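(* Let $\Phi,\Psi$ be two finite simplicial graphs and $\mathcal{G}=\{G_u\mid u\in V(\Phi)\}$, $\mathcal{H}=\{H_v\mid v\in V(\Psi)\}$ two collections of graphically irreducible groups respectively indexed by $V(\Phi), V(\Psi)$. Assume that no two distinct vertices in $\Phi$ are $\prec$-related and that no two distinct vertices in $\Psi$ are $\prec$-related. For every isomorphism $\varphi : \Phi \mathcal{G} \to \Psi \mathcal{H}$, there exist a conjugating automorphism $\alpha \in \mathrm{Aut}(\Phi \mathcal{G})$ and an isometry $s : \Phi \to \Psi$ such that $\varphi \circ \alpha$ sends $G_u$ isomorphically onto $H_{s(u)}$ for every $u \in V(\Phi)$.
   Context: Given a simplicial graph $\Gamma$ and a collection of groups $\mathcal{G}=\{G_u\mid u\in V(\Gamma)\}$, the graph product $\Gamma\mathcal{G}$ is the quotient of the free product of the $G_u$ by the normal closure of all commutators $[g,h]$ with $g\in G_u$, $h\in G_v$, $\{u,v\}\in E(\Gamma)$. The vertex-groups $G_u$ are always assumed non-trivial. A group $K$ is graphically irreducible if, whenever $K$ is isomorphic to a graph product (with non-trivial vertex-groups) over a simplicial graph $\Gamma$, the graph $\Gamma$ is complete. In a graph, $\mathrm{link}(u)$ is the subgraph induced by the neighbors of $u$, $\mathrm{star}(u)$ the subgraph induced by $\mathrm{link}(u)\cup\{u\}$; $u\prec v$ means $\mathrm{link}(u)\subset\mathrm{star}(v)$, and two vertices $u,v$ are $\prec$-related if $u\prec v$ or $v\prec u$. An automorphism of a graph product is conjugating if it sends each vertex-group to a conjugate of a (possibly different)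 vertex-group. An isometry between simplicial graphs is a graph isomorphism. *)

theory Defs
  imports "HOL-Algebra.Coset" "HOL-Algebra.Bij"
begin

section \<open>Simplicial graphs\<close>

record 'v sgraph =
  verts :: "'v set"
  edges :: "'v set set"

text \<open>Graphs may be infinite; finiteness is assumed where it is needed.\<close>

definition simplicial_graph :: "'v sgraph \<Rightarrow> bool" where
  "simplicial_graph \<Gamma> \<longleftrightarrow> (\<forall>e\<in>edges \<Gamma>. e \<subseteq> verts \<Gamma> \<and> card e = 2)"

definition complete_graph :: "'v sgraph \<Rightarrow> bool" where
  "complete_graph \<Gamma> \<longleftrightarrow> (\<forall>u\<in>verts \<Gamma>. \<forall>v\<in>verts \<Gamma>. u \<noteq> v \<longrightarrow> {u, v} \<in> edges \<Gamma>)"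

definition subgraph :: "'v sgraph \<Rightarrow> 'v sgraph \<Rightarrow> bool" where
  "subgraph \<Gamma> \<Delta> \<longleftrightarrow> verts \<Gamma> \<subseteq> verts \<Delta> \<and> edges \<Gamma> \<subseteq> edges \<Delta>"

definition induced_subgraph :: "'v sgraph \<Rightarrow> 'v set \<Rightarrow> 'v sgraph" where
  "induced_subgraph \<Gamma> S = \<lparr>verts = verts \<Gamma> \<inter> S, edges = {e \<in> edges \<Gamma>. e \<subseteq> S}\<rparr>"

definition link :: "'v sgraph \<Rightarrow> 'v \<Rightarrow> 'v sgraph" where
  "link \<Gamma> u = induced_subgraph \<Gamma> {w. {u, w} \<in> edges \<Gamma>}"

definition star :: "'v sgraph \<Rightarrow> 'v \<Rightarrow> 'v sgraph" where
  "star \<Gamma> u = induced_subgraph \<Gamma> (verts (link \<Gamma> u) \<union> {u})"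

definition prec :: "'v sgraph \<Rightarrow> 'v \<Rightarrow> 'v \<Rightarrow> bool" where
  "prec \<Gamma> u v \<longleftrightarrow> subgraph (link \<Gamma> u) (star \<Gamma> v)"

definition prec_related :: "'v sgraph \<Rightarrow> 'v \<Rightarrow> 'v \<Rightarrow> bool" where
  "prec_related \<Gamma> u v \<longleftrightarrow> prec \<Gamma> u v \<or> prec \<Gamma> v u"

definition graph_isometry :: "'v sgraph \<Rightarrow> 'w sgraph \<Rightarrow> ('v \<Rightarrow> 'w) \<Rightarrow> bool" where
  "graph_isometry \<Gamma> \<Delta> s \<longleftrightarrow>
     bij_betw s (verts \<Gamma>) (verts \<Delta>) \<and>
     (\<forall>u\<in>verts \<Gamma>. \<forall>v\<in>verts \<Gamma>. {u, v} \<in> edges \<Gamma> \<longleftrightarrow> {s u, s v} \<in> edges \<Delta>)"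


section \<open>Free products\<close>

text \<open>
  The free product of the groups \<open>G u\<close>, \<open>u \<in> V\<close>, is the set of words in the disjoint union of
  the groups, modulo the smallest congruence for concatenation that multiplies adjacent letters
  of the same group and erases neutral elements.
\<close>

definition words :: "'v set \<Rightarrow> ('v \<Rightarrow> 'a monoid) \<Rightarrow> ('v \<times> 'a) list set" where
  "words V G = lists (SIGMA u:V. carrier (G u))"

inductive word_eq :: "'v set \<Rightarrow> ('v \<Rightarrow> 'a monoid) \<Rightarrow> ('v \<times> 'a) list \<Rightarrow> ('v \<times> 'a) list \<Rightarrow> bool"
  for V G where
  refl: "x \<in> words V G \<Longrightarrow> word_eq V G x x"
| sym: "word_eq V G x y \<Longrightarrow> word_eq V G y x"
| trans: "word_eq V G x y \<Longrightarrow> word_eq V G y z \<Longrightarrow> word_eq V G x z"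
| append: "word_eq V G x x' \<Longrightarrow> word_eq V G y y' \<Longrightarrow> word_eq V G (x @ y) (x' @ y')"
| one: "u \<in> V \<Longrightarrow> word_eq V G [(u, \<one>\<^bsub>G u\<^esub>)] []"
| mult: "u \<in> V \<Longrightarrow> a \<in> carrier (G u) \<Longrightarrow> b \<in> carrier (G u) \<Longrightarrow>
    word_eq V G [(u, a), (u, b)] [(u, a \<otimes>\<^bsub>G u\<^esub> b)]"

definition word_class :: "'v set \<Rightarrow> ('v \<Rightarrow> 'a monoid) \<Rightarrow> ('v \<times> 'a) list \<Rightarrow> ('v \<times> 'a) list set" where
  "word_class V G x = {y. word_eq V G x y}"

definition free_product :: "'v set \<Rightarrow> ('v \<Rightarrow> 'a monoid) \<Rightarrow> ('v \<times> 'a) list set monoid" where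
  "free_product V G =
     \<lparr>carrier = word_class V G ` words V G,
      mult = (\<lambda>A B. \<Union>x\<in>A. \<Union>y\<in>B. word_class V G (x @ y)),
      one = word_class V G []\<rparr>"

definition free_incl :: "'v set \<Rightarrow> ('v \<Rightarrow> 'a monoid) \<Rightarrow> 'v \<Rightarrow> 'a \<Rightarrow> ('v \<times> 'a) list set" where
  "free_incl V G u a = word_class V G [(u, a)]"


section \<open>Graph products\<close>

definition normal_closure :: "('a, 'm) monoid_scheme \<Rightarrow> 'a set \<Rightarrow> 'a set" where
  "normal_closure K S = \<Inter>{N. N \<lhd> K \<and> S \<subseteq> N}"

definition commutator :: "('a, 'm) monoid_scheme \<Rightarrow> 'a \<Rightarrow> 'a \<Rightarrow> 'a" where
  "commutator K g h = g \<otimes>\<^bsub>K\<^esub> h \<otimes>\<^bsub>K\<^esub> inv\<^bsub>K\<^esub> g \<otimes>\<^bsub>K\<^esub> inv\<^bsub>K\<^esub> h"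

definition edge_commutators :: "'v sgraph \<Rightarrow> ('v \<Rightarrow> 'a monoid) \<Rightarrow> ('v \<times> 'a) list set set" where
  "edge_commutators \<Gamma> G =
     {commutator (free_product (verts \<Gamma>) G)
        (free_incl (verts \<Gamma>) G u g) (free_incl (verts \<Gamma>) G v h) | u v g h.
        {u, v} \<in> edges \<Gamma> \<and> g \<in> carrier (G u) \<and> h \<in> carrier (G v)}"

definition edge_relators :: "'v sgraph \<Rightarrow> ('v \<Rightarrow> 'a monoid) \<Rightarrow> ('v \<times> 'a) list set set" where
  "edge_relators \<Gamma> G = normal_closure (free_product (verts \<Gamma>) G) (edge_commutators \<Gamma> G)"

definition graph_product :: "'v sgraph \<Rightarrow> ('v \<Rightarrow> 'a monoid) \<Rightarrow> ('v \<times> 'a) list set set monoid" where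
  "graph_product \<Gamma> G = free_product (verts \<Gamma>) G Mod edge_relators \<Gamma> G"

definition vertex_incl :: "'v sgraph \<Rightarrow> ('v \<Rightarrow> 'a monoid) \<Rightarrow> 'v \<Rightarrow> 'a \<Rightarrow> ('v \<times> 'a) list set set" where
  "vertex_incl \<Gamma> G u a =
     edge_relators \<Gamma> G #>\<^bsub>free_product (verts \<Gamma>) G\<^esub> free_incl (verts \<Gamma>) G u a"

definition vertex_subgroup :: "'v sgraph \<Rightarrow> ('v \<Rightarrow> 'a monoid) \<Rightarrow> 'v \<Rightarrow> ('v \<times> 'a) list set set set" where
  "vertex_subgroup \<Gamma> G u = vertex_incl \<Gamma> G u ` carrier (G u)"

definition vertex_groups :: "'v sgraph \<Rightarrow> ('v \<Rightarrow> 'a monoid) \<Rightarrow> bool" where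
  "vertex_groups \<Gamma> G \<longleftrightarrow> (\<forall>u\<in>verts \<Gamma>. group (G u) \<and> carrier (G u) \<noteq> {\<one>\<^bsub>G u\<^esub>})"

text \<open>
  A definition cannot quantify over the types of the vertices and of the elements of the
  vertex-groups, so both are taken to be the type of the elements of \<open>K\<close>. This is no restriction:
  see \<open>graphically_irreducible_complete\<close> below.
\<close>

definition graphically_irreducible :: "'a monoid \<Rightarrow> bool" where
  "graphically_irreducible K \<longleftrightarrow>
     (\<forall>(\<Gamma> :: 'a sgraph) (G :: 'a \<Rightarrow> 'a monoid).
        simplicial_graph \<Gamma> \<and> vertex_groups \<Gamma> G \<and> K \<cong> graph_product \<Gamma> G \<longrightarrow> complete_graph \<Gamma>)"

definition conjugate_subgroup :: "('a, 'm) monoid_scheme \<Rightarrow> 'a \<Rightarrow> 'a set \<Rightarrow> 'a set" where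
  "conjugate_subgroup K g S = (\<lambda>x. g \<otimes>\<^bsub>K\<^esub> x \<otimes>\<^bsub>K\<^esub> inv\<^bsub>K\<^esub> g) ` S"

definition conjugating ::
  "'v sgraph \<Rightarrow> ('v \<Rightarrow> 'a monoid) \<Rightarrow> (('v \<times> 'a) list set set \<Rightarrow> ('v \<times> 'a) list set set) \<Rightarrow> bool" where
  "conjugating \<Gamma> G \<alpha> \<longleftrightarrow>
     (\<forall>u\<in>verts \<Gamma>. \<exists>v\<in>verts \<Gamma>. \<exists>g\<in>carrier (graph_product \<Gamma> G).
        \<alpha> ` vertex_subgroup \<Gamma> G u =
          conjugate_subgroup (graph_product \<Gamma> G) g (vertex_subgroup \<Gamma> G v))"


section \<open>Basic facts\<close>

lemma word_eq_words: "word_eq V G x y \<Longrightarrow> \<forall>u\<in>V. group (G u) \<Longrightarrow> x \<in> words V G \<and> y \<in> words V G"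
proof (induction rule: word_eq.induct)
  case (one u)
  then interpret group "G u" by blast
  show ?case using one.hyps by (simp add: words_def)
next
  case (mult u a b)
  then interpret group "G u" by blast
  show ?case using mult.hyps by (simp add: words_def)
next
  case (append x x' y y')
  then show ?case by (simp add: words_def)
qed blast+

lemma word_class_eq_iff:
  assumes "y \<in> words V G"
  shows "word_class V G x = word_class V G y \<longleftrightarrow> word_eq V G x y"
  unfolding word_class_def set_eq_iff mem_Collect_eq
  by (meson assms word_eq.refl word_eq.sym word_eq.trans)

lemma word_class_mult:
  assumes "x \<in> words V G" "y \<in> words V G"
  shows "word_class V G x \<otimes>\<^bsub>free_product V G\<^esub> word_class V G y = word_class V G (x @ y)"
proof -
  have *: "word_class V G (x' @ y') = word_class V G (x @ y)"
    if "x' \<in> word_class V G x" "y' \<in> word_class V G y" for x' y'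
  proof -
    have "x @ y \<in> words V G"
      using assms by (simp add: words_def)
    moreover have "word_eq V G (x' @ y') (x @ y)"
      using that by (auto simp: word_class_def intro: word_eq.append word_eq.sym)
    ultimately show ?thesis
      by (simp add: word_class_eq_iff)
  qed
  have "x \<in> word_class V G x" "y \<in> word_class V G y"
    using assms by (auto simp: word_class_def intro: word_eq.refl)
  then have ne: "word_class V G x \<noteq> {}" "word_class V G y \<noteq> {}"
    by blast+
  have "(\<Union>x'\<in>word_class V G x. \<Union>y'\<in>word_class V G y. word_class V G (x' @ y')) =
      (\<Union>x'\<in>word_class V G x. \<Union>y'\<in>word_class V G y. word_class V G (x @ y))"
    using * by (intro SUP_cong HOL.refl)
  then show ?thesis
    by (simp add: free_product_def ne)
qed

lemma words_Nil: "[] \<in> words V G"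
  by (simp add: words_def)

lemma words_append: "x \<in> words V G \<Longrightarrow> y \<in> words V G \<Longrightarrow> x @ y \<in> words V G"
  by (simp add: words_def)

lemma word_inverse_ex:
  assumes "\<forall>u\<in>V. group (G u)" "x \<in> words V G"
  shows "\<exists>y\<in>words V G. word_eq V G (y @ x) []"
  using assms(2)
proof (induction x)
  case Nil
  then show ?case
    using words_Nil[of V G] word_eq.refl[OF words_Nil, of V G] by (intro bexI[of _ "[]"]) simp_all
next
  case (Cons p x)
  obtain u a where p: "p = (u, a)" "u \<in> V" "a \<in> carrier (G u)"
    using Cons.prems by (cases p) (auto simp: words_def)
  interpret group "G u" using assms p by blast
  have x: "x \<in> words V G" using Cons.prems by (auto simp: words_def)
  then obtain y where y: "y \<in> words V G" "word_eq V G (y @ x) []"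
    using Cons.IH by blast
  let ?b = "inv\<^bsub>G u\<^esub> a"
  have "word_eq V G [(u, ?b), (u, a)] []"
    using word_eq.trans[OF word_eq.mult[of u V ?b G a], of "[]"] word_eq.one[of u V G] p
    by simp
  then have "word_eq V G (y @ [(u, ?b), (u, a)] @ x) (y @ [] @ x)"
    using word_eq.append[OF word_eq.refl[OF y(1)] word_eq.append[OF _ word_eq.refl[OF x]]] by blast
  then have "word_eq V G ((y @ [(u, ?b)]) @ p # x) (y @ x)"
    using p(1) by simp
  then have "word_eq V G ((y @ [(u, ?b)]) @ p # x) []"
    using y(2) by (rule word_eq.trans)
  moreover have "y @ [(u, ?b)] \<in> words V G"
    using y(1) p by (simp add: words_def)
  ultimately show ?case by blast
qed

lemma group_free_product:
  assumes "\<forall>u\<in>V. group (G u)"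
  shows "group (free_product V G)"
proof (rule groupI)
  let ?F = "free_product V G"
  have carr: "carrier ?F = word_class V G ` words V G" and one: "\<one>\<^bsub>?F\<^esub> = word_class V G []"
    by (simp_all add: free_product_def)
  show "\<one>\<^bsub>?F\<^esub> \<in> carrier ?F"
    unfolding carr one using words_Nil by blast
  fix A assume "A \<in> carrier ?F"
  then obtain x where x: "x \<in> words V G" "A = word_class V G x"
    unfolding carr by blast
  show "\<one>\<^bsub>?F\<^esub> \<otimes>\<^bsub>?F\<^esub> A = A"
    unfolding one x(2) word_class_mult[OF words_Nil x(1)] by simp
  obtain y where y: "y \<in> words V G" "word_eq V G (y @ x) []"
    using word_inverse_ex[OF assms x(1)] by blast
  have "word_class V G y \<otimes>\<^bsub>?F\<^esub> A = \<one>\<^bsub>?F\<^esub>"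
    unfolding one x(2) word_class_mult[OF y(1) x(1)]
    using y(2) by (simp add: word_class_eq_iff words_Nil)
  then show "\<exists>B\<in>carrier ?F. B \<otimes>\<^bsub>?F\<^esub> A = \<one>\<^bsub>?F\<^esub>"
    unfolding carr using y(1) by blast
  fix B assume "B \<in> carrier ?F"
  then obtain y where y: "y \<in> words V G" "B = word_class V G y"
    unfolding carr by blast
  show "A \<otimes>\<^bsub>?F\<^esub> B \<in> carrier ?F"
    unfolding x(2) y(2) word_class_mult[OF x(1) y(1)] carr
    using words_append[OF x(1) y(1)] by blast
  fix C assume "C \<in> carrier ?F"
  then obtain z where z: "z \<in> words V G" "C = word_class V G z"
    unfolding carr by blast
  show "A \<otimes>\<^bsub>?F\<^esub> B \<otimes>\<^bsub>?F\<^esub> C = A \<otimes>\<^bsub>?F\<^esub> (B \<otimes>\<^bsub>?F\<^esub> C)"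
    by (simp add: x y z word_class_mult words_append)
qed

lemma free_incl_hom:
  assumes "\<forall>u\<in>V. group (G u)" "u \<in> V"
  shows "free_incl V G u \<in> hom (G u) (free_product V G)"
proof (rule homI)
  interpret group "G u" using assms by blast
  fix a b assume a: "a \<in> carrier (G u)" and b: "b \<in> carrier (G u)"
  then have w: "[(u, a)] \<in> words V G" "[(u, b)] \<in> words V G" "[(u, a \<otimes>\<^bsub>G u\<^esub> b)] \<in> words V G"
    using assms(2) by (simp_all add: words_def)
  show "free_incl V G u a \<in> carrier (free_product V G)"
    using w(1) by (simp add: free_product_def free_incl_def)
  show "free_incl V G u (a \<otimes>\<^bsub>G u\<^esub> b) =
      free_incl V G u a \<otimes>\<^bsub>free_product V G\<^esub> free_incl V G u b"
    using word_eq.mult[of u V a G b, OF assms(2) a b]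
      word_class_eq_iff[OF w(3), of "[(u, a), (u, b)]"] word_class_mult[OF w(1,2)]
    by (simp add: free_incl_def)
qed

lemma free_product_universal:
  assumes G: "\<forall>u\<in>V. group (G u)" and H: "group H"
    and f: "\<And>u. u \<in> V \<Longrightarrow> f u \<in> hom (G u) H"
  obtains h where "h \<in> hom (free_product V G) H"
    "\<And>u a. u \<in> V \<Longrightarrow> a \<in> carrier (G u) \<Longrightarrow> h (free_incl V G u a) = f u a"
proof -
  interpret H: group H by fact
  define ev where "ev w = foldr (\<lambda>(u, a) r. f u a \<otimes>\<^bsub>H\<^esub> r) w \<one>\<^bsub>H\<^esub>" for w
  have fc: "f u a \<in> carrier H" if "u \<in> V" "a \<in> carrier (G u)" for u a
    using f[OF that(1)] that(2) by (auto simp: hom_def)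
  have evc: "ev w \<in> carrier H" if "w \<in> words V G" for w
    using that by (induction w) (auto simp: ev_def words_def fc)
  have evapp: "ev (x @ y) = ev x \<otimes>\<^bsub>H\<^esub> ev y" if "x \<in> words V G" "y \<in> words V G" for x y
    using that(1)
  proof (induction x)
    case Nil
    then show ?case using evc[OF that(2)] by (simp add: ev_def)
  next
    case (Cons p x)
    then obtain u a where p: "p = (u, a)" "u \<in> V" "a \<in> carrier (G u)" "x \<in> words V G"
      by (cases p) (auto simp: words_def)
    have ev_p: "ev (p # w) = f u a \<otimes>\<^bsub>H\<^esub> ev w" for w
      by (simp add: ev_def p(1))
    show ?case
      using Cons.IH[OF p(4)] fc[OF p(2,3)] evc[OF p(4)] evc[OF that(2)]
      by (simp add: ev_p H.m_assoc)
  qed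
  have evresp: "ev x = ev y" if "word_eq V G x y" for x y
    using that
  proof (induction rule: word_eq.induct)
    case (append x x' y y')
    then show ?case
      using word_eq_words[OF append.hyps(1) G] word_eq_words[OF append.hyps(2) G]
      by (simp add: evapp)
  next
    case (one u)
    then show ?case
      using hom_one[OF f[OF one] bspec[OF G one] H] by (simp add: ev_def)
  next
    case (mult u a b)
    then show ?case
      using hom_mult[OF f[OF mult(1)] mult(2,3)] fc by (simp add: ev_def H.m_assoc)
  qed auto
  define h where "h A = ev (SOME x. x \<in> A)" for A
  have h: "h (word_class V G x) = ev x" if "x \<in> words V G" for x
  proof -
    have "x \<in> word_class V G x"
      using that by (simp add: word_class_def word_eq.refl)
    then have "(SOME y. y \<in> word_class V G x) \<in> word_class V G x"
      by (rule someI)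
    then show ?thesis
      unfolding h_def word_class_def using evresp by force
  qed
  show thesis
  proof
    show "h \<in> hom (free_product V G) H"
    proof (rule homI)
      fix A assume "A \<in> carrier (free_product V G)"
      then obtain x where x: "x \<in> words V G" "A = word_class V G x"
        by (auto simp: free_product_def)
      show "h A \<in> carrier H" by (simp add: x h evc)
      fix B assume "B \<in> carrier (free_product V G)"
      then obtain y where y: "y \<in> words V G" "B = word_class V G y"
        by (auto simp: free_product_def)
      show "h (A \<otimes>\<^bsub>free_product V G\<^esub> B) = h A \<otimes>\<^bsub>H\<^esub> h B"
        by (simp add: x y word_class_mult h words_append evapp)
    qed
    fix u a assume u: "u \<in> V" "a \<in> carrier (G u)"
    then have "[(u, a)] \<in> words V G" by (simp add: words_def)
    then show "h (free_incl V G u a) = f u a"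
      using fc[OF u] by (simp add: free_incl_def h) (simp add: ev_def)
  qed
qed

lemma free_product_hom_eq:
  assumes G: "\<forall>u\<in>V. group (G u)" and H: "group H"
    and h: "h \<in> hom (free_product V G) H" and k: "k \<in> hom (free_product V G) H"
    and eq: "\<And>u a. u \<in> V \<Longrightarrow> a \<in> carrier (G u) \<Longrightarrow> h (free_incl V G u a) = k (free_incl V G u a)"
    and A: "A \<in> carrier (free_product V G)"
  shows "h A = k A"
proof -
  have "h (word_class V G x) = k (word_class V G x)" if "x \<in> words V G" for x
    using that
  proof (induction x)
    case Nil
    have "\<one>\<^bsub>free_product V G\<^esub> = word_class V G []" by (simp add: free_product_def)
    then show ?case
      using hom_one[OF h group_free_product[OF G] H] hom_one[OF k group_free_product[OF G] H] by simp
  next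
    case (Cons p x)
    then obtain u a where p: "p = (u, a)" "u \<in> V" "a \<in> carrier (G u)" and x: "x \<in> words V G"
      by (cases p) (auto simp: words_def)
    have w: "[(u, a)] \<in> words V G" using p by (simp add: words_def)
    have "word_class V G (p # x) = free_incl V G u a \<otimes>\<^bsub>free_product V G\<^esub> word_class V G x"
      using word_class_mult[OF w x] by (simp add: free_incl_def p)
    moreover have "free_incl V G u a \<in> carrier (free_product V G)"
      "word_class V G x \<in> carrier (free_product V G)"
      using w x by (auto simp: free_incl_def free_product_def)
    ultimately show ?case
      using Cons.IH[OF x] eq[OF p(2,3)] hom_mult[OF h] hom_mult[OF k] by metis
  qed
  then show ?thesis
    using A by (auto simp: free_product_def)
qed

lemma normal_closure_normal:
  assumes "group K" "S \<subseteq> carrier K"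
  shows "normal_closure K S \<lhd> K"
proof -
  interpret group K by fact
  let ?N = "{N. N \<lhd> K \<and> S \<subseteq> N}"
  have "carrier K \<lhd> K"
    by (rule normal_invI[OF subgroup_self]) simp
  then have "carrier K \<in> ?N" using assms by blast
  moreover have "\<And>N. N \<in> ?N \<Longrightarrow> subgroup N K" by (simp add: normal_imp_subgroup)
  ultimately have "subgroup (\<Inter>?N) K"
    by (intro subgroups_Inter) auto
  then show ?thesis
    unfolding normal_closure_def
    by (rule normal_invI) (auto simp: normal_inv_iff)
qed

lemma normal_closure_superset: "S \<subseteq> normal_closure K S"
  unfolding normal_closure_def by blast

lemma normal_closure_least: "N \<lhd> K \<Longrightarrow> S \<subseteq> N \<Longrightarrow> normal_closure K S \<subseteq> N"
  unfolding normal_closure_def by blast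

lemma commutator_eq_one_iff:
  assumes "group K" "x \<in> carrier K" "y \<in> carrier K"
  shows "commutator K x y = \<one>\<^bsub>K\<^esub> \<longleftrightarrow> x \<otimes>\<^bsub>K\<^esub> y = y \<otimes>\<^bsub>K\<^esub> x"
proof -
  interpret group K by fact
  have "commutator K x y = (x \<otimes>\<^bsub>K\<^esub> y) \<otimes>\<^bsub>K\<^esub> inv\<^bsub>K\<^esub> (y \<otimes>\<^bsub>K\<^esub> x)"
    using assms by (simp add: commutator_def inv_mult_group m_assoc)
  then show ?thesis
    using assms by (metis inv_closed inv_equality inv_inv m_closed r_inv)
qed

lemma simplicial_edgeD:
  assumes "simplicial_graph \<Gamma>" "{u, v} \<in> edges \<Gamma>"
  shows "u \<in> verts \<Gamma>" "v \<in> verts \<Gamma>" "u \<noteq> v"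
  using assms by (auto simp: simplicial_graph_def)

context
  fixes \<Gamma> :: "'v sgraph" and G :: "'v \<Rightarrow> 'a monoid"
  assumes simp_graph: "simplicial_graph \<Gamma>" and grp: "\<forall>u\<in>verts \<Gamma>. group (G u)"
begin

private abbreviation "F \<equiv> free_product (verts \<Gamma>) G"

lemma edge_relators_normal: "edge_relators \<Gamma> G \<lhd> F"
  unfolding edge_relators_def
proof (rule normal_closure_normal)
  interpret F: group F by (rule group_free_product[OF grp])
  show "group F" by (rule F.is_group)
  have "commutator F (free_incl (verts \<Gamma>) G u g) (free_incl (verts \<Gamma>) G v h) \<in> carrier F"
    if "{u, v} \<in> edges \<Gamma>" "g \<in> carrier (G u)" "h \<in> carrier (G v)" for u v g h
    using that simplicial_edgeD[OF simp_graph that(1)]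
      hom_in_carrier[OF free_incl_hom[OF grp]] by (simp add: commutator_def)
  then show "edge_commutators \<Gamma> G \<subseteq> carrier F"
    by (auto simp: edge_commutators_def)
qed

lemma group_graph_product: "group (graph_product \<Gamma> G)"
  unfolding graph_product_def by (rule normal.factorgroup_is_group[OF edge_relators_normal])

lemma vertex_incl_hom:
  assumes "u \<in> verts \<Gamma>"
  shows "vertex_incl \<Gamma> G u \<in> hom (G u) (graph_product \<Gamma> G)"
proof -
  have "vertex_incl \<Gamma> G u = (\<lambda>x. edge_relators \<Gamma> G #>\<^bsub>F\<^esub> x) \<circ> free_incl (verts \<Gamma>) G u"
    by (auto simp: vertex_incl_def)
  then show ?thesis
    unfolding graph_product_def
    using hom_compose[OF free_incl_hom[OF grp assms] normal.r_coset_hom_Mod[OF edge_relators_normal]]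
    by metis
qed

lemma vertex_incl_commute:
  assumes e: "{u, v} \<in> edges \<Gamma>" and g: "g \<in> carrier (G u)" and h: "h \<in> carrier (G v)"
  shows "vertex_incl \<Gamma> G u g \<otimes>\<^bsub>graph_product \<Gamma> G\<^esub> vertex_incl \<Gamma> G v h =
    vertex_incl \<Gamma> G v h \<otimes>\<^bsub>graph_product \<Gamma> G\<^esub> vertex_incl \<Gamma> G u g"
proof -
  interpret F: group F by (rule group_free_product[OF grp])
  interpret N: normal "edge_relators \<Gamma> G" F by (rule edge_relators_normal)
  let ?x = "free_incl (verts \<Gamma>) G u g" and ?y = "free_incl (verts \<Gamma>) G v h"
  have c: "?x \<in> carrier F" "?y \<in> carrier F"
    using simplicial_edgeD[OF simp_graph e] g h hom_in_carrier[OF free_incl_hom[OF grp]] by auto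
  have "commutator F ?x ?y \<in> edge_relators \<Gamma> G"
    unfolding edge_relators_def
    by (rule subsetD[OF normal_closure_superset]) (use assms in \<open>auto simp: edge_commutators_def\<close>)
  moreover have "commutator F ?x ?y = (?x \<otimes>\<^bsub>F\<^esub> ?y) \<otimes>\<^bsub>F\<^esub> inv\<^bsub>F\<^esub> (?y \<otimes>\<^bsub>F\<^esub> ?x)"
    using c by (simp add: commutator_def F.inv_mult_group F.m_assoc)
  ultimately have "edge_relators \<Gamma> G #>\<^bsub>F\<^esub> (?x \<otimes>\<^bsub>F\<^esub> ?y) = edge_relators \<Gamma> G #>\<^bsub>F\<^esub> (?y \<otimes>\<^bsub>F\<^esub> ?x)"
    using c by (metis F.m_closed F.repr_independence N.rcos_module N.subgroup_axioms F.is_group)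
  then show ?thesis
    using c by (simp add: graph_product_def vertex_incl_def N.rcos_sum)
qed

lemma graph_product_universal:
  assumes H: "group H" and f: "\<And>u. u \<in> verts \<Gamma> \<Longrightarrow> f u \<in> hom (G u) H"
    and comm: "\<And>u v a b. {u, v} \<in> edges \<Gamma> \<Longrightarrow> a \<in> carrier (G u) \<Longrightarrow> b \<in> carrier (G v) \<Longrightarrow>
      f u a \<otimes>\<^bsub>H\<^esub> f v b = f v b \<otimes>\<^bsub>H\<^esub> f u a"
  obtains h where "h \<in> hom (graph_product \<Gamma> G) H"
    "\<And>u a. u \<in> verts \<Gamma> \<Longrightarrow> a \<in> carrier (G u) \<Longrightarrow> h (vertex_incl \<Gamma> G u a) = f u a"
proof -
  obtain k where k: "k \<in> hom F H"
    "\<And>u a. u \<in> verts \<Gamma> \<Longrightarrow> a \<in> carrier (G u) \<Longrightarrow> k (free_incl (verts \<Gamma>) G u a) = f u a"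
    using free_product_universal[OF grp H f] by metis
  interpret F: group F by (rule group_free_product[OF grp])
  interpret H: group H by fact
  interpret k: group_hom F H k
    by (unfold_locales) (rule k(1))
  have "edge_commutators \<Gamma> G \<subseteq> kernel F H k"
  proof
    fix x assume "x \<in> edge_commutators \<Gamma> G"
    then obtain u v a b where *: "{u, v} \<in> edges \<Gamma>" "a \<in> carrier (G u)" "b \<in> carrier (G v)"
      and x: "x = commutator F (free_incl (verts \<Gamma>) G u a) (free_incl (verts \<Gamma>) G v b)"
      by (auto simp: edge_commutators_def)
    note uv = simplicial_edgeD[OF simp_graph *(1)]
    have c: "free_incl (verts \<Gamma>) G u a \<in> carrier F" "free_incl (verts \<Gamma>) G v b \<in> carrier F"
      using uv * hom_in_carrier[OF free_incl_hom[OF grp]] by auto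
    have fc: "f u a \<in> carrier H" "f v b \<in> carrier H"
      using uv * hom_in_carrier[OF f] by auto
    have "k x = commutator H (f u a) (f v b)"
      using c uv * by (simp add: x commutator_def k(2))
    also have "\<dots> = \<one>\<^bsub>H\<^esub>"
      using commutator_eq_one_iff[OF H fc] comm[OF *] by simp
    finally show "x \<in> kernel F H k"
      using c by (simp add: kernel_def x commutator_def)
  qed
  then have "edge_relators \<Gamma> G \<subseteq> kernel F H k"
    unfolding edge_relators_def using k.normal_kernel by (rule normal_closure_least[rotated])
  then obtain h where h: "h \<in> hom (F Mod edge_relators \<Gamma> G) H"
    "\<And>x. x \<in> carrier F \<Longrightarrow> h (edge_relators \<Gamma> G #>\<^bsub>F\<^esub> x) = k x"
    using k.FactGroup_universal_kernel[OF edge_relators_normal] by metis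
  show thesis
  proof
    show "h \<in> hom (graph_product \<Gamma> G) H" using h(1) by (simp add: graph_product_def)
    show "h (vertex_incl \<Gamma> G u a) = f u a" if "u \<in> verts \<Gamma>" "a \<in> carrier (G u)" for u a
      using h(2)[OF hom_in_carrier[OF free_incl_hom[OF grp that(1)] that(2)]] k(2)[OF that]
      by (simp add: vertex_incl_def)
  qed
qed

lemma graph_product_hom_eq:
  assumes H: "group H" and h: "h \<in> hom (graph_product \<Gamma> G) H" and k: "k \<in> hom (graph_product \<Gamma> G) H"
    and eq: "\<And>u a. u \<in> verts \<Gamma> \<Longrightarrow> a \<in> carrier (G u) \<Longrightarrow>
      h (vertex_incl \<Gamma> G u a) = k (vertex_incl \<Gamma> G u a)"
    and x: "x \<in> carrier (graph_product \<Gamma> G)"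
  shows "h x = k x"
proof -
  let ?q = "\<lambda>x. edge_relators \<Gamma> G #>\<^bsub>F\<^esub> x"
  have q: "?q \<in> hom F (graph_product \<Gamma> G)"
    unfolding graph_product_def by (rule normal.r_coset_hom_Mod[OF edge_relators_normal])
  obtain y where y: "y \<in> carrier F" "x = ?q y"
    using x by (auto simp: graph_product_def carrier_FactGroup)
  have "(h \<circ> ?q) y = (k \<circ> ?q) y"
    by (rule free_product_hom_eq[OF grp H hom_compose[OF q h] hom_compose[OF q k] _ y(1)])
      (use eq in \<open>simp add: vertex_incl_def\<close>)
  then show ?thesis by (simp add: y(2))
qed

lemma vertex_retraction:
  assumes u: "u \<in> verts \<Gamma>"
  obtains r where "r \<in> hom (graph_product \<Gamma> G) (G u)"
    "\<And>a. a \<in> carrier (G u) \<Longrightarrow> r (vertex_incl \<Gamma> G u a) = a"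
    "\<And>v b. v \<in> verts \<Gamma> \<Longrightarrow> v \<noteq> u \<Longrightarrow> b \<in> carrier (G v) \<Longrightarrow> r (vertex_incl \<Gamma> G v b) = \<one>\<^bsub>G u\<^esub>"
proof -
  interpret group "G u" using grp u by blast
  define f where "f v a = (if v = u then a else \<one>\<^bsub>G u\<^esub>)" for v a
  have "f v \<in> hom (G v) (G u)" for v
    by (rule homI) (auto simp: f_def)
  moreover have "f v a \<otimes>\<^bsub>G u\<^esub> f w b = f w b \<otimes>\<^bsub>G u\<^esub> f v a"
    if "{v, w} \<in> edges \<Gamma>" "a \<in> carrier (G v)" "b \<in> carrier (G w)" for v w a b
    using simplicial_edgeD[OF simp_graph that(1)] that by (auto simp: f_def)
  ultimately obtain r where r: "r \<in> hom (graph_product \<Gamma> G) (G u)"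
    "\<And>v a. v \<in> verts \<Gamma> \<Longrightarrow> a \<in> carrier (G v) \<Longrightarrow> r (vertex_incl \<Gamma> G v a) = f v a"
    using graph_product_universal[of "G u" f] is_group by metis
  show thesis
    by (rule that[OF r(1)]) (use r(2) u in \<open>auto simp: f_def\<close>)
qed

end

text \<open>
  Graphical irreducibility does not depend on the types of vertices and vertex-group elements.
\<close>

theorem graphically_irreducible_complete:
  fixes \<Gamma> :: "'v sgraph" and G :: "'v \<Rightarrow> 'b monoid" and K :: "'a monoid"
  assumes K: "group K" and irr: "graphically_irreducible K"
    and \<Gamma>: "simplicial_graph \<Gamma>" and G: "vertex_groups \<Gamma> G"
    and iso: "K \<cong> graph_product \<Gamma> G"
  shows "complete_graph \<Gamma>"
proof -
  interpret K: group K by fact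
  have grp: "\<forall>u\<in>verts \<Gamma>. group (G u)" using G by (simp add: vertex_groups_def)
  let ?P = "graph_product \<Gamma> G"
  interpret P: group ?P by (rule group_graph_product[OF \<Gamma> grp])
  obtain \<phi> where \<phi>: "\<phi> \<in> Group.iso ?P K"
    using K.iso_sym[OF iso] by (auto simp: is_iso_def)
  then have \<phi>h: "\<phi> \<in> hom ?P K" and \<phi>b: "bij_betw \<phi> (carrier ?P) (carrier K)"
    by (auto simp: iso_def)
  interpret \<phi>: group_hom ?P K \<phi> by unfold_locales (rule \<phi>h)
  define j where "j u a = \<phi> (vertex_incl \<Gamma> G u a)" for u a
  have incl_c: "vertex_incl \<Gamma> G u a \<in> carrier ?P" if "u \<in> verts \<Gamma>" "a \<in> carrier (G u)" for u a
    using hom_in_carrier[OF vertex_incl_hom[OF \<Gamma> grp that(1)] that(2)] .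
  have j_hom: "j u \<in> hom (G u) K" if "u \<in> verts \<Gamma>" for u
    using hom_compose[OF vertex_incl_hom[OF \<Gamma> grp that] \<phi>h] by (simp add: j_def[abs_def] o_def)
  have j_c: "j u a \<in> carrier K" if "u \<in> verts \<Gamma>" "a \<in> carrier (G u)" for u a
    using hom_in_carrier[OF j_hom[OF that(1)] that(2)] .
  have j_eq: "vertex_incl \<Gamma> G u a = vertex_incl \<Gamma> G v b"
    if "u \<in> verts \<Gamma>" "a \<in> carrier (G u)" "v \<in> verts \<Gamma>" "b \<in> carrier (G v)" "j u a = j v b" for u a v b
    using \<phi>b that incl_c unfolding j_def bij_betw_def inj_on_def by blast
  have j_inj: "a = b" if "u \<in> verts \<Gamma>" "a \<in> carrier (G u)" "b \<in> carrier (G u)" "j u a = j u b" for u a b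
    using vertex_retraction[OF \<Gamma> grp that(1)] j_eq[OF that(1,2,1,3,4)] that(2,3) by metis
  have "\<exists>a\<in>carrier (G u). a \<noteq> \<one>\<^bsub>G u\<^esub>" if "u \<in> verts \<Gamma>" for u
    using G that group.is_monoid monoid.one_closed unfolding vertex_groups_def
    by (metis empty_iff singletonI subsetI subset_singletonD insert_iff)
  then obtain c where c: "\<And>u. u \<in> verts \<Gamma> \<Longrightarrow> c u \<in> carrier (G u) \<and> c u \<noteq> \<one>\<^bsub>G u\<^esub>"
    by metis
  define i where "i u = j u (c u)" for u
  have i_inj: "inj_on i (verts \<Gamma>)"
  proof (rule inj_onI, rule ccontr)
    fix u v assume uv: "u \<in> verts \<Gamma>" "v \<in> verts \<Gamma>" "i u = i v" "u \<noteq> v"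
    then have "vertex_incl \<Gamma> G u (c u) = vertex_incl \<Gamma> G v (c v)"
      using j_eq c unfolding i_def by metis
    then show False
      using vertex_retraction[OF \<Gamma> grp uv(1)] uv(2,4) c[OF uv(1)] c[OF uv(2)] by metis
  qed
  define \<Delta> where "\<Delta> = \<lparr>verts = i ` verts \<Gamma>, edges = (`) i ` edges \<Gamma>\<rparr>"
  define p where "p = inv_into (verts \<Gamma>) i"
  have p: "p (i u) = u" if "u \<in> verts \<Gamma>" for u
    using i_inj that by (simp add: p_def)
  define H where "H x = K\<lparr>carrier := j (p x) ` carrier (G (p x))\<rparr>" for x
  have H_sub: "subgroup (j u ` carrier (G u)) K" if "u \<in> verts \<Gamma>" for u
  proof -
    interpret group_hom "G u" K "j u"
      using that grp K j_hom[OF that] by (simp add: group_hom_def group_hom_axioms_def)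
    show ?thesis by (rule img_is_subgroup)
  qed
  have Hi: "H (i u) = K\<lparr>carrier := j u ` carrier (G u)\<rparr>" if "u \<in> verts \<Gamma>" for u
    using that by (simp add: H_def p)
  have edge_sub: "e \<subseteq> verts \<Gamma>" "card e = 2" if "e \<in> edges \<Gamma>" for e
    using \<Gamma> that by (auto simp: simplicial_graph_def)
  have \<Delta>: "simplicial_graph \<Delta>"
    unfolding simplicial_graph_def \<Delta>_def
    using edge_sub card_image[OF inj_on_subset[OF i_inj]] by fastforce
  have H: "vertex_groups \<Delta> H"
    unfolding vertex_groups_def
  proof
    fix x assume "x \<in> verts \<Delta>"
    then obtain u where u: "u \<in> verts \<Gamma>" "x = i u" by (auto simp: \<Delta>_def)
    interpret Gu: group "G u" using grp u(1) by blast
    have "j u \<one>\<^bsub>G u\<^esub> = \<one>\<^bsub>K\<^esub>"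
      using hom_one[OF j_hom[OF u(1)] Gu.is_group K] .
    then have "j u (c u) \<noteq> \<one>\<^bsub>K\<^esub>"
      using j_inj[OF u(1)] c[OF u(1)] Gu.one_closed by metis
    then show "group (H x) \<and> carrier (H x) \<noteq> {\<one>\<^bsub>H x\<^esub>}"
      using subgroup.subgroup_is_group[OF H_sub[OF u(1)] K] c[OF u(1)]
      by (auto simp: u(2) Hi[OF u(1)])
  qed
  then have grpH: "\<forall>x\<in>verts \<Delta>. group (H x)" by (simp add: vertex_groups_def)
  let ?Q = "graph_product \<Delta> H"
  interpret Q: group ?Q by (rule group_graph_product[OF \<Delta> grpH])
  have \<Delta>_edge: "{i u, i v} \<in> edges \<Delta> \<longleftrightarrow> {u, v} \<in> edges \<Gamma>"
    if "u \<in> verts \<Gamma>" "v \<in> verts \<Gamma>" for u v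
  proof -
    have "{i u, i v} = i ` {u, v}" by simp
    then show ?thesis
      unfolding \<Delta>_def using that edge_sub inj_on_image_eq_iff[OF i_inj]
      by (auto simp del: image_insert) 
  qed

  obtain A where A: "A \<in> hom ?Q K"
    "\<And>x k. x \<in> verts \<Delta> \<Longrightarrow> k \<in> carrier (H x) \<Longrightarrow> A (vertex_incl \<Delta> H x k) = k"
  proof (rule graph_product_universal[OF \<Delta> grpH K, of "\<lambda>x k. k"])
    show "(\<lambda>k. k) \<in> hom (H x) K" if "x \<in> verts \<Delta>" for x
      using that Hi j_c by (auto simp: \<Delta>_def hom_def)
    fix x y k l assume xy: "{x, y} \<in> edges \<Delta>" "k \<in> carrier (H x)" "l \<in> carrier (H y)"
    obtain u v where uv: "u \<in> verts \<Gamma>" "v \<in> verts \<Gamma>" "x = i u" "y = i v"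
      using simplicial_edgeD[OF \<Delta> xy(1)] by (auto simp: \<Delta>_def)
    then obtain a b where ab: "a \<in> carrier (G u)" "b \<in> carrier (G v)" "k = j u a" "l = j v b"
      using xy(2,3) Hi by auto
    have "{u, v} \<in> edges \<Gamma>" using xy(1) \<Delta>_edge[OF uv(1,2)] uv(3,4) by simp
    from vertex_incl_commute[OF \<Gamma> grp this ab(1,2)]
    show "k \<otimes>\<^bsub>K\<^esub> l = l \<otimes>\<^bsub>K\<^esub> k"
      unfolding ab(3,4) j_def using incl_c uv ab by (metis \<phi>.hom_mult)
  qed blast
  obtain B where B: "B \<in> hom ?P ?Q"
    "\<And>u a. u \<in> verts \<Gamma> \<Longrightarrow> a \<in> carrier (G u) \<Longrightarrow> B (vertex_incl \<Gamma> G u a) = vertex_incl \<Delta> H (i u) (j u a)"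
  proof (rule graph_product_universal[OF \<Gamma> grp Q.is_group, of "\<lambda>u a. vertex_incl \<Delta> H (i u) (j u a)"])
    show "(\<lambda>a. vertex_incl \<Delta> H (i u) (j u a)) \<in> hom (G u) ?Q" if u: "u \<in> verts \<Gamma>" for u
    proof -
      have "j u \<in> hom (G u) (H (i u))"
        using j_hom[OF u] by (auto simp: Hi[OF u] hom_def)
      moreover have "vertex_incl \<Delta> H (i u) \<in> hom (H (i u)) ?Q"
        by (rule vertex_incl_hom[OF \<Delta> grpH]) (use u in \<open>simp add: \<Delta>_def\<close>)
      ultimately show ?thesis
        using hom_compose by (fastforce simp: o_def)
    qed
    fix u v a b assume *: "{u, v} \<in> edges \<Gamma>" "a \<in> carrier (G u)" "b \<in> carrier (G v)"
    note uv = simplicial_edgeD[OF \<Gamma> *(1)]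
    show "vertex_incl \<Delta> H (i u) (j u a) \<otimes>\<^bsub>?Q\<^esub> vertex_incl \<Delta> H (i v) (j v b) =
      vertex_incl \<Delta> H (i v) (j v b) \<otimes>\<^bsub>?Q\<^esub> vertex_incl \<Delta> H (i u) (j u a)"
      by (rule vertex_incl_commute[OF \<Delta> grpH]) (use * uv \<Delta>_edge Hi in auto)
  qed blast
  have AB: "A (B x) = \<phi> x" if x: "x \<in> carrier ?P" for x
  proof -
    have "(A \<circ> B) x = \<phi> x"
    proof (rule graph_product_hom_eq[OF \<Gamma> grp K hom_compose[OF B(1) A(1)] \<phi>h _ x])
      fix u a assume u: "u \<in> verts \<Gamma>" "a \<in> carrier (G u)"
      then have "i u \<in> verts \<Delta>" "j u a \<in> carrier (H (i u))" by (auto simp: \<Delta>_def Hi)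
      then show "(A \<circ> B) (vertex_incl \<Gamma> G u a) = \<phi> (vertex_incl \<Gamma> G u a)"
        by (simp add: B(2)[OF u] A(2)) (simp add: j_def)
    qed
    then show ?thesis by simp
  qed
  define \<psi> where "\<psi> = inv_into (carrier ?P) \<phi>"
  have \<psi>: "\<psi> \<in> hom K ?P"
    using P.iso_set_sym[OF \<phi>] by (simp add: \<psi>_def iso_def)
  have BA: "B (\<psi> (A y)) = y" if y: "y \<in> carrier ?Q" for y
  proof -
    have "(B \<circ> \<psi> \<circ> A) y = (\<lambda>y. y) y"
    proof (rule graph_product_hom_eq[OF \<Delta> grpH Q.is_group _ _ _ y])
      show "B \<circ> \<psi> \<circ> A \<in> hom ?Q ?Q"
        using hom_compose[OF A(1) hom_compose[OF \<psi> B(1)]] by (simp add: o_assoc)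
      show "(\<lambda>y. y) \<in> hom ?Q ?Q" by (auto simp: hom_def)
      fix x k assume x: "x \<in> verts \<Delta>" "k \<in> carrier (H x)"
      then obtain u where u: "u \<in> verts \<Gamma>" "x = i u" by (auto simp: \<Delta>_def)
      then obtain a where a: "a \<in> carrier (G u)" "k = j u a" using x(2) Hi by auto
      have "\<psi> k = vertex_incl \<Gamma> G u a"
        unfolding \<psi>_def a(2) j_def using \<phi>b incl_c[OF u(1) a(1)] by (simp add: bij_betw_inv_into_left)
      then show "(B \<circ> \<psi> \<circ> A) (vertex_incl \<Delta> H x k) = vertex_incl \<Delta> H x k"
        using A(2)[OF x] B(2)[OF u(1) a(1)] by (simp add: a(2) u(2))
    qed
    then show ?thesis by simp
  qed
  have "bij_betw A (carrier ?Q) (carrier K)"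
    unfolding bij_betw_def
  proof
    show "inj_on A (carrier ?Q)" by (metis BA inj_onI)
    have "carrier K \<subseteq> A ` carrier ?Q"
    proof
      fix k assume "k \<in> carrier K"
      then obtain x where "x \<in> carrier ?P" "k = \<phi> x" using \<phi>b by (auto simp: bij_betw_def)
      then show "k \<in> A ` carrier ?Q" using AB hom_in_carrier[OF B(1)] by force
    qed
    then show "A ` carrier ?Q = carrier K" using hom_in_carrier[OF A(1)] by blast
  qed
  then have "?Q \<cong> K" using A(1) by (auto simp: is_iso_def iso_def)
  then have "K \<cong> ?Q" by (rule Q.iso_sym)
  then have "complete_graph \<Delta>"
    using irr \<Delta> H unfolding graphically_irreducible_def by blast
  then show ?thesis
    unfolding complete_graph_def using \<Delta>_edge i_inj by (simp add: \<Delta>_def inj_on_eq_iff)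
qed

end

theory Submission
  imports Defs "HOL-Algebra.Generated_Groups"
begin

text \<open>
  As no link is contained in the star of another vertex, the vertex-group \<open>K u\<close> is the centralizer of any
  choice of non-trivial elements, one in each vertex-group adjacent to \<open>u\<close>. Let it act on the
  Bass--Serre tree \<open>T v\<close> of the splitting of the second graph product over the subgroup of
  \<open>link v\<close>. Elements commuting with a hyperbolic element of \<open>K u\<close> have products with its powers that
  fix its axis, and a centralizer of elements fixing an edge is, up to conjugation, a direct product
  \<open>Q \<times> \<langle>perp \<Theta>\<rangle>\<close> with \<open>\<Theta> \<subseteq> link v\<close>; as \<open>K u\<close> is graphically irreducible, \<open>perp \<Theta>\<close> is complete and
  \<open>K u\<close> fixes a point of \<open>T v\<close>. Commuting elliptic subgroups generate an elliptic subgroup, so the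
  subgroup of every clique is elliptic in all trees \<open>T v\<close>, hence conjugate into the subgroup of a
  clique. By symmetry, subgroups of maximal cliques correspond to each other up to conjugation.
  Since \<open>{u}\<close> is the intersection of the maximal cliques containing it, \<open>K u\<close> is conjugate to a
  parabolic subgroup, hence, by symmetry again, to a vertex-group. The conjugators are then absorbed
  in the conjugating automorphism.
\<close>

section \<open>Group actions on trees\<close>

text \<open>Two obstacles shape the proof. Vertex-groups need not be finitely generated, so a common
  fixed point of \<open>K u\<close> does not follow from each of its elements fixing a point. It is
  obtained from outside: finitely many elements, one per neighbour of \<open>u\<close>, have
  \<open>K u\<close> as their centralizer, and if their fixed subtrees do not meet,
  \<open>K u\<close> must fix the end of a bridge between two invariant subtrees. This requires
  single elements of vertex-groups to be elliptic, so hyperbolic elements are excluded beforehand,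
  for all vertices at once. A hyperbolic \<open>a\<close> fixes no point, but whatever commutes with
  it translates along its axis; suitable products of powers cancel the translation and fix an edge,
  and the analysis of centralizers starts from these products. The appeals to symmetry work because
  a parabolic subgroup is never conjugate into a proper subgroup of itself and determines its set of
  vertices: a chain of conjugate inclusions that goes to the other decomposition and returns to its
  start consists of equalities.\<close>

lemma (in group) commute_inv:
  assumes "x \<in> carrier G" "y \<in> carrier G" "x \<otimes> y = y \<otimes> x"
  shows "inv x \<otimes> y = y \<otimes> inv x"
proof -
  have "inv x \<otimes> y = inv x \<otimes> (y \<otimes> x) \<otimes> inv x" using assms(1,2) by (simp add: m_assoc)
  also have "\<dots> = inv x \<otimes> (x \<otimes> y) \<otimes> inv x" using assms(3) by simp
  also have "\<dots> = y \<otimes> inv x" using assms(1,2) by (simp add: m_assoc[symmetric])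
  finally show ?thesis .
qed

section \<open>Conjugation as a left action\<close>

definition (in group) cj :: "'a \<Rightarrow> 'a \<Rightarrow> 'a" where "cj g x = g \<otimes> x \<otimes> inv g"

context group
begin

lemma cj_closed [simp]: "g \<in> carrier G \<Longrightarrow> x \<in> carrier G \<Longrightarrow> cj g x \<in> carrier G"
  by (simp add: cj_def)

lemma cj_mult: "g \<in> carrier G \<Longrightarrow> x \<in> carrier G \<Longrightarrow> y \<in> carrier G \<Longrightarrow> cj g (x \<otimes> y) = cj g x \<otimes> cj g y"
  by (simp add: cj_def m_assoc inv_solve_left)

lemma cj_cj: "g \<in> carrier G \<Longrightarrow> h \<in> carrier G \<Longrightarrow> x \<in> carrier G \<Longrightarrow> cj g (cj h x) = cj (g \<otimes> h) x"
  by (simp add: cj_def m_assoc inv_mult_group)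

lemma cj_one [simp]: "x \<in> carrier G \<Longrightarrow> cj \<one> x = x"
  by (simp add: cj_def)

lemma cj_inv_cj [simp]: "g \<in> carrier G \<Longrightarrow> x \<in> carrier G \<Longrightarrow> cj (inv g) (cj g x) = x"
  by (simp add: cj_cj)

lemma cj_cj_inv [simp]: "g \<in> carrier G \<Longrightarrow> x \<in> carrier G \<Longrightarrow> cj g (cj (inv g) x) = x"
  by (simp add: cj_cj)

lemma cj_eq_iff: "g \<in> carrier G \<Longrightarrow> x \<in> carrier G \<Longrightarrow> y \<in> carrier G \<Longrightarrow> cj g x = cj g y \<longleftrightarrow> x = y"
  by (metis cj_inv_cj)

lemma cj_id: "g \<in> carrier G \<Longrightarrow> x \<in> carrier G \<Longrightarrow> g \<otimes> x = x \<otimes> g \<Longrightarrow> cj g x = x"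
  by (simp add: cj_def m_assoc)

lemma cj_eq_one: "g \<in> carrier G \<Longrightarrow> x \<in> carrier G \<Longrightarrow> cj g x = \<one> \<longleftrightarrow> x = \<one>"
  using cj_eq_iff[of g x \<one>] by (simp add: cj_def)

lemma cj_of_inv: "g \<in> carrier G \<Longrightarrow> x \<in> carrier G \<Longrightarrow> cj g (inv x) = inv (cj g x)"
  by (simp add: cj_def m_assoc inv_mult_group)

lemma cj_commute_iff:
  assumes "g \<in> carrier G" "x \<in> carrier G" "y \<in> carrier G"
  shows "cj g x \<otimes> cj g y = cj g y \<otimes> cj g x \<longleftrightarrow> x \<otimes> y = y \<otimes> x"
  unfolding cj_mult[OF assms, symmetric] cj_mult[OF assms(1,3,2), symmetric]
  using assms by (simp add: cj_eq_iff)

lemma cj_eqD: "x \<in> carrier G \<Longrightarrow> s \<in> carrier G \<Longrightarrow> cj x s \<otimes> x = x \<otimes> s"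
  by (simp add: cj_def m_assoc)

lemma cj_image_cj: "g \<in> carrier G \<Longrightarrow> h \<in> carrier G \<Longrightarrow> S \<subseteq> carrier G \<Longrightarrow> cj g ` cj h ` S = cj (g \<otimes> h) ` S"
  unfolding image_image by (rule image_cong) (auto simp: cj_cj)

lemma cj_image_Int:
  "g \<in> carrier G \<Longrightarrow> S \<subseteq> carrier G \<Longrightarrow> T \<subseteq> carrier G \<Longrightarrow> cj g ` (S \<inter> T) = cj g ` S \<inter> cj g ` T"
  by (rule inj_on_image_Int[of _ "carrier G"]) (auto simp: inj_on_def cj_eq_iff)

lemma cj_image_subgroup:
  assumes "subgroup H G" "h \<in> H"
  shows "cj h ` H = H"
proof -
  have hc: "h \<in> carrier G" by (rule subgroup.mem_carrier[OF assms])
  have in_H: "cj k x \<in> H" if "k \<in> H" "x \<in> H" for k x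
    using that assms(1) by (simp add: cj_def subgroup.m_closed subgroup.m_inv_closed)
  have "x \<in> cj h ` H" if x: "x \<in> H" for x
  proof
    show "cj (inv h) x \<in> H" using in_H x assms subgroup.m_inv_closed by metis
    show "x = cj h (cj (inv h) x)" using hc subgroup.mem_carrier[OF assms(1) x] by simp
  qed
  then show ?thesis using in_H assms(2) by blast
qed

lemma cj_image_closed: "g \<in> carrier G \<Longrightarrow> S \<subseteq> carrier G \<Longrightarrow> cj g ` S \<subseteq> carrier G"
  by auto

lemma cj_subset_iff:
  assumes "g \<in> carrier G" "S \<subseteq> carrier G" "T \<subseteq> carrier G"
  shows "cj g ` S \<subseteq> T \<longleftrightarrow> S \<subseteq> cj (inv g) ` T"
proof
  assume "cj g ` S \<subseteq> T"
  then have "cj (inv g) ` cj g ` S \<subseteq> cj (inv g) ` T" by blast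
  then show "S \<subseteq> cj (inv g) ` T" using assms by (simp add: cj_image_cj) (simp add: image_def subset_iff)
next
  assume "S \<subseteq> cj (inv g) ` T"
  then have "cj g ` S \<subseteq> cj g ` cj (inv g) ` T" by blast
  then show "cj g ` S \<subseteq> T" using assms by (simp add: cj_image_cj) (simp add: image_def subset_iff)
qed

end

text \<open>Trees are encoded by their distance function: \<open>step_ex\<close> provides geodesics,
  \<open>step_uniq\<close> says that only one neighbour of a point leads towards a given target, and
  \<open>d_neq\<close> expresses bipartiteness.\<close>

locale tree =
  fixes X :: "'x set" and d :: "'x \<Rightarrow> 'x \<Rightarrow> nat"
  assumes d_eq_0: "x \<in> X \<Longrightarrow> y \<in> X \<Longrightarrow> d x y = 0 \<longleftrightarrow> x = y"
    and d_sym: "x \<in> X \<Longrightarrow> y \<in> X \<Longrightarrow> d x y = d y x"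
    and d_tri: "x \<in> X \<Longrightarrow> y \<in> X \<Longrightarrow> z \<in> X \<Longrightarrow> d x z \<le> d x y + d y z"
    and step_ex: "x \<in> X \<Longrightarrow> y \<in> X \<Longrightarrow> x \<noteq> y \<Longrightarrow> \<exists>z\<in>X. d x z = 1 \<and> d x y = Suc (d z y)"
    and step_uniq: "x \<in> X \<Longrightarrow> y \<in> X \<Longrightarrow> z \<in> X \<Longrightarrow> z' \<in> X \<Longrightarrow> d x z = 1 \<Longrightarrow> d x z' = 1 \<Longrightarrow>
      d z y < d x y \<Longrightarrow> d z' y < d x y \<Longrightarrow> z = z'"
    and d_neq: "x \<in> X \<Longrightarrow> y \<in> X \<Longrightarrow> z \<in> X \<Longrightarrow> d x z = 1 \<Longrightarrow> d x y \<noteq> d z y"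
begin

lemma d_adj:
  assumes "x \<in> X" "y \<in> X" "z \<in> X" "d x z = 1"
  shows "d z y = Suc (d x y) \<or> d x y = Suc (d z y)"
  using d_tri[of x z y] d_tri[of z x y] d_sym[of x z] d_neq[of x y z] assms by linarith

text \<open>Geodesics are unique: the first steps towards \<open>z\<close> and \<open>z'\<close>
  both approach \<open>y\<close>, so \<open>step_uniq\<close> makes them equal, and the induction
  moves \<open>x\<close> to this common neighbour.\<close>

lemma between_unique:
  assumes "x \<in> X" "y \<in> X" "z \<in> X" "z' \<in> X" "d x z + d z y = d x y" "d x z' + d z' y = d x y"
    "d x z = d x z'"
  shows "z = z'"
  using assms
proof (induction "d x z" arbitrary: x)
  case 0
  then show ?case by (metis d_eq_0)
next
  case (Suc n)
  have "x \<noteq> z" "x \<noteq> z'" using Suc.hyps(2) Suc.prems d_eq_0 by auto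
  then obtain p p' where p: "p \<in> X" "d x p = 1" "d x z = Suc (d p z)"
    and p': "p' \<in> X" "d x p' = 1" "d x z' = Suc (d p' z')"
    using step_ex Suc.prems by meson
  have t: "d p y \<le> d p z + d z y" "d x y \<le> d x p + d p y"
    "d p' y \<le> d p' z' + d z' y" "d x y \<le> d x p' + d p' y"
    using d_tri[of p z y] d_tri[of x p y] d_tri[of p' z' y] d_tri[of x p' y] Suc.prems p p' by auto
  then have lt: "d p y < d x y" "d p' y < d x y"
    using Suc.prems(5-7) p(2,3) p'(2,3) by linarith+
  have pp: "p = p'"
    using step_uniq[OF Suc.prems(1,2) p(1) p'(1) p(2) p'(2) lt] .
  show ?case
  proof (rule Suc.hyps(1)[OF _ p(1) Suc.prems(2-4)])
    show "n = d p z" using Suc.hyps(2) p(3) by linarith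
    show "d p z + d z y = d p y" using Suc.prems(5) p t by linarith
    show "d p z' + d z' y = d p y" unfolding pp using Suc.prems(6) p' t by linarith
    show "d p z = d p z'" using Suc.prems(7) p(3) p'(3) unfolding pp by linarith
  qed
qed

lemma geodesic_ex:
  assumes "x \<in> X" "y \<in> X"
  obtains p where "\<And>i. i \<le> d x y \<Longrightarrow> p i \<in> X \<and> d x (p i) = i \<and> d (p i) y = d x y - i"
    "\<And>i. i < d x y \<Longrightarrow> d (p i) (p (Suc i)) = 1"
proof -
  define Q where "Q i z \<longleftrightarrow> z \<in> X \<and> d x z = i \<and> d z y = d x y - i" for i z
  have next_pt: "\<exists>z'. Q (Suc i) z' \<and> d z z' = 1" if "i < d x y" "Q i z" for i z
  proof -
    have z: "z \<in> X" "d x z = i" "d z y = d x y - i" using that by (auto simp: Q_def)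
    have "z \<noteq> y" using that(1) z by auto
    from step_ex[OF z(1) assms(2) this]
    obtain z' where z': "z' \<in> X" "d z z' = 1" "d z y = Suc (d z' y)" by blast
    have "d x z' = Suc i" "d z' y = d x y - Suc i"
      using d_tri[OF assms(1) z(1) z'(1)] d_tri[OF assms(1) z'(1) assms(2)] z z' that(1) by linarith+
    then show ?thesis using z' by (auto simp: Q_def)
  qed
  have "\<exists>z. Q i z" if "i \<le> d x y" for i
    using that
  proof (induction i)
    case 0
    have "Q 0 x" using assms d_eq_0 by (simp add: Q_def)
    then show ?case by blast
  next
    case (Suc i)
    then obtain z where "Q i z" by auto
    then show ?case using next_pt[of i z] Suc.prems by auto
  qed
  then have p: "Q i (SOME z. Q i z)" if "i \<le> d x y" for i
    using someI_ex[of "Q i"] that by blast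
  define p where "p i = (SOME z. Q i z)" for i
  note p = p[folded p_def]
  \<comment> \<open>The \<open>p i\<close> are chosen separately; \<open>between_unique\<close>
    identifies the neighbour produced by \<open>next_pt\<close> with the chosen
    \<open>p (Suc i)\<close>.\<close>
  have adj: "d (p i) (p (Suc i)) = 1" if i: "i < d x y" for i
  proof -
    obtain z where z: "Q (Suc i) z" "d (p i) z = 1" using next_pt[OF i p] i by auto
    have "z = p (Suc i)"
      by (rule between_unique[of x y]) (use z(1) p[of "Suc i"] i assms in \<open>simp_all add: Q_def\<close>)
    then show ?thesis using z by simp
  qed
  show thesis
    by (rule that[of p]) (use p in \<open>simp add: Q_def\<close>, rule adj)
qed

definition conv :: "'x set \<Rightarrow> bool" where
  "conv C \<longleftrightarrow> C \<subseteq> X \<and> (\<forall>x\<in>C. \<forall>y\<in>C. \<forall>z\<in>X. d x z + d z y = d x y \<longrightarrow> z \<in> C)"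

lemma conv_subset: "conv C \<Longrightarrow> C \<subseteq> X"
  by (simp add: conv_def)

lemma conv_between:
  "conv C \<Longrightarrow> x \<in> C \<Longrightarrow> y \<in> C \<Longrightarrow> z \<in> X \<Longrightarrow> d x z + d z y = d x y \<Longrightarrow> z \<in> C"
  unfolding conv_def by blast

lemma step_in_conv:
  assumes "conv C" "x \<in> C" "y \<in> C" "x \<noteq> y"
  obtains z where "z \<in> C" "d x z = 1" "d x y = Suc (d z y)"
proof -
  have X: "x \<in> X" "y \<in> X" using assms conv_subset by auto
  from step_ex[OF X assms(4)]
  obtain z where z: "z \<in> X" "d x z = 1" "d x y = Suc (d z y)" by blast
  have "d x z + d z y = d x y" using z by simp
  then have "z \<in> C" by (rule conv_between[OF assms(1-3) z(1)])
  then show thesis using that z(2,3) by metis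
qed

text \<open>The nearest point is a gate to \<open>C\<close>. Otherwise, on the geodesic in
  \<open>C\<close> from \<open>c\<close> to \<open>c'\<close>, some point \<open>q\<close> would
  have both its neighbours closer to \<open>x\<close>, against \<open>step_uniq\<close>.\<close>

lemma nearest_point:
  assumes C: "conv C" and x: "x \<in> X" and c: "c \<in> C" and min: "\<And>c'. c' \<in> C \<Longrightarrow> d x c \<le> d x c'"
    and c': "c' \<in> C"
  shows "d x c' = d x c + d c c'"
  using c'
proof (induction "d c c'" arbitrary: c' rule: less_induct)
  case less
  have X: "c \<in> X" "c' \<in> X" using C c less.prems conv_subset by auto
  show ?case
  proof (cases "c' = c")
    case True
    then show ?thesis using d_eq_0 X by simp
  next
    case False
    obtain q where q: "q \<in> C" "d c' q = 1" "d c' c = Suc (d q c)"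
      using step_in_conv[OF C less.prems c False] .
    have qX: "q \<in> X" using C q conv_subset by auto
    have dq: "d c c' = Suc (d c q)" using q d_sym X qX by simp
    then have IHq: "d x q = d x c + d c q" using less.hyps[of q] q by simp
    have sym: "d c' x = d x c'" "d q x = d x q" using d_sym X(2) qX x by auto
    have alt: "d x c' = Suc (d x q) \<or> d x q = Suc (d x c')"
      using d_adj[OF X(2) x qX q(2)] sym by linarith
    have "d x q \<noteq> Suc (d x c')"
    proof (cases "q = c")
      case True
      then show ?thesis using min[OF less.prems] by simp
    next
      case False
      obtain r where r: "r \<in> C" "d q r = 1" "d q c = Suc (d r c)"
        using step_in_conv[OF C q(1) c False] .
      have rX: "r \<in> X" using C r conv_subset by auto
      have dr: "d c q = Suc (d c r)" using r d_sym X qX rX by simp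
      then have IHr: "d x r = d x c + d c r" using less.hyps[of r] r dq by simp
      show ?thesis
      proof
        assume as: "d x q = Suc (d x c')"
        have "d c' x < d q x" "d r x < d q x"
          using as sym d_sym[OF rX x] IHq IHr dr by linarith+
        moreover have "d q c' = 1" using q(2) d_sym X(2) qX by simp
        ultimately have "c' = r"
          using step_uniq[OF qX x X(2) rX _ r(2)] by blast
        then show False using dq dr by simp
      qed
    qed
    then show ?thesis using alt IHq dq by linarith
  qed
qed

lemma nearest_ex: "C \<noteq> {} \<Longrightarrow> \<exists>c\<in>C. \<forall>c'\<in>C. d x c \<le> d x c'"
  using ex_has_least_nat[of "\<lambda>c. c \<in> C" _ "d x"] by blast

text \<open>A path without backtracking is geodesic: if the path came back towards
  \<open>\<gamma> i\<close> at some point, the previous and the next point would both be the unique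
  neighbour approaching \<open>\<gamma> i\<close>.\<close>

lemma geodesic_line:
  assumes X: "\<And>i::int. \<gamma> i \<in> X" and adj: "\<And>i. d (\<gamma> i) (\<gamma> (i + 1)) = 1"
    and ne: "\<And>i. \<gamma> (i + 2) \<noteq> \<gamma> i"
  shows "d (\<gamma> i) (\<gamma> (i + int n)) = n"
proof (induction n rule: less_induct)
  case (less n)
  consider "n = 0" | "n = 1" | m where "n = Suc (Suc m)"
    by (metis One_nat_def not0_implies_Suc)
  then show ?case
  proof cases
    case 1
    then show ?thesis using X d_eq_0 by simp
  next
    case 2
    then show ?thesis using adj by simp
  next
    case 3
    let ?r = "\<gamma> (i + int m)" and ?q = "\<gamma> (i + int m + 1)" and ?c = "\<gamma> (i + int m + 2)"
    have eq: "\<gamma> (i + int n) = ?c" "\<gamma> (i + int (Suc m)) = ?q"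
      using 3 by (simp_all add: algebra_simps)
    have r: "d (\<gamma> i) ?r = m" and q: "d (\<gamma> i) ?q = Suc m"
      using less[of m] less[of "Suc m"] 3 eq by auto
    have qr: "d ?q ?r = 1" using adj[of "i + int m"] d_sym X by simp
    have qc: "d ?q ?c = 1" using adj[of "i + int m + 1"] by (simp add: add.assoc)
    have "d ?q (\<gamma> i) \<noteq> Suc (d ?c (\<gamma> i))"
    proof
      assume "d ?q (\<gamma> i) = Suc (d ?c (\<gamma> i))"
      moreover have "d ?r (\<gamma> i) < d ?q (\<gamma> i)" using q r d_sym[OF X X] by simp
      ultimately have "?c = ?r"
        using step_uniq[OF X X X X qc qr, of i] by simp
      then show False using ne by blast
    qed
    then have "d ?c (\<gamma> i) = Suc (d ?q (\<gamma> i))" using d_adj[OF X X X qc] by blast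
    then have "d (\<gamma> i) ?c = Suc (d (\<gamma> i) ?q)" using d_sym[OF X X] by metis
    then show ?thesis using q eq 3 by simp
  qed
qed

end

text \<open>\<open>act_even\<close> excludes inversions: an element exchanging the ends of an edge
  would move them by distance one. The trees used below satisfy it because the action preserves the
  two classes of a bipartition.\<close>

locale tree_action = tree X d + group P
  for X :: "'x set" and d and P :: "'g monoid" (structure) +
  fixes act :: "'g \<Rightarrow> 'x \<Rightarrow> 'x"
  assumes act_closed [simp]: "g \<in> carrier P \<Longrightarrow> x \<in> X \<Longrightarrow> act g x \<in> X"
    and act_one: "x \<in> X \<Longrightarrow> act \<one> x = x"
    and act_mult: "g \<in> carrier P \<Longrightarrow> h \<in> carrier P \<Longrightarrow> x \<in> X \<Longrightarrow> act (g \<otimes> h) x = act g (act h x)"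
    and act_iso: "g \<in> carrier P \<Longrightarrow> x \<in> X \<Longrightarrow> y \<in> X \<Longrightarrow> d (act g x) (act g y) = d x y"
    and act_even: "g \<in> carrier P \<Longrightarrow> x \<in> X \<Longrightarrow> even (d x (act g x))"
begin

definition Fix :: "'g set \<Rightarrow> 'x set" where
  "Fix S = {x \<in> X. \<forall>s\<in>S. act s x = x}"

lemma conv_Fix: "S \<subseteq> carrier P \<Longrightarrow> conv (Fix S)"
  unfolding conv_def
proof (intro conjI ballI impI)
  show "Fix S \<subseteq> X" by (auto simp: Fix_def)
  fix x y z assume S: "S \<subseteq> carrier P" and x: "x \<in> Fix S" and y: "y \<in> Fix S"
    and z: "z \<in> X" "d x z + d z y = d x y"
  have "act s z = z" if "s \<in> S" for s
  proof -
    have s: "s \<in> carrier P" "act s x = x" "act s y = y" using S that x y by (auto simp: Fix_def)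
    have "x \<in> X" "y \<in> X" using x y by (auto simp: Fix_def)
    then show ?thesis
      using between_unique[of x y "act s z" z] z s act_iso[of s x z] act_iso[of s z y] by simp
  qed
  then show "z \<in> Fix S" using z by (simp add: Fix_def)
qed

lemma Fix_commuting:
  assumes "S \<subseteq> carrier P" "a \<in> carrier P" "\<And>s. s \<in> S \<Longrightarrow> a \<otimes> s = s \<otimes> a" "x \<in> Fix S"
  shows "act a x \<in> Fix S"
proof -
  have x: "x \<in> X" "\<And>s. s \<in> S \<Longrightarrow> act s x = x" using assms(4) by (auto simp: Fix_def)
  have "act s (act a x) = act a x" if s: "s \<in> S" for s
  proof -
    have sP: "s \<in> carrier P" using s assms(1) by blast
    have "act s (act a x) = act (a \<otimes> s) x" using act_mult[OF sP assms(2) x(1)] assms(3)[OF s] by simp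
    then show ?thesis using act_mult[OF assms(2) sP x(1)] x(2)[OF s] by simp
  qed
  then show ?thesis using assms(2) x(1) by (simp add: Fix_def)
qed

text \<open>The nearest point of \<open>C\<close> to \<open>z\<close> is unique by
  \<open>nearest_point\<close>, and \<open>A\<close> preserves both \<open>C\<close> and
  \<open>z\<close>.\<close>

lemma fix_nearest:
  assumes C: "conv C" "C \<noteq> {}" and z: "z \<in> X" and A: "A \<subseteq> carrier P"
    and AC: "\<And>a x. a \<in> A \<Longrightarrow> x \<in> C \<Longrightarrow> act a x \<in> C" and Az: "\<And>a. a \<in> A \<Longrightarrow> act a z = z"
  obtains c where "c \<in> C" "\<And>a. a \<in> A \<Longrightarrow> act a c = c"
proof -
  obtain c where c: "c \<in> C" "\<And>c'. c' \<in> C \<Longrightarrow> d z c \<le> d z c'"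
    using nearest_ex[OF C(2), of z] by blast
  have "act a c = c" if a: "a \<in> A" for a
  proof -
    have X: "c \<in> X" using C c conv_subset by auto
    have "d z (act a c) = d z c" using act_iso[of a z c] Az[OF a] A a X z by auto
    moreover have "d z (act a c) = d z c + d c (act a c)"
      using nearest_point[OF C(1) z c AC[OF a c(1)]] .
    ultimately show ?thesis using d_eq_0[OF X, of "act a c"] A a X by auto
  qed
  then show thesis using that c by blast
qed

text \<open>The end \<open>c\<close> of a shortest segment from \<open>C\<close> to \<open>D\<close>
  cannot move: the way from \<open>c\<close> to \<open>act a e\<close> would start both towards
  \<open>e\<close> and, inside \<open>C\<close>, towards \<open>act a c\<close>, so a point of
  \<open>C\<close> would be nearer to \<open>e\<close>.\<close>

lemma fix_bridge:
  assumes C: "conv C" "C \<noteq> {}" and D: "conv D" "D \<noteq> {}" and disj: "C \<inter> D = {}"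
    and A: "A \<subseteq> carrier P"
    and AC: "\<And>a x. a \<in> A \<Longrightarrow> x \<in> C \<Longrightarrow> act a x \<in> C" and AD: "\<And>a x. a \<in> A \<Longrightarrow> x \<in> D \<Longrightarrow> act a x \<in> D"
  obtains c where "c \<in> C" "\<And>a. a \<in> A \<Longrightarrow> act a c = c"
proof -
  obtain c e where ce: "c \<in> C" "e \<in> D" and min: "\<And>c' e'. c' \<in> C \<Longrightarrow> e' \<in> D \<Longrightarrow> d c e \<le> d c' e'"
    using ex_has_least_nat[of "\<lambda>p. p \<in> C \<times> D" _ "\<lambda>p. d (fst p) (snd p)"] C(2) D(2) by fastforce
  have CX: "C \<subseteq> X" "D \<subseteq> X" using C D conv_subset by auto
  have "act a c = c" if a: "a \<in> A" for a
  proof (rule ccontr)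
    assume ne: "act a c \<noteq> c"
    define c' e' where "c' = act a c" and "e' = act a e"
    have in': "c' \<in> C" "e' \<in> D" using AC AD a ce by (auto simp: c'_def e'_def)
    note X = subsetD[OF CX(1) ce(1)] subsetD[OF CX(2) ce(2)] subsetD[OF CX(1) in'(1)] subsetD[OF CX(2) in'(2)]
    have m: "d c' e' = d c e" using act_iso[of a c e] A a X by (auto simp: c'_def e'_def)
    have 1: "d e' c = d e' c' + d c' c"
    proof (rule nearest_point[OF C(1) X(4) in'(1) _ ce(1)])
      fix x assume "x \<in> C"
      then show "d e' c' \<le> d e' x" using min[of x e'] in' m d_sym X CX by auto
    qed
    have 2: "d c e' = d c e + d e e'"
      by (rule nearest_point[OF D(1) X(1) ce(2) _ in'(2)]) (use min ce in auto)
    have "c \<noteq> e" using ce disj by blast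
    then obtain p where p: "p \<in> X" "d c p = 1" "d c e = Suc (d p e)" using step_ex X by blast
    obtain q where q: "q \<in> C" "d c q = 1" "d c c' = Suc (d q c')"
      using step_in_conv[OF C(1) ce(1) in'(1)] ne by (auto simp: c'_def)
    have qX: "q \<in> X" using q CX by blast
    have "d p e' < d c e'" using d_tri[OF p(1) X(2,4)] 2 p(3) by linarith
    moreover have "d q e' < d c e'"
      using d_tri[OF qX X(3,4)] 1 q(3) d_sym[OF X(4,1)] d_sym[OF X(4,3)] d_sym[OF X(3,1)] by linarith
    ultimately have "p = q" using step_uniq[OF X(1,4) p(1) qX p(2) q(2)] by blast
    then show False using min[OF q(1) ce(2)] p by simp
  qed
  then show thesis using that ce by blast
qed

text \<open>Members of \<open>S\<close> are added one at a time. If the fixed sets of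
  \<open>S\<close> and of the new \<open>s\<close> are disjoint, both are preserved by
  \<open>A\<close>, which then fixes the end of the bridge between them. Finiteness of
  \<open>S\<close> takes the place of finite generation of \<open>A\<close>.\<close>

lemma fix_or_common_fix:
  assumes "finite S" "S \<subseteq> carrier P" and fixS: "\<And>s. s \<in> S \<Longrightarrow> Fix {s} \<noteq> {}" and A: "A \<subseteq> carrier P"
    and comm: "\<And>a s. a \<in> A \<Longrightarrow> s \<in> S \<Longrightarrow> a \<otimes> s = s \<otimes> a" and "X \<noteq> {}"
  shows "Fix A \<noteq> {} \<or> Fix S \<noteq> {}"
  using assms(1-3,5)
proof (induction S)
  case empty
  then show ?case using \<open>X \<noteq> {}\<close> by (simp add: Fix_def)
next
  case (insert s S)
  have IH: "Fix A \<noteq> {} \<or> Fix S \<noteq> {}" using insert by auto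
  show ?case
  proof (cases "Fix S = {} \<or> Fix S \<inter> Fix {s} \<noteq> {}")
    case True
    then show ?thesis using IH by (auto simp: Fix_def)
  next
    case False
    have cS: "S \<subseteq> carrier P" "{s} \<subseteq> carrier P" using insert.prems by auto
    obtain c where "c \<in> Fix S" "\<And>a. a \<in> A \<Longrightarrow> act a c = c"
    proof (rule fix_bridge[of "Fix S" "Fix {s}" A])
      show "conv (Fix S)" "conv (Fix {s})" using conv_Fix cS by auto
      show "Fix S \<noteq> {}" "Fix {s} \<noteq> {}" "Fix S \<inter> Fix {s} = {}" using False insert.prems by auto
      show "act a x \<in> Fix S" if "a \<in> A" "x \<in> Fix S" for a x
        using Fix_commuting[OF cS(1) _ _ that(2)] that A insert.prems by auto
      show "act a x \<in> Fix {s}" if "a \<in> A" "x \<in> Fix {s}" for a x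
      proof (rule Fix_commuting[OF cS(2) _ _ that(2)])
        show "a \<in> carrier P" using that A by blast
        show "a \<otimes> t = t \<otimes> a" if "t \<in> {s}" for t using that \<open>a \<in> A\<close> insert.prems(3) by blast
      qed
    qed (use A in auto)
    then show ?thesis by (auto simp: Fix_def)
  qed
qed

text \<open>\<open>A\<close> preserves \<open>Fix S\<close>: a single point is fixed by
  \<open>A\<close>, and a convex set with two points contains an edge.\<close>

lemma fix_or_edge:
  assumes "S \<subseteq> carrier P" "A \<subseteq> carrier P"
    and comm: "\<And>a s. a \<in> A \<Longrightarrow> s \<in> S \<Longrightarrow> a \<otimes> s = s \<otimes> a" and "Fix S \<noteq> {}"
  shows "Fix A \<noteq> {} \<or> (\<exists>x\<in>Fix S. \<exists>y\<in>Fix S. d x y = 1)"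
proof (cases "\<exists>x. Fix S = {x}")
  case True
  then obtain x where x: "Fix S = {x}" by blast
  have "act a x \<in> Fix S" if "a \<in> A" for a
    using Fix_commuting[OF assms(1)] that assms(2) comm x by auto
  then have "x \<in> Fix A" using x by (auto simp: Fix_def)
  then show ?thesis by blast
next
  case False
  then obtain x y where "x \<in> Fix S" "y \<in> Fix S" "x \<noteq> y" using assms(4) by blast
  then show ?thesis using step_in_conv[OF conv_Fix[OF assms(1)]] by metis
qed

text \<open>The axis is the concatenation of the translates of a geodesic from a point
  \<open>o'\<close> of least displacement to its image. Backtracking at a junction would produce a
  point of smaller displacement, so \<open>geodesic_line\<close> applies.\<close>

lemma axis_ex:
  assumes a: "a \<in> carrier P" and nofix: "\<And>x. x \<in> X \<Longrightarrow> act a x \<noteq> x" and "X \<noteq> {}"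
  obtains \<gamma> :: "int \<Rightarrow> 'x" and L :: nat where "\<And>i. \<gamma> i \<in> X" "L > 0"
    "\<And>i n. d (\<gamma> i) (\<gamma> (i + int n)) = n"
    "\<And>i m. act (a [^] (m::int)) (\<gamma> i) = \<gamma> (i + m * int L)"
    "\<And>x. x \<in> X \<Longrightarrow> L \<le> d x (act a x)"
proof -
  obtain o' where o': "o' \<in> X" and min: "\<And>x. x \<in> X \<Longrightarrow> d o' (act a o') \<le> d x (act a x)"
    using ex_has_least_nat[of "\<lambda>x. x \<in> X" _ "\<lambda>x. d x (act a x)"] assms(3) by blast
  define l where "l = d o' (act a o')"
  have ao: "act a o' \<in> X" using a o' by simp
  have "l \<noteq> 0" using nofix[OF o'] d_eq_0[OF o' ao] by (auto simp: l_def)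
  \<comment> \<open>As there are no inversions, the translation length is at least two, so that
    \<open>p 1\<close> and \<open>p (l - 1)\<close> are interior to the segment.\<close>
  moreover have "even l" using act_even[OF a o'] by (simp add: l_def)
  ultimately have l2: "l \<ge> 2" by (metis One_nat_def Suc_leI even_Suc le_neq_implies_less neq0_conv numeral_2_eq_2 odd_one)
  obtain p where p: "\<And>i. i \<le> l \<Longrightarrow> p i \<in> X \<and> d o' (p i) = i \<and> d (p i) (act a o') = l - i"
    and p1: "\<And>i. i < l \<Longrightarrow> d (p i) (p (Suc i)) = 1"
    using geodesic_ex[OF o' ao] unfolding l_def[symmetric] by blast
  have p0: "p 0 = o'" using p[of 0] d_eq_0 o' by auto
  have pl: "p l = act a o'" using p[of l] d_eq_0 ao by auto
  have pd: "d (p i) (p (i + k)) \<le> k" if "i + k \<le> l" for i k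
    using that
  proof (induction k)
    case 0
    then show ?case using p[of i] d_eq_0 by simp
  next
    case (Suc k)
    then show ?case using d_tri[of "p i" "p (i + k)" "p (i + Suc k)"] p1[of "i + k"] p[of i] p[of "i + k"] p[of "i + Suc k"] by simp
  qed
  define g where "g i = act (a [^] (i div int l)) (p (nat (i mod int l)))" for i :: int
  have lpos: "int l > 0" using l2 by simp
  \<comment> \<open>Allowing \<open>j = l\<close> states that consecutive translates of the segment
    fit together.\<close>
  have gkj: "g (k * int l + int j) = act (a [^] k) (p j)" if "j \<le> l" for k j
  proof (cases "j = l")
    case False
    then have "(k * int l + int j) div int l = k" "(k * int l + int j) mod int l = int j"
      using that by auto
    then show ?thesis by (simp add: g_def)
  next
    case True
    have "k * int l + int j = (k + 1) * int l" using True by (simp add: algebra_simps)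
    then have "(k * int l + int j) div int l = k + 1" "(k * int l + int j) mod int l = 0"
      using lpos by auto
    then have "g (k * int l + int j) = act (a [^] (k + 1)) o'" by (simp add: g_def p0)
    also have "\<dots> = act (a [^] k) (act a o')"
      using int_pow_mult[OF a, of k 1] act_mult[of "a [^] k" a o'] a o' by (simp add: int_pow_1)
    finally show ?thesis using pl True by simp
  qed
  have ex: "\<exists>k j. j < l \<and> i = k * int l + int j" for i
  proof (intro exI conjI)
    show "nat (i mod int l) < l" using lpos by (metis nat_less_iff pos_mod_bound pos_mod_sign)
    show "i = i div int l * int l + int (nat (i mod int l))" using lpos by simp
  qed
  have gX: "g i \<in> X" for i
    using ex[of i] gkj p a by (metis act_closed int_pow_closed less_imp_le)
  have g1: "d (g i) (g (i + 1)) = 1" for i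
  proof -
    obtain k j where kj: "j < l" "i = k * int l + int j" using ex by blast
    have i1: "i + 1 = k * int l + int (Suc j)" using kj by simp
    have "g i = act (a [^] k) (p j)" "g (i + 1) = act (a [^] k) (p (Suc j))"
      unfolding i1 unfolding kj(2) by (rule gkj, use kj(1) in simp)+
    then show ?thesis using kj(1) p1[of j] act_iso[of "a [^] k" "p j" "p (Suc j)"] p a by simp
  qed
  have g2: "g (i + 2) \<noteq> g i" for i
  proof
    assume eq: "g (i + 2) = g i"
    obtain k j where kj: "j < l" "i = k * int l + int j" using ex by blast
    have pk: "a [^] k \<in> carrier P" using a by simp
    have inj: "x = y" if "act (a [^] k) x = act (a [^] k) y" "x \<in> X" "y \<in> X" for x y
      using act_iso[OF pk, of x y] that d_eq_0 pk by (metis act_closed)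
    show False
    proof (cases "j + 2 \<le> l")
      case True
      have i2: "i + 2 = k * int l + int (j + 2)" using kj by simp
      have "g i = act (a [^] k) (p j)" "g (i + 2) = act (a [^] k) (p (j + 2))"
        unfolding i2 unfolding kj(2) by (rule gkj, use kj(1) True in simp)+
      then have "p (j + 2) = p j" using eq inj[of "p (j + 2)" "p j"] p[of j] p[of "j + 2"] kj(1) True by simp
      then show False using p[of j] p[of "j + 2"] kj True by simp
    next
      case False
      \<comment> \<open>At a junction, \<open>g (i + 2) = g i\<close> becomes
        \<open>act a (p 1) = p (l - 1)\<close>, so \<open>p 1\<close> is displaced by at most
        \<open>l - 2\<close>, against minimality.\<close>
      then have j: "Suc j = l" using kj by simp
      then have i2: "i + 2 = (k + 1) * int l + int 1" using kj by (simp add: algebra_simps)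
      have "g i = act (a [^] k) (p j)" "g (i + 2) = act (a [^] (k + 1)) (p 1)"
        unfolding i2 unfolding kj(2) by (rule gkj, use kj(1) l2 in simp)+
      then have "act (a [^] (k + 1)) (p 1) = act (a [^] k) (p j)" using eq by simp
      moreover have "act (a [^] (k + 1)) (p 1) = act (a [^] k) (act a (p 1))"
        using int_pow_mult[OF a, of k 1] act_mult[of "a [^] k" a "p 1"] a p[of 1] l2 by (simp add: int_pow_1)
      ultimately have "act a (p 1) = p j" using inj p[of 1] p[of j] kj l2 a by simp
      moreover have "d (p 1) (p j) \<le> l - 2" using pd[of 1 "j - 1"] j l2 by simp
      ultimately show False using min[of "p 1"] p[of 1] l2 by (simp add: l_def)
    qed
  qed
  show thesis
  proof (rule that[of g l])
    show "act (a [^] m) (g i) = g (i + m * int l)" for i and m :: int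
    proof -
      obtain k j where kj: "j < l" "i = k * int l + int j" using ex by blast
      have im: "i + m * int l = (m + k) * int l + int j" using kj by (simp add: algebra_simps)
      have "g i = act (a [^] k) (p j)" "g (i + m * int l) = act (a [^] (m + k)) (p j)"
        unfolding im unfolding kj(2) by (rule gkj, use kj(1) in simp)+
      then show ?thesis
        using kj(1) act_mult[of "a [^] m" "a [^] k" "p j"] int_pow_mult[OF a, of m k] a p[of j] by simp
    qed
    show "d (g i) (g (i + int n)) = n" for i n by (rule geodesic_line[of g, OF gX g1 g2])
    show "l \<le> d x (act a x)" if "x \<in> X" for x using min[OF that] by (simp add: l_def)
  qed (use gX l2 in simp_all)
qed

text \<open>The axis contains all points that \<open>a\<close> displaces by \<open>l\<close>, so it
  is preserved by every \<open>b\<close> commuting with \<open>a\<close>, and \<open>b\<close> acts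
  on it as a translation by some \<open>t\<close>. A power of \<open>a\<close> cancels the
  translation of \<open>b [^] l\<close>. That the power of \<open>b\<close> is non-trivial is needed
  later for \<open>centralizer_star\<close>.\<close>

lemma commuting_fix_axis_edge:
  assumes a: "a \<in> carrier P" and nofix: "\<And>x. x \<in> X \<Longrightarrow> act a x \<noteq> x" and "X \<noteq> {}"
  obtains x y where "x \<in> X" "y \<in> X" "d x y = 1"
    "\<And>b. b \<in> carrier P \<Longrightarrow> b \<otimes> a = a \<otimes> b \<Longrightarrow> b \<noteq> \<one> \<Longrightarrow>
      \<exists>(n::nat) (m::int). b [^] n \<noteq> \<one> \<and> {x, y} \<subseteq> Fix {b [^] n \<otimes> a [^] m}"
proof -
  obtain \<gamma> :: "int \<Rightarrow> 'x" and l :: nat where \<gamma>X: "\<And>i. \<gamma> i \<in> X" and l: "l > 0"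
    and \<gamma>d: "\<And>i n. d (\<gamma> i) (\<gamma> (i + int n)) = n"
    and \<gamma>a: "\<And>i m. act (a [^] (m::int)) (\<gamma> i) = \<gamma> (i + m * int l)"
    and min: "\<And>x. x \<in> X \<Longrightarrow> l \<le> d x (act a x)"
    using axis_ex[OF assms] by metis
  have \<gamma>d': "d (\<gamma> i) (\<gamma> j) = nat \<bar>j - i\<bar>" for i j
  proof (cases "i \<le> j")
    case True
    then show ?thesis using \<gamma>d[of i "nat (j - i)"] by simp
  next
    case False
    then show ?thesis using \<gamma>d[of j "nat (i - j)"] d_sym[OF \<gamma>X \<gamma>X, of i j] by simp
  qed
  have \<gamma>inj: "\<gamma> i = \<gamma> j \<longleftrightarrow> i = j" for i j using \<gamma>d'[of i j] d_eq_0[OF \<gamma>X \<gamma>X, of i j] by auto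
  have \<gamma>1: "act a (\<gamma> i) = \<gamma> (i + int l)" for i using \<gamma>a[of 1 i] a by (simp add: int_pow_1)
  have between: "z = \<gamma> (i + int k)" if "z \<in> X" "k \<le> n" "d (\<gamma> i) z = k" "d z (\<gamma> (i + int n)) = n - k" for z i k n
  proof -
    have "d (\<gamma> (i + int k)) (\<gamma> (i + int n)) = n - k" using that \<gamma>d' by simp
    then show ?thesis
      using between_unique[of "\<gamma> i" "\<gamma> (i + int n)" z "\<gamma> (i + int k)"] that \<gamma>X \<gamma>d by simp
  qed
  have conv: "conv (range \<gamma>)"
  proof -
    have *: "z \<in> range \<gamma>" if z: "z \<in> X" "d (\<gamma> i) z + d z (\<gamma> j) = d (\<gamma> i) (\<gamma> j)" "i \<le> j" for i j z
    proof -
      have "z = \<gamma> (i + int (d (\<gamma> i) z))"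
        by (rule between[of _ _ "nat (j - i)"]) (use z \<gamma>d'[of i j] in auto)
      then show ?thesis by blast
    qed
    have "z \<in> range \<gamma>" if z: "z \<in> X" "d (\<gamma> i) z + d z (\<gamma> j) = d (\<gamma> i) (\<gamma> j)" for i j z
      using *[of z i j] *[of z j i] z d_sym[OF \<gamma>X z(1)] d_sym[OF \<gamma>X \<gamma>X] by (metis add.commute linear)
    then show ?thesis unfolding conv_def using \<gamma>X by (intro conjI ballI impI) (blast, elim imageE, simp)
  qed
  \<comment> \<open>From the projection \<open>\<gamma> i\<close> of a point \<open>x\<close> off
    the axis, the neighbour towards \<open>x\<close> and the next axis point both approach
    \<open>act a x\<close>. Hence they coincide, and the axis would come nearer to
    \<open>x\<close>.\<close>
  have axis: "x \<in> range \<gamma>" if x: "x \<in> X" "d x (act a x) = l" for x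
  proof (rule ccontr)
    assume nx: "x \<notin> range \<gamma>"
    have ax: "act a x \<in> X" using a x by simp
    obtain c where c: "c \<in> range \<gamma>" "\<And>c'. c' \<in> range \<gamma> \<Longrightarrow> d x c \<le> d x c'"
      using nearest_ex[of "range \<gamma>" x] by (metis UNIV_not_empty image_is_empty)
    from c(1) obtain i where i: "c = \<gamma> i" by blast
    have near: "d x (\<gamma> i') \<ge> d x (\<gamma> i)" for i' using c(2)[OF rangeI] i by simp
    have m: "d (act a x) (\<gamma> (i + int l)) = d x (\<gamma> i)"
      using act_iso[OF a x(1) \<gamma>X[of i]] \<gamma>1 by simp
    have near': "d (act a x) (\<gamma> (i + int l)) \<le> d (act a x) c'" if c': "c' \<in> range \<gamma>" for c'
    proof -
      obtain i' where i': "c' = \<gamma> (i' + int l)" using c' by (metis diff_add_cancel imageE)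
      show ?thesis using act_iso[OF a x(1) \<gamma>X[of i']] \<gamma>1 near[of i'] m i' by simp
    qed
    have proj: "d (act a x) (\<gamma> j) = d x (\<gamma> i) + nat \<bar>j - (i + int l)\<bar>" for j
      using nearest_point[OF conv ax rangeI near', of "\<gamma> j"] m \<gamma>d' by simp
    have "x \<noteq> \<gamma> i" using nx by blast
    then obtain q where q: "q \<in> X" "d (\<gamma> i) q = 1" "d (\<gamma> i) x = Suc (d q x)" using step_ex[OF \<gamma>X x(1)] by metis
    have s: "d (\<gamma> i) x = d x (\<gamma> i)" "d (\<gamma> i) (act a x) = d (act a x) (\<gamma> i)"
      "d (\<gamma> (i + 1)) (act a x) = d (act a x) (\<gamma> (i + 1))"
      using d_sym \<gamma>X x ax by auto
    have "d q (act a x) < d (\<gamma> i) (act a x)"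
      using d_tri[OF q(1) x(1) ax] x q proj[of i] s by simp
    moreover have "d (\<gamma> (i + 1)) (act a x) < d (\<gamma> i) (act a x)"
      using proj[of i] proj[of "i + 1"] s l by simp
    ultimately have "q = \<gamma> (i + 1)"
      using step_uniq[OF \<gamma>X ax q(1) \<gamma>X q(2)] \<gamma>d[of i 1] by (metis of_nat_1)
    then show False using near[of "i + 1"] q s d_sym[OF q(1) x(1)] by simp
  qed
  show thesis
  proof (rule that[of "\<gamma> 0" "\<gamma> 1"])
    fix b assume b: "b \<in> carrier P" "b \<otimes> a = a \<otimes> b" "b \<noteq> \<one>"
    have ba: "act b (act a x) = act a (act b x)" if "x \<in> X" for x
      using act_mult[OF b(1) a that] act_mult[OF a b(1) that] b(2) by simp
    have "d (act b (\<gamma> 0)) (act a (act b (\<gamma> 0))) = l"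
      using act_iso[OF b(1) \<gamma>X \<gamma>X, of 0 "int l"] \<gamma>1[of 0] ba[OF \<gamma>X[of 0]] \<gamma>d[of 0 l] by simp
    then have "act b (\<gamma> 0) \<in> range \<gamma>" by (rule axis[OF act_closed[OF b(1) \<gamma>X]])
    then obtain t where t: "act b (\<gamma> 0) = \<gamma> t" by (elim imageE)
    have pw: "a [^] k \<otimes> b = b \<otimes> a [^] k" for k :: int
    proof -
      have n: "a [^] n \<otimes> b = b \<otimes> a [^] n" for n :: nat
        by (rule group_commutes_pow[OF b(2)[symmetric] a b(1)])
      have "inv (a [^] n) \<otimes> b = b \<otimes> inv (a [^] n)" for n :: nat
        by (rule commute_inv[OF nat_pow_closed[OF a] b(1) n])
      then show ?thesis unfolding int_pow_def2 by (cases "k < 0") (simp_all only: if_True if_False n)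
    qed
    have bk: "act b (\<gamma> (k * int l)) = \<gamma> (t + k * int l)" for k
    proof -
      have "\<gamma> (k * int l) = act (a [^] k) (\<gamma> 0)" using \<gamma>a[of k 0] by simp
      then have "act b (\<gamma> (k * int l)) = act (b \<otimes> a [^] k) (\<gamma> 0)" using act_mult[of b "a [^] k" "\<gamma> 0"] a b(1) \<gamma>X by simp
      also have "\<dots> = act (a [^] k) (\<gamma> t)" unfolding pw[symmetric] using act_mult[of "a [^] k" b "\<gamma> 0"] a b(1) \<gamma>X t by simp
      finally show ?thesis using \<gamma>a by simp
    qed
    \<comment> \<open>At multiples of \<open>l\<close> the translation by \<open>t\<close> follows
      from commuting with powers of \<open>a\<close>; the points in between are determined by their
      distances to these.\<close>
    have bt: "act b (\<gamma> i) = \<gamma> (i + t)" for i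
    proof -
      define k j where "k = i div int l" and "j = nat (i mod int l)"
      have lp: "int l > 0" using l by simp
      have i: "i = k * int l + int j" "j \<le> l"
        using lp pos_mod_bound[OF lp, of i] pos_mod_sign[OF lp, of i] by (auto simp: k_def j_def)
      have "act b (\<gamma> i) = \<gamma> ((t + k * int l) + int j)"
      proof (rule between[of _ _ l])
        have "d (act b (\<gamma> (k * int l))) (act b (\<gamma> i)) = j" using act_iso[OF b(1) \<gamma>X \<gamma>X] \<gamma>d i by simp
        then show "d (\<gamma> (t + k * int l)) (act b (\<gamma> i)) = j" using bk by simp
        have "d (act b (\<gamma> i)) (act b (\<gamma> ((k + 1) * int l))) = l - j"
          using act_iso[OF b(1) \<gamma>X \<gamma>X] \<gamma>d'[of i "(k + 1) * int l"] i by (simp add: algebra_simps)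
        then show "d (act b (\<gamma> i)) (\<gamma> (t + k * int l + int l)) = l - j"
          using bk[of "k + 1"] by (simp add: algebra_simps)
      qed (use b \<gamma>X i in auto)
      then show ?thesis using i by (simp add: algebra_simps)
    qed
    have bn: "act (b [^] n) (\<gamma> i) = \<gamma> (i + int n * t)" for n :: nat and i
    proof (induction n arbitrary: i)
      case 0
      then show ?case using act_one \<gamma>X by simp
    next
      case (Suc n)
      then show ?case using act_mult[of "b [^] n" b "\<gamma> i"] b bt \<gamma>X by (simp add: algebra_simps)
    qed
    show "\<exists>(n::nat) (m::int). b [^] n \<noteq> \<one> \<and> {\<gamma> 0, \<gamma> 1} \<subseteq> Fix {b [^] n \<otimes> a [^] m}"
    proof (cases "t = 0")
      case True
      then have "b [^] (1::nat) \<noteq> \<one> \<and> {\<gamma> 0, \<gamma> 1} \<subseteq> Fix {b [^] (1::nat) \<otimes> a [^] (0::int)}"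
        using b bt \<gamma>X by (auto simp: Fix_def)
      then show ?thesis by blast
    next
      case False
      \<comment> \<open>\<open>b [^] l\<close> translates by \<open>l * t\<close>, which
        \<open>a [^] (- t)\<close> undoes.\<close>
      have "act (b [^] l) (\<gamma> 0) \<noteq> \<gamma> 0" using bn False l \<gamma>inj by simp
      then have "b [^] l \<noteq> \<one>" using act_one \<gamma>X by metis
      moreover have "act (b [^] l \<otimes> a [^] (- t)) (\<gamma> i) = \<gamma> i" for i
        using act_mult[of "b [^] l" "a [^] (- t)" "\<gamma> i"] bn \<gamma>a a b \<gamma>X by simp
      ultimately have "b [^] l \<noteq> \<one> \<and> {\<gamma> 0, \<gamma> 1} \<subseteq> Fix {b [^] l \<otimes> a [^] (- t)}"
        using \<gamma>X by (auto simp: Fix_def)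
      then show ?thesis by blast
    qed
  qed (use \<gamma>X \<gamma>d[of 0 1] in auto)
qed

end

text \<open>These conditions describe a tree hung from \<open>r\<close>: lower neighbours connect
  every vertex to the root, and a highest vertex of a circuit would have two of them.\<close>

locale rooted_tree =
  fixes X :: "'x set" and R :: "('x \<times> 'x) set" and lev :: "'x \<Rightarrow> nat" and r :: 'x
  assumes R_X: "R \<subseteq> X \<times> X" and R_sym: "(x, y) \<in> R \<Longrightarrow> (y, x) \<in> R" and r: "r \<in> X"
    and lev_r: "lev r = 0" and lev_root: "x \<in> X \<Longrightarrow> lev x = 0 \<Longrightarrow> x = r"
    and lev_R: "(x, y) \<in> R \<Longrightarrow> lev y = Suc (lev x) \<or> lev x = Suc (lev y)"
    and lower_ex: "x \<in> X \<Longrightarrow> lev x \<noteq> 0 \<Longrightarrow> \<exists>y. (x, y) \<in> R \<and> lev y < lev x"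
    and lower_uniq: "(x, y) \<in> R \<Longrightarrow> (x, z) \<in> R \<Longrightarrow> lev y < lev x \<Longrightarrow> lev z < lev x \<Longrightarrow> y = z"
begin

definition D :: "'x \<Rightarrow> 'x \<Rightarrow> nat" where "D x y = (LEAST n. (x, y) \<in> R ^^ n)"

lemma relpow_sym: "(x, y) \<in> R ^^ n \<Longrightarrow> (y, x) \<in> R ^^ n"
proof (induction n arbitrary: y)
  case (Suc n)
  then obtain z where "(x, z) \<in> R ^^ n" "(z, y) \<in> R" by auto
  then show ?case using Suc.IH R_sym relpow_Suc_I2 by metis
qed simp

lemma path_root: "x \<in> X \<Longrightarrow> (x, r) \<in> R ^^ lev x"
proof (induction "lev x" arbitrary: x)
  case 0
  then show ?case using lev_root by simp
next
  case (Suc n)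
  have "lev x \<noteq> 0" using Suc.hyps(2) by simp
  then obtain y where y: "(x, y) \<in> R" "lev y < lev x" using lower_ex[OF Suc.prems] by blast
  have n: "lev x = Suc (lev y)" using lev_R[OF y(1)] y(2) by linarith
  have "y \<in> X" using y(1) R_X by blast
  then have "(y, r) \<in> R ^^ lev y" using Suc.hyps n by simp
  then show ?case unfolding n by (rule relpow_Suc_I2[OF y(1)])
qed

lemma path_ex: "x \<in> X \<Longrightarrow> y \<in> X \<Longrightarrow> \<exists>n. (x, y) \<in> R ^^ n"
  by (rule exI[of _ "lev x + lev y"]) (rule relpow_trans[OF path_root relpow_sym[OF path_root]])

lemma D_path: "x \<in> X \<Longrightarrow> y \<in> X \<Longrightarrow> (x, y) \<in> R ^^ D x y"
  unfolding D_def by (rule LeastI_ex[OF path_ex])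

lemma D_le: "(x, y) \<in> R ^^ n \<Longrightarrow> D x y \<le> n"
  unfolding D_def by (rule Least_le)

lemma D_sym: "x \<in> X \<Longrightarrow> y \<in> X \<Longrightarrow> D x y = D y x"
  using D_le[OF relpow_sym[OF D_path], of x y] D_le[OF relpow_sym[OF D_path], of y x] by simp

lemma D_tri: "x \<in> X \<Longrightarrow> y \<in> X \<Longrightarrow> z \<in> X \<Longrightarrow> D x z \<le> D x y + D y z"
  using D_le[OF relpow_trans[OF D_path D_path]] .

lemma D_0: "x \<in> X \<Longrightarrow> y \<in> X \<Longrightarrow> D x y = 0 \<longleftrightarrow> x = y"
proof
  show "D x y = 0 \<Longrightarrow> x = y" if "x \<in> X" "y \<in> X" using D_path[OF that] by simp
  show "x = y \<Longrightarrow> D x y = 0" using D_le[of x y 0] by simp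
qed

lemma R_neq: "(x, y) \<in> R \<Longrightarrow> x \<noteq> y"
  using lev_R[of x x] by auto

lemma D_1: "x \<in> X \<Longrightarrow> y \<in> X \<Longrightarrow> D x y = 1 \<longleftrightarrow> (x, y) \<in> R"
proof
  show "D x y = 1 \<Longrightarrow> (x, y) \<in> R" if "x \<in> X" "y \<in> X" using D_path[OF that] by simp
  show "D x y = 1" if "(x, y) \<in> R" "x \<in> X" "y \<in> X"
    using that D_le[of x y 1] D_0[of x y] R_neq[of x y] by auto
qed

lemma D_step:
  assumes "x \<in> X" "y \<in> X" "x \<noteq> y"
  obtains z where "z \<in> X" "(x, z) \<in> R" "D x y = Suc (D z y)"
proof -
  obtain n where n: "D x y = Suc n" using D_0 assms by (cases "D x y") auto
  then have "(x, y) \<in> R ^^ Suc n" using D_path[OF assms(1,2)] by simp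
  then obtain z where z: "(x, z) \<in> R" "(z, y) \<in> R ^^ n" by (meson relpow_Suc_D2)
  have zX: "z \<in> X" using z R_X by blast
  have "D z y \<le> n" using D_le z by blast
  moreover have "D x y \<le> 1 + D z y" using D_tri[OF assms(1) zX assms(2)] D_1[OF assms(1) zX] z by simp
  ultimately show thesis using that[OF zX z(1)] n by simp
qed

text \<open>Bipartiteness of the graph; it yields both the axiom \<open>d_neq\<close> and the
  absence of inversions.\<close>

lemma lev_parity: "(x, y) \<in> R ^^ n \<Longrightarrow> even (n + lev x + lev y)"
proof (induction n arbitrary: y)
  case (Suc n)
  then obtain z where z: "(x, z) \<in> R ^^ n" "(z, y) \<in> R" by auto
  then show ?case using Suc.IH[OF z(1)] lev_R[OF z(2)] by auto
qed simp

lemma D_R: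
  assumes "(x, z) \<in> R" "y \<in> X"
  shows "D z y = Suc (D x y) \<or> D x y = Suc (D z y)"
proof -
  have X: "x \<in> X" "z \<in> X" using assms R_X by auto
  have 1: "D x z = 1" "D z x = 1" using D_1[OF X] D_1[OF X(2,1)] assms(1) R_sym[OF assms(1)] by simp_all
  have "D x y \<noteq> D z y"
    using lev_parity[OF D_path[OF X(1) assms(2)]] lev_parity[OF D_path[OF X(2) assms(2)]] lev_R[OF assms(1)]
    by auto
  then show ?thesis using D_tri[OF X assms(2)] D_tri[OF X(2,1) assms(2)] 1 by linarith
qed

text \<open>This is \<open>step_uniq\<close> for the target \<open>y\<close>. For the root it
  follows from the levels, and it is then carried along edges to every other target, so that
  circuits never have to be discussed.\<close>

definition descent :: "'x \<Rightarrow> bool" where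
  "descent y \<longleftrightarrow> (\<forall>x z z'. (x, z) \<in> R \<longrightarrow> (x, z') \<in> R \<longrightarrow> D z y < D x y \<longrightarrow> D z' y < D x y \<longrightarrow> z = z')"

lemma D_root: "x \<in> X \<Longrightarrow> D x r = lev x"
proof -
  have "lev x \<le> n" if "(x, r) \<in> R ^^ n" for n x
    using that
  proof (induction n arbitrary: x)
    case 0
    then show ?case using lev_r by simp
  next
    case (Suc n)
    then obtain z where z: "(x, z) \<in> R" "(z, r) \<in> R ^^ n" by (meson relpow_Suc_D2)
    then show ?case using Suc.IH[OF z(2)] lev_R[OF z(1)] by auto
  qed
  then show "x \<in> X \<Longrightarrow> D x r = lev x" using D_path[OF _ r, of x] D_le[OF path_root[of x]] le_antisym by metis
qed

lemma descent_root: "descent r"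
  unfolding descent_def
proof (intro allI impI)
  fix x z z' assume xz: "(x, z) \<in> R" "(x, z') \<in> R" and lt: "D z r < D x r" "D z' r < D x r"
  have "x \<in> X" "z \<in> X" "z' \<in> X" using xz R_X by auto
  then show "z = z'" using lower_uniq[OF xz] lt by (simp add: D_root)
qed

text \<open>The only edge out of the branch of \<open>y'\<close>, seen from \<open>y\<close>, is \<open>{y, y'}\<close>.\<close>

lemma descent_step:
  assumes y: "descent y" and yy: "(y, y') \<in> R"
  shows "descent y'"
proof -
  have X: "y \<in> X" "y' \<in> X" using yy R_X by auto
  have d1: "D y y' = 1" "D y' y = 1" using D_1[OF X] D_1[OF X(2,1)] yy R_sym[OF yy] by simp_all
  have near: "D x y' = Suc (D x y) \<or> D x y = Suc (D x y')" if "x \<in> X" for x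
    using D_R[OF yy that] D_sym that X by metis
  have uniq: "z = z'" if "(x, z) \<in> R" "(x, z') \<in> R" "D z y < D x y" "D z' y < D x y" for x z z'
    using y that unfolding descent_def by blast
  have bridge: "p = y' \<and> q = y"
    if pq: "(p, q) \<in> R" and p: "D p y = Suc (D p y')" and q: "D q y' = Suc (D q y)" for p q
  proof -
    have X': "p \<in> X" "q \<in> X" using pq R_X by auto
    have lin: "D q y = D p y'"
      using D_R[OF pq X(1)] D_R[OF pq X(2)] p q by linarith
    have "p = y'"
    proof (rule ccontr)
      assume "p \<noteq> y'"
      then obtain p' where p': "p' \<in> X" "(p, p') \<in> R" "D p y' = Suc (D p' y')"
        using D_step[OF X'(1) X(2)] by metis
      have "D p' y \<le> D p' y' + 1" using D_tri[OF p'(1) X(2,1)] d1 by simp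
      then have "D p' y < D p y" using p' p by simp
      then have "p' = q" using uniq[OF p'(2) pq] lin p by simp
      then show False using p' q lin by simp
    qed
    then show ?thesis using lin D_0[OF X'(2) X(1)] D_0[OF X(2) X(2)] by simp
  qed
  show ?thesis
    unfolding descent_def
  proof (intro allI impI)
    fix x z z' assume xz: "(x, z) \<in> R" "(x, z') \<in> R" and lt: "D z y' < D x y'" "D z' y' < D x y'"
    have X': "x \<in> X" "z \<in> X" "z' \<in> X" using xz R_X by auto
    show "z = z'"
    proof (cases "D x y = Suc (D x y')")
      case True
      \<comment> \<open>Here \<open>x\<close> lies on the side of \<open>y'\<close>, so a step
        approaching \<open>y'\<close> also approaches \<open>y\<close>.\<close>
      have "D z y < D x y" if "(x, z) \<in> R" "D z y' < D x y'" for z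
      proof (rule ccontr)
        assume n: "\<not> D z y < D x y"
        have zX: "z \<in> X" using that R_X by auto
        have "D z y' < D z y" using n that True by simp
        then show False
          using near[OF zX] D_R[OF that(1) X(1)] D_R[OF that(1) X(2)] n that True by linarith
      qed
      then show ?thesis using uniq[OF xz] xz lt by simp
    next
      case False
      then have x: "D x y' = Suc (D x y)" using near[OF X'(1)] by blast
      \<comment> \<open>Here \<open>x\<close> lies on the side of \<open>y\<close>, and a step that
        approaches \<open>y'\<close> but not \<open>y\<close> must cross the edge from
        \<open>y\<close> to \<open>y'\<close>.\<close>
      have *: "z = y' \<and> x = y" if "(x, z) \<in> R" "D z y' < D x y'" "\<not> D z y < D x y" for z
      proof (rule bridge)
        show "(z, x) \<in> R" using that R_sym by blast
        have "z \<in> X" using that R_X by auto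
        then show "D z y = Suc (D z y')"
          using near[of z] D_R[OF that(1) X(1)] D_R[OF that(1) X(2)] that x by linarith
      qed (rule x)
      show ?thesis
      proof (cases "D z y < D x y \<and> D z' y < D x y")
        case True
        then show ?thesis using uniq[OF xz] by blast
      next
        case False
        then have "x = y" using *[OF xz(1) lt(1)] *[OF xz(2) lt(2)] by argo
        then have "\<not> D z y < D x y" "\<not> D z' y < D x y" using D_0[OF X(1) X(1)] by auto
        then show ?thesis using *[OF xz(1) lt(1)] *[OF xz(2) lt(2)] by argo
      qed
    qed
  qed
qed

lemma descent_all: "y \<in> X \<Longrightarrow> descent y"
proof -
  have "descent y" if "(r, y) \<in> R ^^ n" for n y
    using that
  proof (induction n arbitrary: y)
    case 0
    then show ?case using descent_root by simp
  next
    case (Suc n)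
    then obtain z where "(r, z) \<in> R ^^ n" "(z, y) \<in> R" by auto
    then show ?case using Suc.IH descent_step by blast
  qed
  then show "y \<in> X \<Longrightarrow> descent y" using path_ex[OF r] by blast
qed

lemma tree: "tree X D"
proof
  show "\<exists>z\<in>X. D x z = 1 \<and> D x y = Suc (D z y)" if "x \<in> X" "y \<in> X" "x \<noteq> y" for x y
    by (rule D_step[OF that]) (use D_1 that(1) in blast)
  show "z = z'" if "x \<in> X" "y \<in> X" "z \<in> X" "z' \<in> X" "D x z = 1" "D x z' = 1"
    "D z y < D x y" "D z' y < D x y" for x y z z'
    using descent_all[OF that(2)] that(5-8) D_1[OF that(1,3)] D_1[OF that(1,4)] unfolding descent_def by simp
  show "D x y \<noteq> D z y" if "x \<in> X" "y \<in> X" "z \<in> X" "D x z = 1" for x y z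
    using D_R[OF _ that(2), of x z] D_1[OF that(1,3)] that(4) by fastforce
qed ((rule D_0 D_sym D_tri; assumption)+)

end

section \<open>Graph products\<close>

lemma graph_product_induct:
  assumes simp: "simplicial_graph \<Gamma>" and grp: "\<forall>u\<in>verts \<Gamma>. group (G u)"
    and x: "x \<in> carrier (graph_product \<Gamma> G)" and one: "Q \<one>\<^bsub>graph_product \<Gamma> G\<^esub>"
    and step: "\<And>u a y. u \<in> verts \<Gamma> \<Longrightarrow> a \<in> carrier (G u) \<Longrightarrow> y \<in> carrier (graph_product \<Gamma> G) \<Longrightarrow> Q y \<Longrightarrow>
      Q (vertex_incl \<Gamma> G u a \<otimes>\<^bsub>graph_product \<Gamma> G\<^esub> y)"
  shows "Q x"
proof -
  let ?F = "free_product (verts \<Gamma>) G" and ?N = "edge_relators \<Gamma> G"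
  interpret F: group ?F by (rule group_free_product[OF grp])
  interpret N: normal ?N ?F by (rule edge_relators_normal[OF simp grp])
  have "Q (?N #>\<^bsub>?F\<^esub> word_class (verts \<Gamma>) G w)" if "w \<in> words (verts \<Gamma>) G" for w
    using that
  proof (induction w)
    case Nil
    have "word_class (verts \<Gamma>) G [] = \<one>\<^bsub>?F\<^esub>" by (simp add: free_product_def)
    moreover have "?N #>\<^bsub>?F\<^esub> \<one>\<^bsub>?F\<^esub> = \<one>\<^bsub>graph_product \<Gamma> G\<^esub>"
      using F.coset_mult_one[OF N.subset] by (simp add: graph_product_def)
    ultimately show ?case using one by simp
  next
    case (Cons p w)
    then obtain u a where p: "p = (u, a)" "u \<in> verts \<Gamma>" "a \<in> carrier (G u)" and w: "w \<in> words (verts \<Gamma>) G"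
      by (cases p) (auto simp: words_def)
    have pw: "[(u, a)] \<in> words (verts \<Gamma>) G" using p by (simp add: words_def)
    have c: "word_class (verts \<Gamma>) G w \<in> carrier ?F" "free_incl (verts \<Gamma>) G u a \<in> carrier ?F"
      using w pw by (auto simp: free_product_def free_incl_def)
    have "word_class (verts \<Gamma>) G (p # w) = free_incl (verts \<Gamma>) G u a \<otimes>\<^bsub>?F\<^esub> word_class (verts \<Gamma>) G w"
      using word_class_mult[OF pw w] by (simp add: p free_incl_def)
    then have "?N #>\<^bsub>?F\<^esub> word_class (verts \<Gamma>) G (p # w) =
        vertex_incl \<Gamma> G u a \<otimes>\<^bsub>graph_product \<Gamma> G\<^esub> (?N #>\<^bsub>?F\<^esub> word_class (verts \<Gamma>) G w)"
      using c by (simp add: graph_product_def vertex_incl_def N.rcos_sum)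
    moreover have "?N #>\<^bsub>?F\<^esub> word_class (verts \<Gamma>) G w \<in> carrier (graph_product \<Gamma> G)"
      using c by (auto simp: graph_product_def carrier_FactGroup)
    ultimately show ?case using step[OF p(2,3)] Cons.IH[OF w] by simp
  qed
  moreover obtain w where "w \<in> words (verts \<Gamma>) G" "x = ?N #>\<^bsub>?F\<^esub> word_class (verts \<Gamma>) G w"
    using x by (auto simp: graph_product_def carrier_FactGroup free_product_def)
  ultimately show ?thesis by simp
qed

text \<open>An internal decomposition: the images \<open>K u\<close> of the vertex-groups lie in a
  fixed \<open>P\<close>, so that two graph products of the same group can be compared without
  transporting elements along an isomorphism.\<close>

locale graph_decomp = group P for P :: "'g monoid" (structure) +
  fixes \<Gamma> :: "'v sgraph" and G :: "'v \<Rightarrow> 'a monoid" and \<phi> :: "('v \<times> 'a) list set set \<Rightarrow> 'g"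
  assumes simp_graph: "simplicial_graph \<Gamma>" and vertex_groups: "vertex_groups \<Gamma> G"
    and fin_verts: "finite (verts \<Gamma>)" and iso_\<phi>: "\<phi> \<in> iso (graph_product \<Gamma> G) P"
begin

abbreviation V :: "'v set" where "V \<equiv> verts \<Gamma>"

definition adj :: "'v \<Rightarrow> 'v \<Rightarrow> bool" where "adj u v \<longleftrightarrow> {u, v} \<in> edges \<Gamma>"

definition \<iota> :: "'v \<Rightarrow> 'a \<Rightarrow> 'g" where "\<iota> u a = \<phi> (vertex_incl \<Gamma> G u a)"

definition K :: "'v \<Rightarrow> 'g set" where "K u = \<iota> u ` carrier (G u)"

lemma grp: "\<forall>u\<in>V. group (G u)"
  using vertex_groups by (simp add: vertex_groups_def)

lemma adj_sym: "adj u v \<longleftrightarrow> adj v u"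
  by (simp add: adj_def insert_commute)

lemma adjD: "adj u v \<Longrightarrow> u \<in> V" "adj u v \<Longrightarrow> v \<in> V" "adj u v \<Longrightarrow> u \<noteq> v"
  using simplicial_edgeD[OF simp_graph] by (auto simp: adj_def)

lemma adj_irrefl [simp]: "\<not> adj u u"
  using adjD(3) by blast

lemma \<phi>_hom: "\<phi> \<in> hom (graph_product \<Gamma> G) P"
  using iso_\<phi> by (simp add: iso_def)

lemma \<phi>_bij: "bij_betw \<phi> (carrier (graph_product \<Gamma> G)) (carrier P)"
  using iso_\<phi> by (simp add: iso_def)

lemma incl_closed: "u \<in> V \<Longrightarrow> a \<in> carrier (G u) \<Longrightarrow> vertex_incl \<Gamma> G u a \<in> carrier (graph_product \<Gamma> G)"
  using hom_in_carrier[OF vertex_incl_hom[OF simp_graph grp]] .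

lemma \<iota>_hom: "u \<in> V \<Longrightarrow> \<iota> u \<in> hom (G u) P"
  using Group.hom_compose[OF vertex_incl_hom[OF simp_graph grp] \<phi>_hom] by (simp add: \<iota>_def[abs_def] o_def)

lemma \<iota>_inj: "u \<in> V \<Longrightarrow> inj_on (\<iota> u) (carrier (G u))"
proof (rule inj_onI)
  fix a b assume u: "u \<in> V" and ab: "a \<in> carrier (G u)" "b \<in> carrier (G u)" "\<iota> u a = \<iota> u b"
  then have "vertex_incl \<Gamma> G u a = vertex_incl \<Gamma> G u b"
    using \<phi>_bij incl_closed[OF u] by (simp add: \<iota>_def bij_betw_def inj_on_def)
  then show "a = b" using vertex_retraction[OF simp_graph grp u] ab(1,2) by metis
qed

lemma K_subgroup: "u \<in> V \<Longrightarrow> subgroup (K u) P"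
proof -
  assume u: "u \<in> V"
  interpret group_hom "G u" P "\<iota> u"
    using u grp \<iota>_hom[OF u] is_group by (simp add: group_hom_def group_hom_axioms_def)
  show ?thesis unfolding K_def by (rule img_is_subgroup)
qed

lemma K_closed: "u \<in> V \<Longrightarrow> a \<in> K u \<Longrightarrow> a \<in> carrier P"
  using subgroup.mem_carrier[OF K_subgroup] .

lemma K_one: "u \<in> V \<Longrightarrow> \<one> \<in> K u"
  using subgroup.one_closed[OF K_subgroup] .

lemma K_mult: "u \<in> V \<Longrightarrow> a \<in> K u \<Longrightarrow> b \<in> K u \<Longrightarrow> a \<otimes> b \<in> K u"
  using subgroup.m_closed[OF K_subgroup] .

lemma K_inv: "u \<in> V \<Longrightarrow> a \<in> K u \<Longrightarrow> inv a \<in> K u"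
  using subgroup.m_inv_closed[OF K_subgroup] .

lemma K_commute: "adj u v \<Longrightarrow> a \<in> K u \<Longrightarrow> b \<in> K v \<Longrightarrow> a \<otimes> b = b \<otimes> a"
proof -
  assume uv: "adj u v" and "a \<in> K u" "b \<in> K v"
  then obtain c e where ce: "c \<in> carrier (G u)" "e \<in> carrier (G v)" "a = \<iota> u c" "b = \<iota> v e"
    by (auto simp: K_def)
  note c = incl_closed[OF adjD(1)[OF uv] ce(1)] incl_closed[OF adjD(2)[OF uv] ce(2)]
  show ?thesis
    using vertex_incl_commute[OF simp_graph grp uv[unfolded adj_def] ce(1,2)]
      hom_mult[OF \<phi>_hom c] hom_mult[OF \<phi>_hom c(2,1)] by (simp add: ce \<iota>_def)
qed

lemma K_nontrivial: "u \<in> V \<Longrightarrow> \<exists>a\<in>K u. a \<noteq> \<one>"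
proof -
  assume u: "u \<in> V"
  interpret Gu: group "G u" using grp u by blast
  have "carrier (G u) \<noteq> {\<one>\<^bsub>G u\<^esub>}" using vertex_groups u by (simp add: vertex_groups_def)
  then obtain a where a: "a \<in> carrier (G u)" "a \<noteq> \<one>\<^bsub>G u\<^esub>" using Gu.one_closed by blast
  then have "\<iota> u a \<noteq> \<iota> u \<one>\<^bsub>G u\<^esub>" using \<iota>_inj[OF u] Gu.one_closed by (metis inj_onD)
  then show ?thesis using a hom_one[OF \<iota>_hom[OF u] Gu.is_group is_group] by (auto simp: K_def)
qed

lemma gen_induct:
  assumes x: "x \<in> carrier P" and one: "Q \<one>"
    and step: "\<And>u a y. u \<in> V \<Longrightarrow> a \<in> K u \<Longrightarrow> y \<in> carrier P \<Longrightarrow> Q y \<Longrightarrow> Q (a \<otimes> y)"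
  shows "Q x"
proof -
  have "Q (\<phi> y)" if "y \<in> carrier (graph_product \<Gamma> G)" for y
    using that
  proof (rule graph_product_induct[OF simp_graph grp, where Q = "\<lambda>y. Q (\<phi> y)"])
    show "Q (\<phi> \<one>\<^bsub>graph_product \<Gamma> G\<^esub>)"
      using hom_one[OF \<phi>_hom group_graph_product[OF simp_graph grp] is_group] one by simp
    fix u a y assume u: "u \<in> V" "a \<in> carrier (G u)" and y: "y \<in> carrier (graph_product \<Gamma> G)" "Q (\<phi> y)"
    then show "Q (\<phi> (vertex_incl \<Gamma> G u a \<otimes>\<^bsub>graph_product \<Gamma> G\<^esub> y))"
      using step[of u "\<iota> u a" "\<phi> y"] hom_mult[OF \<phi>_hom incl_closed[OF u] y(1)] hom_in_carrier[OF \<phi>_hom y(1)]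
      by (simp add: \<iota>_def K_def)
  qed
  moreover obtain y where "y \<in> carrier (graph_product \<Gamma> G)" "x = \<phi> y"
    using x \<phi>_bij unfolding bij_betw_def by blast
  ultimately show ?thesis by simp
qed

lemma universal:
  assumes H: "group H" and f: "\<And>u. u \<in> V \<Longrightarrow> f u \<in> hom (P\<lparr>carrier := K u\<rparr>) H"
    and comm: "\<And>u v a b. adj u v \<Longrightarrow> a \<in> K u \<Longrightarrow> b \<in> K v \<Longrightarrow> f u a \<otimes>\<^bsub>H\<^esub> f v b = f v b \<otimes>\<^bsub>H\<^esub> f u a"
  obtains h where "h \<in> hom P H" "\<And>u a. u \<in> V \<Longrightarrow> a \<in> K u \<Longrightarrow> h a = f u a"
proof -
  let ?GP = "graph_product \<Gamma> G"
  interpret GP: group ?GP by (rule group_graph_product[OF simp_graph grp])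
  obtain k where k: "k \<in> hom ?GP H"
    "\<And>u a. u \<in> V \<Longrightarrow> a \<in> carrier (G u) \<Longrightarrow> k (vertex_incl \<Gamma> G u a) = f u (\<iota> u a)"
  proof (rule graph_product_universal[OF simp_graph grp H, of "\<lambda>u a. f u (\<iota> u a)"])
    show "(\<lambda>a. f u (\<iota> u a)) \<in> hom (G u) H" if u: "u \<in> V" for u
    proof (rule homI)
      fix a b assume ab: "a \<in> carrier (G u)" "b \<in> carrier (G u)"
      have "\<iota> u a \<in> K u" "\<iota> u b \<in> K u" using ab by (auto simp: K_def)
      then show "f u (\<iota> u a) \<in> carrier H"
        "f u (\<iota> u (a \<otimes>\<^bsub>G u\<^esub> b)) = f u (\<iota> u a) \<otimes>\<^bsub>H\<^esub> f u (\<iota> u b)"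
        using hom_in_carrier[OF f[OF u]] hom_mult[OF f[OF u]] hom_mult[OF \<iota>_hom[OF u] ab] by auto
    qed
    show "f u (\<iota> u a) \<otimes>\<^bsub>H\<^esub> f v (\<iota> v b) = f v (\<iota> v b) \<otimes>\<^bsub>H\<^esub> f u (\<iota> u a)"
      if "{u, v} \<in> edges \<Gamma>" "a \<in> carrier (G u)" "b \<in> carrier (G v)" for u v a b
      by (rule comm) (use that in \<open>auto simp: adj_def K_def\<close>)
  qed blast
  define \<psi> where "\<psi> = inv_into (carrier ?GP) \<phi>"
  have \<psi>: "\<psi> \<in> hom P ?GP" using GP.iso_set_sym[OF iso_\<phi>] by (simp add: \<psi>_def iso_def)
  show thesis
  proof (rule that[of "k \<circ> \<psi>"])
    show "k \<circ> \<psi> \<in> hom P H" by (rule Group.hom_compose[OF \<psi> k(1)])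
    fix u a assume u: "u \<in> V" and "a \<in> K u"
    then obtain c where c: "c \<in> carrier (G u)" "a = \<iota> u c" by (auto simp: K_def)
    have "\<psi> a = vertex_incl \<Gamma> G u c"
      unfolding \<psi>_def c \<iota>_def using \<phi>_bij incl_closed[OF u c(1)] by (simp add: bij_betw_inv_into_left)
    then show "(k \<circ> \<psi>) a = f u a" using k(2)[OF u c(1)] c by simp
  qed
qed

lemma hom_eqI:
  assumes H: "group H" and h: "h \<in> hom P H" "k \<in> hom P H"
    and eq: "\<And>u a. u \<in> V \<Longrightarrow> a \<in> K u \<Longrightarrow> h a = k a" and x: "x \<in> carrier P"
  shows "h x = k x"
  using x
proof (rule gen_induct)
  show "h \<one> = k \<one>" using hom_one[OF h(1) is_group H] hom_one[OF h(2) is_group H] by simp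
  show "h (a \<otimes> y) = k (a \<otimes> y)" if "u \<in> V" "a \<in> K u" "y \<in> carrier P" "h y = k y" for u a y
    using hom_mult[OF h(1) K_closed[OF that(1,2)] that(3)] hom_mult[OF h(2) K_closed[OF that(1,2)] that(3)]
      eq[OF that(1,2)] that(4) by simp
qed

subsection \<open>Normal forms\<close>

text \<open>
  A reduced word is stored as one stack per vertex: a syllable \<open>a \<in> K u\<close> pushes \<open>Some a\<close> on the
  stack of \<open>u\<close> and a blocking \<open>None\<close> on the stacks of the other vertices not adjacent to \<open>u\<close>. Two
  words differ by exchanges of commuting syllables iff they have the same stacks.
\<close>

definition push :: "'v \<Rightarrow> 'g \<Rightarrow> ('v \<Rightarrow> 'g option list) \<Rightarrow> 'v \<Rightarrow> 'g option list" where
  "push u a \<sigma> = (\<lambda>t. if t = u then Some a # \<sigma> t else if adj u t then \<sigma> t else None # \<sigma> t)"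

definition pop :: "'v \<Rightarrow> ('v \<Rightarrow> 'g option list) \<Rightarrow> 'v \<Rightarrow> 'g option list" where
  "pop u \<sigma> = (\<lambda>t. if t = u \<or> \<not> adj u t then tl (\<sigma> t) else \<sigma> t)"

definition headed :: "'v \<Rightarrow> ('v \<Rightarrow> 'g option list) \<Rightarrow> bool" where
  "headed u \<sigma> \<longleftrightarrow> (\<exists>b r. \<sigma> u = Some b # r)"

inductive nf :: "('v \<Rightarrow> 'g option list) \<Rightarrow> 'g \<Rightarrow> bool" where
  Nil: "nf (\<lambda>_. []) \<one>"
| Push: "nf \<sigma> g \<Longrightarrow> u \<in> V \<Longrightarrow> a \<in> K u \<Longrightarrow> a \<noteq> \<one> \<Longrightarrow> \<not> headed u \<sigma> \<Longrightarrow> nf (push u a \<sigma>) (a \<otimes> g)"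

lemma nf_closed: "nf \<sigma> g \<Longrightarrow> g \<in> carrier P"
  by (induction rule: nf.induct) (auto simp: K_closed)

lemma pop_push [simp]: "pop u (push u a \<sigma>) = \<sigma>"
  by (auto simp: pop_def push_def)

lemma push_commute: "adj u v \<Longrightarrow> push u a (push v b \<sigma>) = push v b (push u a \<sigma>)"
  using adj_sym[of u v] adjD(3)[of u v] by (intro ext) (simp add: push_def)

lemma push_at: "push u a \<sigma> u = Some a # \<sigma> u"
  by (simp add: push_def)

lemma push_adj: "adj u t \<Longrightarrow> push u a \<sigma> t = \<sigma> t"
  using adjD(3) by (auto simp: push_def)

lemma push_nonadj: "t \<noteq> u \<Longrightarrow> \<not> adj u t \<Longrightarrow> push u a \<sigma> t = None # \<sigma> t"
  by (simp add: push_def)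

lemma headed_adj: "adj u t \<Longrightarrow> headed t (push u a \<sigma>) \<longleftrightarrow> headed t \<sigma>"
  by (simp add: headed_def push_adj)

text \<open>Whatever was pushed after \<open>b\<close> left nothing above it on the stack of
  \<open>u\<close>, so it belongs to vertices adjacent to \<open>u\<close> and commutes with
  \<open>b\<close>; hence \<open>b\<close> can be brought to the front.\<close>

lemma nf_peel:
  assumes "nf \<sigma> g" "\<sigma> u = Some b # r"
  shows "u \<in> V \<and> b \<in> K u \<and> b \<noteq> \<one> \<and> (\<exists>\<tau> h. nf \<tau> h \<and> \<not> headed u \<tau> \<and> \<sigma> = push u b \<tau> \<and> g = b \<otimes> h)"
  using assms
proof (induction arbitrary: r rule: nf.induct)
  case Nil
  then show ?case by simp
next
  case (Push \<sigma> g v c)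
  consider "v = u" | "v \<noteq> u" "adj v u" | "v \<noteq> u" "\<not> adj v u" by blast
  then show ?case
  proof cases
    case 1
    then have "c = b" using Push.prems by (simp add: push_at)
    then show ?thesis using 1 Push.hyps by blast
  next
    case 2
    have "\<sigma> u = Some b # r" using Push.prems 2 by (simp add: push_adj)
    from Push.IH[OF this] obtain \<tau> h where u: "u \<in> V" "b \<in> K u" "b \<noteq> \<one>"
      and \<tau>: "nf \<tau> h" "\<not> headed u \<tau>" "\<sigma> = push u b \<tau>" "g = b \<otimes> h" by blast
    have uv: "adj u v" using 2 adj_sym by blast
    have "\<not> headed v \<tau>" using Push.hyps(5) \<tau>(3) headed_adj[OF uv] by simp
    then have "nf (push v c \<tau>) (c \<otimes> h)" using nf.Push[OF \<tau>(1) Push.hyps(2-4)] by blast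
    moreover have "\<not> headed u (push v c \<tau>)" using headed_adj[OF 2(2)] \<tau>(2) by simp
    moreover have "push v c \<sigma> = push u b (push v c \<tau>)" using push_commute[OF 2(2)] \<tau>(3) by simp
    moreover have "c \<otimes> g = b \<otimes> (c \<otimes> h)"
    proof -
      have cl: "b \<in> carrier P" "c \<in> carrier P" "h \<in> carrier P"
        using K_closed u Push.hyps nf_closed[OF \<tau>(1)] by auto
      have "c \<otimes> g = (c \<otimes> b) \<otimes> h" using cl \<tau>(4) by (simp add: m_assoc)
      also have "\<dots> = (b \<otimes> c) \<otimes> h" using K_commute[OF 2(2) Push.hyps(3) u(2)] by simp
      finally show ?thesis using cl by (simp add: m_assoc)
    qed
    ultimately show ?thesis using u by blast
  next
    case 3
    then show ?thesis using Push.prems push_nonadj[of u v c \<sigma>] by auto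
  qed
qed

definition Stk :: "('v \<Rightarrow> 'g option list) set" where "Stk = {\<sigma>. \<exists>g. nf \<sigma> g}"

definition pushe :: "'v \<Rightarrow> 'g \<Rightarrow> ('v \<Rightarrow> 'g option list) \<Rightarrow> 'v \<Rightarrow> 'g option list" where
  "pushe u a \<sigma> = (if a = \<one> then \<sigma> else push u a \<sigma>)"

text \<open>The action of \<open>K u\<close> in van der Waerden's argument: the syllable is merged
  with a head at \<open>u\<close> if there is one, and disappears if the result is trivial.\<close>

definition lact :: "'v \<Rightarrow> 'g \<Rightarrow> ('v \<Rightarrow> 'g option list) \<Rightarrow> 'v \<Rightarrow> 'g option list" where
  "lact u a \<sigma> = (if headed u \<sigma> then pushe u (a \<otimes> the (hd (\<sigma> u))) (pop u \<sigma>) else pushe u a \<sigma>)"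

text \<open>A stack family consists of a coordinate \<open>b\<close> in \<open>K u\<close>, possibly
  \<open>\<one>\<close>, on top of one without head at \<open>u\<close>. In this form
  \<open>lact\<close> is multiplication on \<open>b\<close>, which makes the action laws
  immediate.\<close>

lemma Stk_decomp:
  assumes "\<sigma> \<in> Stk" "u \<in> V"
  obtains b \<tau> where "b \<in> K u" "\<tau> \<in> Stk" "\<not> headed u \<tau>" "\<sigma> = pushe u b \<tau>"
proof (cases "headed u \<sigma>")
  case True
  then obtain b r where "\<sigma> u = Some b # r" by (auto simp: headed_def)
  then show thesis using nf_peel[of \<sigma> _ u b r] assms(1) that[of b] by (fastforce simp: Stk_def pushe_def)
next
  case False
  then show thesis using that[of \<one> \<sigma>] assms K_one by (simp add: pushe_def)
qed

lemma pushe_Stk: "\<tau> \<in> Stk \<Longrightarrow> \<not> headed u \<tau> \<Longrightarrow> u \<in> V \<Longrightarrow> a \<in> K u \<Longrightarrow> pushe u a \<tau> \<in> Stk"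
  using nf.Push by (fastforce simp: Stk_def pushe_def)

lemma lact_pushe:
  assumes "\<not> headed u \<tau>" "u \<in> V" "a \<in> K u" "b \<in> K u"
  shows "lact u a (pushe u b \<tau>) = pushe u (a \<otimes> b) \<tau>"
proof (cases "b = \<one>")
  case True
  then show ?thesis using assms K_closed by (simp add: lact_def pushe_def)
next
  case False
  have "headed u (push u b \<tau>)" by (simp add: headed_def push_at)
  then show ?thesis using False by (simp add: lact_def pushe_def push_at)
qed

lemma headed_pushe_adj: "adj u v \<Longrightarrow> headed v (pushe u a \<tau>) \<longleftrightarrow> headed v \<tau>"
  by (simp add: pushe_def headed_adj)

lemma pushe_commute: "adj u v \<Longrightarrow> pushe u a (pushe v b \<sigma>) = pushe v b (pushe u a \<sigma>)"
  unfolding pushe_def by (auto intro: push_commute)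

lemma lact_closed: "\<sigma> \<in> Stk \<Longrightarrow> u \<in> V \<Longrightarrow> a \<in> K u \<Longrightarrow> lact u a \<sigma> \<in> Stk"
  by (metis Stk_decomp lact_pushe pushe_Stk K_mult)

lemma lact_mult:
  assumes "\<sigma> \<in> Stk" "u \<in> V" "a \<in> K u" "b \<in> K u"
  shows "lact u (a \<otimes> b) \<sigma> = lact u a (lact u b \<sigma>)"
proof -
  obtain c \<tau> where c: "c \<in> K u" "\<tau> \<in> Stk" "\<not> headed u \<tau>" "\<sigma> = pushe u c \<tau>"
    using Stk_decomp assms by blast
  show ?thesis
    unfolding c(4) using assms(2-4) c(1,3)
    by (simp add: lact_pushe K_mult m_assoc K_closed)
qed

lemma lact_one: "\<sigma> \<in> Stk \<Longrightarrow> u \<in> V \<Longrightarrow> lact u \<one> \<sigma> = \<sigma>"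
proof -
  assume s: "\<sigma> \<in> Stk" and u: "u \<in> V"
  obtain c \<tau> where c: "c \<in> K u" "\<tau> \<in> Stk" "\<not> headed u \<tau>" "\<sigma> = pushe u c \<tau>"
    using Stk_decomp[OF s u] .
  then show ?thesis using lact_pushe[OF c(3) u K_one[OF u] c(1)] K_closed[OF u c(1)] by simp
qed

text \<open>As \<open>u\<close> and \<open>v\<close> are adjacent, their coordinates can be split
  off simultaneously and do not interact.\<close>

lemma lact_commute:
  assumes \<sigma>: "\<sigma> \<in> Stk" and uv: "adj u v" and ab: "a \<in> K u" "b \<in> K v"
  shows "lact u a (lact v b \<sigma>) = lact v b (lact u a \<sigma>)"
proof -
  note V = adjD(1)[OF uv] adjD(2)[OF uv]
  have vu: "adj v u" using uv adj_sym by blast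
  obtain c \<tau> where c: "c \<in> K u" "\<tau> \<in> Stk" "\<not> headed u \<tau>" "\<sigma> = pushe u c \<tau>"
    using Stk_decomp[OF \<sigma> V(1)] .
  obtain e \<rho> where e: "e \<in> K v" "\<rho> \<in> Stk" "\<not> headed v \<rho>" "\<tau> = pushe v e \<rho>"
    using Stk_decomp[OF c(2) V(2)] .
  have r: "\<not> headed u \<rho>" using c(3) e(4) headed_pushe_adj[OF vu] by simp
  have 1: "\<not> headed u (pushe v x \<rho>)" for x using headed_pushe_adj[OF vu] r by simp
  have 2: "\<not> headed v (pushe u x \<rho>)" for x using headed_pushe_adj[OF uv] e(3) by simp
  have L: "lact u a (pushe u c (pushe v x \<rho>)) = pushe u (a \<otimes> c) (pushe v x \<rho>)" for x
    by (rule lact_pushe[OF 1 V(1) ab(1) c(1)])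
  have R: "lact v b (pushe v e (pushe u x \<rho>)) = pushe v (b \<otimes> e) (pushe u x \<rho>)" for x
    by (rule lact_pushe[OF 2 V(2) ab(2) e(1)])
  have sw: "pushe v y (pushe u x \<rho>) = pushe u x (pushe v y \<rho>)" for x y
    by (rule pushe_commute[OF vu])
  have "lact v b \<sigma> = pushe u c (pushe v (b \<otimes> e) \<rho>)"
    unfolding c(4) e(4) sw[symmetric] R ..
  moreover have "lact u a \<sigma> = pushe v e (pushe u (a \<otimes> c) \<rho>)"
    unfolding c(4) e(4) L sw ..
  ultimately show ?thesis using L R sw by simp
qed

text \<open>By the universal property the maps \<open>lact\<close> combine to an action of
  \<open>P\<close> on stacks, and an element sends the empty stack to each of its normal
  forms.\<close>

lemma nf_unique_stack:
  assumes "nf \<sigma> g" "nf \<sigma>' g"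
  shows "\<sigma> = \<sigma>'"
proof -
  define f where "f u a = (\<lambda>\<sigma>\<in>Stk. lact u a \<sigma>)" for u a
  have f_Bij: "f u a \<in> Bij Stk" if u: "u \<in> V" "a \<in> K u" for u a
  proof -
    have "bij_betw (lact u a) Stk Stk"
      by (rule bij_betw_byWitness[where f' = "lact u (inv a)"])
        (use u K_inv[OF u] K_closed[OF u] lact_closed in
          \<open>auto simp: lact_mult[symmetric] lact_one\<close>)
    then show ?thesis unfolding Bij_def f_def by simp
  qed
  have f_mult: "f u a \<otimes>\<^bsub>BijGroup Stk\<^esub> f v b = (\<lambda>\<sigma>\<in>Stk. lact u a (lact v b \<sigma>))"
    if "u \<in> V" "a \<in> K u" "v \<in> V" "b \<in> K v" for u a v b
    using f_Bij that lact_closed by (auto simp: BijGroup_def f_def compose_def restrict_def)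
  obtain \<rho> where \<rho>: "\<rho> \<in> hom P (BijGroup Stk)" "\<And>u a. u \<in> V \<Longrightarrow> a \<in> K u \<Longrightarrow> \<rho> a = f u a"
  proof (rule universal[OF group_BijGroup, of f Stk])
    show "f u \<in> hom (P\<lparr>carrier := K u\<rparr>) (BijGroup Stk)" if u: "u \<in> V" for u
    proof (rule homI)
      fix a b assume ab: "a \<in> carrier (P\<lparr>carrier := K u\<rparr>)" "b \<in> carrier (P\<lparr>carrier := K u\<rparr>)"
      then show "f u a \<in> carrier (BijGroup Stk)" using f_Bij u by (simp add: BijGroup_def)
      show "f u (a \<otimes>\<^bsub>P\<lparr>carrier := K u\<rparr>\<^esub> b) = f u a \<otimes>\<^bsub>BijGroup Stk\<^esub> f u b"
        using ab u by (simp add: f_mult) (auto simp: f_def restrict_def lact_mult)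
    qed
    show "f u a \<otimes>\<^bsub>BijGroup Stk\<^esub> f v b = f v b \<otimes>\<^bsub>BijGroup Stk\<^esub> f u a"
      if "adj u v" "a \<in> K u" "b \<in> K v" for u v a b
      using that adjD[OF that(1)] by (simp add: f_mult) (rule restrict_ext, rule lact_commute)
  qed blast
  have Nil_Stk: "(\<lambda>_. []) \<in> Stk" using nf.Nil by (auto simp: Stk_def)
  have "\<rho> g (\<lambda>_. []) = \<sigma>" if "nf \<sigma> g" for \<sigma> g
    using that
  proof (induction rule: nf.induct)
    case Nil
    then show ?case
      using hom_one[OF \<rho>(1) is_group group_BijGroup] Nil_Stk by (simp add: BijGroup_def)
  next
    case (Push \<sigma> g u a)
    have g: "g \<in> carrier P" by (rule nf_closed[OF Push.hyps(1)])
    have "\<rho> (a \<otimes> g) = f u a \<otimes>\<^bsub>BijGroup Stk\<^esub> \<rho> g"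
      using hom_mult[OF \<rho>(1) K_closed[OF Push.hyps(2,3)] g] \<rho>(2)[OF Push.hyps(2,3)] by simp
    also have "\<dots> = compose Stk (f u a) (\<rho> g)"
      using hom_in_carrier[OF \<rho>(1) g] f_Bij[OF Push.hyps(2,3)] by (simp add: BijGroup_def)
    finally have "\<rho> (a \<otimes> g) (\<lambda>_. []) = f u a \<sigma>" using Nil_Stk Push.IH by (simp add: compose_def)
    also have "\<dots> = push u a \<sigma>"
      using Push.hyps by (auto simp: f_def Stk_def lact_def pushe_def)
    finally show ?case .
  qed
  then show ?thesis using assms by blast
qed

lemma nf_ex: "g \<in> carrier P \<Longrightarrow> \<exists>\<sigma>. nf \<sigma> g"
proof (rule gen_induct[of g "\<lambda>g. \<exists>\<sigma>. nf \<sigma> g"], assumption)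
  show "\<exists>\<sigma>. nf \<sigma> \<one>" using nf.Nil by blast
  fix u a y assume u: "u \<in> V" "a \<in> K u" and y: "y \<in> carrier P" "\<exists>\<sigma>. nf \<sigma> y"
  then obtain \<sigma> where \<sigma>: "nf \<sigma> y" by blast
  show "\<exists>\<sigma>. nf \<sigma> (a \<otimes> y)"
  proof (cases "headed u \<sigma>")
    case True
    then obtain b r where "\<sigma> u = Some b # r" by (auto simp: headed_def)
    from nf_peel[OF \<sigma> this] obtain \<tau> h where b: "b \<in> K u" and \<tau>: "nf \<tau> h" "\<not> headed u \<tau>" "y = b \<otimes> h"
      by blast
    have h: "h \<in> carrier P" by (rule nf_closed[OF \<tau>(1)])
    have ay: "a \<otimes> y = (a \<otimes> b) \<otimes> h" using u b h \<tau>(3) by (simp add: m_assoc K_closed)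
    show ?thesis
    proof (cases "a \<otimes> b = \<one>")
      case True
      then show ?thesis using ay \<tau>(1) h by auto
    next
      case False
      then show ?thesis using ay nf.Push[OF \<tau>(1) u(1) K_mult[OF u b] _ \<tau>(2)] by auto
    qed
  next
    case False
    then show ?thesis using nf.Push[OF \<sigma> u] \<sigma> y(1) by (cases "a = \<one>") auto
  qed
qed

definition stk :: "'g \<Rightarrow> 'v \<Rightarrow> 'g option list" where "stk g = (THE \<sigma>. nf \<sigma> g)"

lemma stk_eqI: "nf \<sigma> g \<Longrightarrow> stk g = \<sigma>"
  unfolding stk_def using nf_unique_stack by blast

lemma stk_nf: "g \<in> carrier P \<Longrightarrow> nf (stk g) g"
  using nf_ex stk_eqI by metis

lemma stk_one: "stk \<one> = (\<lambda>_. [])"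
  by (rule stk_eqI[OF nf.Nil])

text \<open>\<open>head u g\<close> means that some reduced word for \<open>g\<close> begins with a
  syllable of \<open>K u\<close>, and \<open>tail u g\<close> that some reduced word ends with one:
  the bottom of a stack holds the rightmost syllables.\<close>

definition head :: "'v \<Rightarrow> 'g \<Rightarrow> bool" where "head u g \<longleftrightarrow> headed u (stk g)"

definition tail :: "'v \<Rightarrow> 'g \<Rightarrow> bool" where "tail u g \<longleftrightarrow> stk g u \<noteq> [] \<and> last (stk g u) \<noteq> None"

lemma head_iff: "head u g \<longleftrightarrow> stk g u \<noteq> [] \<and> hd (stk g u) \<noteq> None"
  unfolding head_def headed_def by (cases "stk g u") auto

lemma stk_push:
  "u \<in> V \<Longrightarrow> a \<in> K u \<Longrightarrow> a \<noteq> \<one> \<Longrightarrow> g \<in> carrier P \<Longrightarrow> \<not> head u g \<Longrightarrow> stk (a \<otimes> g) = push u a (stk g)"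
  by (rule stk_eqI) (simp add: nf.Push stk_nf head_def)

lemma stk_syllable: "u \<in> V \<Longrightarrow> a \<in> K u \<Longrightarrow> a \<noteq> \<one> \<Longrightarrow> stk a = push u a (\<lambda>_. [])"
  using stk_push[of u a \<one>] K_closed by (simp add: head_iff stk_one)

lemma head_peel:
  assumes "g \<in> carrier P" "head u g"
  obtains b h where "u \<in> V" "b \<in> K u" "b \<noteq> \<one>" "h \<in> carrier P" "\<not> head u h" "g = b \<otimes> h"
    "stk g = push u b (stk h)"
proof -
  obtain b r where "stk g u = Some b # r" using assms(2) by (auto simp: head_def headed_def)
  from nf_peel[OF stk_nf[OF assms(1)] this] obtain \<tau> h where
    u: "u \<in> V" "b \<in> K u" "b \<noteq> \<one>" and \<tau>: "nf \<tau> h" "\<not> headed u \<tau>" "stk g = push u b \<tau>" "g = b \<otimes> h"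
    by blast
  show thesis using that[OF u nf_closed[OF \<tau>(1)]] \<tau> stk_eqI[OF \<tau>(1)] by (simp add: head_def)
qed

lemma nf_elt_induct [consumes 1, case_names one push]:
  assumes "g \<in> carrier P" and "Q \<one>"
    and "\<And>u a g. u \<in> V \<Longrightarrow> a \<in> K u \<Longrightarrow> a \<noteq> \<one> \<Longrightarrow> g \<in> carrier P \<Longrightarrow> \<not> head u g \<Longrightarrow> Q g \<Longrightarrow> Q (a \<otimes> g)"
  shows "Q g"
proof -
  have "Q g" if "nf \<sigma> g" for \<sigma> g
    using that
    by (induction rule: nf.induct) (use assms(2,3) nf_closed stk_eqI in \<open>auto simp: head_def\<close>)
  then show ?thesis using stk_nf[OF assms(1)] by blast
qed

text \<open>Nothing merges across the product, so a reduced word of \<open>x\<close> followed by one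
  of \<open>y\<close> is again reduced.\<close>

lemma stk_concat:
  assumes "x \<in> carrier P" and y: "y \<in> carrier P" and "\<And>u. tail u x \<Longrightarrow> \<not> head u y"
  shows "stk (x \<otimes> y) = (\<lambda>t. stk x t @ stk y t)"
  using assms(1,3)
proof (induction x rule: nf_elt_induct)
  case one
  then show ?case using y by (simp add: stk_one)
next
  case (push u a x)
  have sx: "stk (a \<otimes> x) = push u a (stk x)" using push.hyps by (simp add: stk_push)
  have "\<not> head v y" if "tail v x" for v
  proof (rule push.prems)
    show "tail v (a \<otimes> x)" using that by (auto simp: tail_def sx push_def)
  qed
  then have IH: "stk (x \<otimes> y) = (\<lambda>t. stk x t @ stk y t)" using push.IH by blast
  \<comment> \<open>If \<open>x\<close> has nothing on the stack of \<open>u\<close>, then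
    \<open>a\<close> itself is a tail of \<open>a \<otimes> x\<close> at \<open>u\<close>, and the
    hypothesis excludes a head of \<open>y\<close> there.\<close>
  have "\<not> head u (x \<otimes> y)"
  proof (cases "stk x u = []")
    case True
    then have "tail u (a \<otimes> x)" by (simp add: tail_def sx push_at)
    then have "\<not> head u y" by (rule push.prems)
    then show ?thesis using True by (simp add: head_iff IH)
  next
    case False
    then show ?thesis using push.hyps(5) by (simp add: head_iff IH)
  qed
  then have "stk (a \<otimes> (x \<otimes> y)) = push u a (stk (x \<otimes> y))"
    using push.hyps y by (simp add: stk_push)
  then show ?case using push.hyps y K_closed by (auto simp: m_assoc IH sx push_def)
qed

lemma stk_inv: "x \<in> carrier P \<Longrightarrow> stk (inv x) = (\<lambda>t. rev (map (map_option (\<lambda>a. inv a)) (stk x t)))"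
proof (induction x rule: nf_elt_induct)
  case one
  then show ?case by (simp add: stk_one)
next
  case (push u a x)
  have a: "inv a \<in> K u" "inv a \<noteq> \<one>" "a \<in> carrier P"
    using push.hyps K_inv K_closed inv_eq_1_iff by auto
  have sa: "stk (inv a) = push u (inv a) (\<lambda>_. [])" using stk_syllable[OF push.hyps(1) a(1,2)] .
  have "stk (inv x \<otimes> inv a) = (\<lambda>t. stk (inv x) t @ stk (inv a) t)"
  proof (rule stk_concat)
    fix v assume v: "tail v (inv x)"
    show "\<not> head v (inv a)"
    proof
      assume "head v (inv a)"
      then have "v = u" by (auto simp: head_iff sa push_def split: if_splits)
      then have "stk x u \<noteq> [] \<and> hd (stk x u) \<noteq> None"
        using v by (auto simp: tail_def push.IH last_rev hd_map)
      then show False using push.hyps(5) by (simp add: head_iff)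
    qed
  qed (use push.hyps a in auto)
  then show ?case
    using push.hyps a stk_push[OF push.hyps(1-5)]
    by (auto simp: inv_mult_group push.IH sa push_def)
qed

lemma tail_inv: "x \<in> carrier P \<Longrightarrow> tail u (inv x) \<longleftrightarrow> head u x"
  by (auto simp: tail_def head_iff stk_inv last_rev hd_map)

lemma head_inv: "x \<in> carrier P \<Longrightarrow> head u (inv x) \<longleftrightarrow> tail u x"
  using tail_inv[of "inv x" u] by simp

lemma head_syllable: "u \<in> V \<Longrightarrow> a \<in> K u \<Longrightarrow> a \<noteq> \<one> \<Longrightarrow> head v a \<longleftrightarrow> v = u"
  by (auto simp: head_iff stk_syllable push_def)

lemma tail_peel:
  assumes "g \<in> carrier P" "tail u g"
  obtains b h where "u \<in> V" "b \<in> K u" "b \<noteq> \<one>" "h \<in> carrier P" "\<not> tail u h" "g = h \<otimes> b"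
    "stk g = (\<lambda>t. stk h t @ stk b t)"
proof -
  have "head u (inv g)" using head_inv assms by simp
  then obtain b h where b: "u \<in> V" "b \<in> K u" "b \<noteq> \<one>" "h \<in> carrier P" "\<not> head u h" "inv g = b \<otimes> h"
    using head_peel[of "inv g"] assms(1) inv_closed by metis
  have bc: "b \<in> carrier P" using b K_closed by blast
  have b': "inv b \<in> K u" "inv b \<noteq> \<one>" using b bc K_inv inv_eq_1_iff by auto
  have g: "g = inv h \<otimes> inv b" using b(4,6) bc assms(1) by (metis inv_inv inv_mult_group)
  have nt: "\<not> tail u (inv h)" using tail_inv b by simp
  have "stk (inv h \<otimes> inv b) = (\<lambda>t. stk (inv h) t @ stk (inv b) t)"
    by (rule stk_concat) (use b b' bc nt head_syllable in auto)
  then show thesis using that[OF b(1) b' _ nt g] b(4) g by simp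
qed

subsection \<open>Syllable counts and parabolic subgroups\<close>

definition cnt :: "'v \<Rightarrow> 'g \<Rightarrow> nat" where "cnt t g = length (filter (\<lambda>z. z \<noteq> None) (stk g t))"

definition len :: "'g \<Rightarrow> nat" where "len g = (\<Sum>t\<in>V. cnt t g)"

lemma cnt_one [simp]: "cnt t \<one> = 0"
  by (simp add: cnt_def stk_one)

lemma cnt_push:
  assumes "u \<in> V" "a \<in> K u" "a \<noteq> \<one>" "g \<in> carrier P" "\<not> head u g"
  shows "cnt t (a \<otimes> g) = (if t = u then Suc (cnt t g) else cnt t g)"
  using stk_push[OF assms] by (auto simp: cnt_def push_def)

lemma cnt_concat: "stk (x \<otimes> y) = (\<lambda>t. stk x t @ stk y t) \<Longrightarrow> cnt t (x \<otimes> y) = cnt t x + cnt t y"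
  by (simp add: cnt_def)

lemma cnt_inv: "x \<in> carrier P \<Longrightarrow> cnt t (inv x) = cnt t x"
  by (simp add: cnt_def stk_inv rev_filter[symmetric] filter_map comp_def)

lemma len_push:
  assumes "u \<in> V" "a \<in> K u" "a \<noteq> \<one>" "g \<in> carrier P" "\<not> head u g"
  shows "len (a \<otimes> g) = Suc (len g)"
  unfolding len_def cnt_push[OF assms]
  using assms(1) fin_verts by (simp add: sum.remove[of V u])

lemma len_concat: "stk (x \<otimes> y) = (\<lambda>t. stk x t @ stk y t) \<Longrightarrow> len (x \<otimes> y) = len x + len y"
  by (simp add: len_def cnt_concat sum.distrib)

lemma len_syllable: "u \<in> V \<Longrightarrow> a \<in> K u \<Longrightarrow> a \<noteq> \<one> \<Longrightarrow> len a = 1"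
  using len_push[of u a \<one>] K_closed by (simp add: head_iff stk_one len_def)

lemma cnt_mult:
  assumes "u \<in> V" "a \<in> K u" "g \<in> carrier P" "t \<noteq> u"
  shows "cnt t (a \<otimes> g) = cnt t g"
proof -
  have *: "cnt t (b \<otimes> h) = cnt t h" if "b \<in> K u" "h \<in> carrier P" "\<not> head u h" for b h
    using that assms(1,4) cnt_push[of u b h t] by (cases "b = \<one>") auto
  show ?thesis
  proof (cases "head u g")
    case True
    then obtain b h where b: "b \<in> K u" "h \<in> carrier P" "\<not> head u h" "g = b \<otimes> h"
      using head_peel[OF assms(3)] by metis
    then have "a \<otimes> g = (a \<otimes> b) \<otimes> h" using assms K_closed by (simp add: m_assoc)
    then show ?thesis using * b K_mult assms by simp
  next
    case False
    then show ?thesis using * assms by simp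
  qed
qed

text \<open>The subgroup generated by the \<open>K u\<close> with \<open>u \<in> \<Theta>\<close>,
  encoded by the vertices occurring in normal forms: intersections become immediate
  (\<open>par_Int\<close>), and generation is recovered by \<open>par_induct\<close>.
  \<open>\<Theta>\<close> may leave \<open>V\<close>, which permits complements such as
  \<open>- {v}\<close>.\<close>

definition par :: "'v set \<Rightarrow> 'g set" where
  "par \<Theta> = {g \<in> carrier P. \<forall>t\<in>V - \<Theta>. cnt t g = 0}"

lemma par_closed: "x \<in> par \<Theta> \<Longrightarrow> x \<in> carrier P"
  by (simp add: par_def)

lemma par_one: "\<one> \<in> par \<Theta>"
  by (simp add: par_def)

lemma par_mono: "\<Theta> \<subseteq> \<Theta>' \<Longrightarrow> par \<Theta> \<subseteq> par \<Theta>'"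
  by (auto simp: par_def)

lemma par_Int: "par \<Theta> \<inter> par \<Theta>' = par (\<Theta> \<inter> \<Theta>')"
  unfolding par_def by blast

lemma par_verts: "par V = carrier P"
  by (auto simp: par_def)

lemma par_Int_verts: "par (\<Theta> \<inter> V) = par \<Theta>"
  unfolding par_def by blast

lemma par_induct [consumes 1, case_names one push]:
  assumes "g \<in> par \<Theta>" and "Q \<one>"
    and "\<And>u a g. u \<in> \<Theta> \<Longrightarrow> u \<in> V \<Longrightarrow> a \<in> K u \<Longrightarrow> a \<noteq> \<one> \<Longrightarrow> g \<in> par \<Theta> \<Longrightarrow> \<not> head u g \<Longrightarrow> Q g \<Longrightarrow> Q (a \<otimes> g)"
  shows "Q g"
proof -
  have "g \<in> carrier P" using assms(1) by (rule par_closed)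
  then show ?thesis
    using assms(1)
  proof (induction g rule: nf_elt_induct)
    case (push u a g)
    have z: "(if t = u then Suc (cnt t g) else cnt t g) = 0" if "t \<in> V - \<Theta>" for t
      using push.prems that cnt_push[OF push.hyps, of t] by (simp add: par_def)
    then have "u \<in> \<Theta>" using push.hyps(1) by force
    moreover have "cnt t g = 0" if "t \<in> V - \<Theta>" for t using z[OF that] by (cases "t = u") auto
    then have "g \<in> par \<Theta>" using push.hyps(4) by (simp add: par_def)
    ultimately show ?case using assms(3) push by blast
  qed (rule assms(2))
qed

lemma cnt_par_mult: "x \<in> par \<Theta> \<Longrightarrow> y \<in> carrier P \<Longrightarrow> t \<notin> \<Theta> \<Longrightarrow> cnt t (x \<otimes> y) = cnt t y"
proof (induction x rule: par_induct)
  case (push u a x)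
  have "cnt t (a \<otimes> (x \<otimes> y)) = cnt t (x \<otimes> y)"
    using push par_closed by (intro cnt_mult) auto
  then show ?case using push par_closed K_closed by (auto simp: m_assoc)
qed simp

lemma par_subgroup: "subgroup (par \<Theta>) P"
proof (rule subgroupI)
  show "par \<Theta> \<noteq> {}" using par_one by blast
  show "inv a \<in> par \<Theta>" if "a \<in> par \<Theta>" for a using that cnt_inv by (auto simp: par_def)
  show "a \<otimes> b \<in> par \<Theta>" if "a \<in> par \<Theta>" "b \<in> par \<Theta>" for a b
    using that cnt_par_mult[OF that(1)] by (auto simp: par_def)
qed (auto simp: par_def)

lemma par_mult: "x \<in> par \<Theta> \<Longrightarrow> y \<in> par \<Theta> \<Longrightarrow> x \<otimes> y \<in> par \<Theta>"
  using subgroup.m_closed[OF par_subgroup] .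

lemma par_inv: "x \<in> par \<Theta> \<Longrightarrow> inv x \<in> par \<Theta>"
  using subgroup.m_inv_closed[OF par_subgroup] .

lemma K_par: "u \<in> V \<Longrightarrow> u \<in> \<Theta> \<Longrightarrow> a \<in> K u \<Longrightarrow> a \<in> par \<Theta>"
proof -
  assume a: "u \<in> V" "u \<in> \<Theta>" "a \<in> K u"
  have ac: "a \<in> carrier P" by (rule K_closed[OF a(1,3)])
  have "cnt t a = 0" if "t \<in> V - \<Theta>" for t
    using cnt_mult[OF a(1,3) one_closed, of t] that a(2) ac by auto
  then show "a \<in> par \<Theta>" using ac by (simp add: par_def)
qed

lemma par_singleton: "u \<in> V \<Longrightarrow> par {u} = K u"
proof
  show "par {u} \<subseteq> K u" if u: "u \<in> V"
  proof
    fix x assume "x \<in> par {u}"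
    then show "x \<in> K u" by (induction x rule: par_induct) (use u K_one K_mult in auto)
  qed
  show "K u \<subseteq> par {u}" if "u \<in> V" using K_par that by blast
qed

lemma par_commute:
  assumes "x \<in> par \<Theta>" "y \<in> par \<Theta>'" "\<And>u v. u \<in> \<Theta> \<Longrightarrow> v \<in> \<Theta>' \<Longrightarrow> u \<in> V \<Longrightarrow> v \<in> V \<Longrightarrow> adj u v"
  shows "x \<otimes> y = y \<otimes> x"
proof -
  have 1: "a \<otimes> y = y \<otimes> a" if "u \<in> \<Theta>" "u \<in> V" "a \<in> K u" for u a
    using assms(2)
  proof (induction y rule: par_induct)
    case one
    then show ?case using K_closed[OF that(2,3)] by simp
  next
    case (push v b y)
    have cl: "a \<in> carrier P" "b \<in> carrier P" "y \<in> carrier P"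
      using K_closed that push par_closed by auto
    have ab: "a \<otimes> b = b \<otimes> a" using K_commute[OF assms(3)[OF that(1) push.hyps(1) that(2) push.hyps(2)] that(3) push.hyps(3)] .
    have "a \<otimes> (b \<otimes> y) = (b \<otimes> a) \<otimes> y" using cl ab by (simp add: m_assoc[symmetric])
    also have "\<dots> = b \<otimes> (y \<otimes> a)" using cl push.IH by (simp add: m_assoc)
    finally show ?case using cl by (simp add: m_assoc)
  qed
  show ?thesis
    using assms(1)
  proof (induction x rule: par_induct)
    case one
    then show ?case using par_closed[OF assms(2)] by simp
  next
    case (push u a x)
    have cl: "a \<in> carrier P" "x \<in> carrier P" "y \<in> carrier P"
      using K_closed push par_closed assms(2) by auto
    have "(a \<otimes> x) \<otimes> y = a \<otimes> (y \<otimes> x)" using cl push.IH by (simp add: m_assoc)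
    also have "\<dots> = (y \<otimes> a) \<otimes> x" using cl 1[OF push.hyps(1-3)] by (simp add: m_assoc[symmetric])
    finally show ?case using cl by (simp add: m_assoc)
  qed
qed

definition lk :: "'v \<Rightarrow> 'v set" where "lk u = {t. adj u t}"

definition st :: "'v \<Rightarrow> 'v set" where "st u = insert u (lk u)"

definition perp :: "'v set \<Rightarrow> 'v set" where "perp \<Theta> = {t \<in> V. \<forall>u\<in>\<Theta>. adj u t}"

text \<open>A syllable leaves the stack of \<open>t\<close> untouched only if its vertex is adjacent
  to \<open>t\<close>.\<close>

lemma par_lk_stk: "s \<in> carrier P \<Longrightarrow> stk s t = [] \<Longrightarrow> s \<in> par (lk t)"
proof (induction s rule: nf_elt_induct)
  case one
  then show ?case by (simp add: par_one)
next
  case (push u a g)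
  have "push u a (stk g) t = []" using push.prems stk_push[OF push.hyps] by simp
  then have ut: "adj u t" "stk g t = []" by (auto simp: push_def split: if_splits)
  then have "a \<in> par (lk t)" using K_par push.hyps adj_sym by (simp add: lk_def)
  then show ?case using par_mult push.IH ut by blast
qed

lemma cnt_par: "s \<in> par \<Theta> \<Longrightarrow> t \<in> V \<Longrightarrow> t \<notin> \<Theta> \<Longrightarrow> cnt t s = 0"
  by (simp add: par_def)

lemma not_head_par: "s \<in> par \<Theta> \<Longrightarrow> t \<in> V \<Longrightarrow> t \<notin> \<Theta> \<Longrightarrow> \<not> head t s"
  using cnt_par[of s \<Theta> t] by (cases "stk s t") (auto simp: cnt_def head_iff split: if_splits)

lemma head_verts: "g \<in> carrier P \<Longrightarrow> head u g \<Longrightarrow> u \<in> V"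
  using head_peel by metis

lemma head_par: "s \<in> par \<Theta> \<Longrightarrow> head t s \<Longrightarrow> t \<in> \<Theta>"
  using not_head_par head_verts par_closed by blast

lemma tail_par: "s \<in> par \<Theta> \<Longrightarrow> tail t s \<Longrightarrow> t \<in> \<Theta>"
  using head_par[OF par_inv] head_inv par_closed by blast

lemma head_ex: "g \<in> carrier P \<Longrightarrow> g \<noteq> \<one> \<Longrightarrow> \<exists>u. head u g"
proof (induction g rule: nf_elt_induct)
  case (push u a g)
  then show ?case using stk_push[OF push.hyps] by (auto simp: head_iff push_at intro!: exI[of _ u])
qed simp


section \<open>Intersections, normalizers and centralizers of parabolic subgroups\<close>

lemma par_subset: "par \<Theta> \<subseteq> carrier P"
  using par_closed by blast

lemma cj_par: "h \<in> par \<Theta> \<Longrightarrow> cj h ` par \<Theta> = par \<Theta>"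
  by (rule cj_image_subgroup[OF par_subgroup])

text \<open>
  With no cancellation on either side of \<open>x\<close>, both sides of \<open>s x = x s'\<close> are reduced; comparing the
  stacks at a head \<open>t\<close> of \<open>x\<close> shows that \<open>s\<close> has no syllable blocking \<open>t\<close>.
\<close>

lemma reduced_commute_head:
  assumes s: "s \<in> par \<Theta>" and s': "s' \<in> par \<Theta>'" and x: "x \<in> carrier P" and eq: "s \<otimes> x = x \<otimes> s'"
    and nh: "\<And>u. u \<in> \<Theta> \<Longrightarrow> \<not> head u x" and nt: "\<And>u. u \<in> \<Theta>' \<Longrightarrow> \<not> tail u x" and t: "head t x"
  shows "s \<in> par (lk t)"
proof -
  have sc: "s \<in> carrier P" "s' \<in> carrier P" using s s' par_closed by auto
  have "stk (s \<otimes> x) = (\<lambda>t. stk s t @ stk x t)"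
    by (rule stk_concat[OF sc(1) x]) (use tail_par[OF s] nh in blast)
  moreover have "stk (x \<otimes> s') = (\<lambda>t. stk x t @ stk s' t)"
    by (rule stk_concat[OF x sc(2)]) (use head_par[OF s'] nt in blast)
  ultimately have e: "stk s t @ stk x t = stk x t @ stk s' t" using eq by metis
  \<comment> \<open>Were \<open>stk s t\<close> non-empty, it would start with the same syllable as
    \<open>stk x t\<close>, and \<open>t\<close> would be a head of \<open>s\<close>, hence in
    \<open>\<Theta>\<close>, where \<open>x\<close> has no heads.\<close>
  have "\<not> head t s" using not_head_par[OF s head_verts[OF x t]] nh t by blast
  then have "stk s t = []"
    using e t by (cases "stk s t"; cases "stk x t") (auto simp: head_iff)
  then show ?thesis by (rule par_lk_stk[OF sc(1)])
qed

text \<open>Case scheme for inductions on \<open>len x\<close> with \<open>par \<Theta>\<close> on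
  the left and \<open>par \<Theta>'\<close> on the right of \<open>x\<close>: a syllable is absorbed
  on one side, or \<open>x\<close> is trivial, or \<open>x\<close> is reduced on both sides and
  \<open>reduced_commute_head\<close> applies.\<close>

lemma peel_cases:
  assumes x: "x \<in> carrier P"
  obtains (head) t b y where "t \<in> \<Theta>" "t \<in> V" "b \<in> K t" "y \<in> carrier P" "x = b \<otimes> y" "len y < len x"
  | (tail) t b y where "t \<in> \<Theta>'" "t \<in> V" "b \<in> K t" "y \<in> carrier P" "x = y \<otimes> b" "len y < len x"
  | (one) "x = \<one>"
  | (inner) t b y where "\<And>u. u \<in> \<Theta> \<Longrightarrow> \<not> head u x" "\<And>u. u \<in> \<Theta>' \<Longrightarrow> \<not> tail u x" "head t x"
      "t \<in> V" "b \<in> K t" "y \<in> carrier P" "x = b \<otimes> y" "len y < len x"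
proof -
  have hd: "\<exists>b y. t \<in> V \<and> b \<in> K t \<and> y \<in> carrier P \<and> x = b \<otimes> y \<and> len y < len x" if t: "head t x" for t
  proof -
    obtain b y where b: "t \<in> V" "b \<in> K t" "b \<noteq> \<one>" "y \<in> carrier P" "\<not> head t y" "x = b \<otimes> y"
      "stk x = push t b (stk y)"
      using head_peel[OF x t] .
    then show ?thesis using len_push[OF b(1-5)] by (intro exI[of _ b] exI[of _ y]) simp
  qed
  have tl: "\<exists>b y. t \<in> V \<and> b \<in> K t \<and> y \<in> carrier P \<and> x = y \<otimes> b \<and> len y < len x" if t: "tail t x" for t
  proof -
    obtain b y where b: "t \<in> V" "b \<in> K t" "b \<noteq> \<one>" "y \<in> carrier P" "\<not> tail t y" "x = y \<otimes> b"
      "stk x = (\<lambda>t. stk y t @ stk b t)"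
      using tail_peel[OF x t] .
    have "len x = len y + len b" unfolding b(6) by (rule len_concat) (use b(6,7) in simp)
    then show ?thesis using b(1-4,6) len_syllable[OF b(1-3)] by (intro exI[of _ b] exI[of _ y]) simp
  qed
  show thesis
  proof (cases "\<exists>t\<in>\<Theta>. head t x")
    case True
    then show thesis using hd head by metis
  next
    case nh: False
    show thesis
    proof (cases "\<exists>t\<in>\<Theta>'. tail t x")
      case True
      then show thesis using tl tail by metis
    next
      case nt: False
      show thesis
      proof (cases "x = \<one>")
        case True
        then show thesis by (rule one)
      next
        case False
        then obtain t where t: "head t x" using head_ex[OF x] by blast
        then obtain b y where b: "t \<in> V" "b \<in> K t" "y \<in> carrier P" "x = b \<otimes> y" "len y < len x"
          using hd by metis
        show thesis by (rule inner[OF _ _ t b]) (use nh nt in auto)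
      qed
    qed
  qed
qed

lemma par_Int_conj:
  assumes "x \<in> carrier P"
  shows "\<exists>h\<in>par \<Theta>. \<exists>\<Xi>\<subseteq>\<Theta> \<inter> \<Theta>'. par \<Theta> \<inter> cj x ` par \<Theta>' = cj h ` par \<Xi>"
  using assms
proof (induction "len x" arbitrary: x \<Theta> rule: less_induct)
  case less
  note x = less.prems
  show ?case
  proof (cases rule: peel_cases[OF x, where \<Theta> = \<Theta> and \<Theta>' = \<Theta>', case_names head tail one inner])
    case (head t b y)
    have b: "b \<in> par \<Theta>" "b \<in> carrier P" using K_par K_closed head by auto
    obtain h \<Xi> where h: "h \<in> par \<Theta>" "\<Xi> \<subseteq> \<Theta> \<inter> \<Theta>'" "par \<Theta> \<inter> cj y ` par \<Theta>' = cj h ` par \<Xi>"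
      using less.hyps[of y \<Theta>] head by blast
    have "par \<Theta> \<inter> cj x ` par \<Theta>' = cj b ` par \<Theta> \<inter> cj b ` cj y ` par \<Theta>'"
      unfolding head(5) cj_par[OF b(1)] cj_image_cj[OF b(2) head(4) par_subset] ..
    also have "\<dots> = cj b ` cj h ` par \<Xi>"
      using cj_image_Int[OF b(2) par_subset cj_image_closed[OF head(4) par_subset]] h(3) by metis
    also have "\<dots> = cj (b \<otimes> h) ` par \<Xi>" by (rule cj_image_cj[OF b(2) par_closed[OF h(1)] par_subset])
    finally show ?thesis using par_mult[OF b(1) h(1)] h(2) by blast
  next
    case (tail t b y)
    have b: "b \<in> par \<Theta>'" "b \<in> carrier P" using K_par K_closed tail by auto
    have "cj x ` par \<Theta>' = cj y ` par \<Theta>'"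
      unfolding tail(5) cj_image_cj[OF tail(4) b(2) par_subset, symmetric] cj_par[OF b(1)] ..
    then show ?thesis using less.hyps[of y \<Theta>] tail by simp
  next
    case one
    have "cj \<one> ` S = S" if "S \<subseteq> carrier P" for S using that by (force simp: image_def)
    then show ?thesis using one par_one par_Int par_subset by (intro bexI[of _ \<one>] exI[of _ "\<Theta> \<inter> \<Theta>'"]) auto
  next
    case (inner t b y)
    have b: "b \<in> carrier P" using K_closed inner by auto
    have bc: "b \<otimes> s = s \<otimes> b" if "s \<in> par (\<Theta> \<inter> lk t)" for s
      by (rule par_commute[of b "{t}" s]) (use that par_singleton inner in \<open>auto simp: lk_def\<close>)
    have "par \<Theta> \<inter> cj x ` par \<Theta>' = par (\<Theta> \<inter> lk t) \<inter> cj y ` par \<Theta>'"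
    proof (intro equalityI subsetI)
      fix s assume "s \<in> par \<Theta> \<inter> cj x ` par \<Theta>'"
      then obtain s' where s: "s \<in> par \<Theta>" "s' \<in> par \<Theta>'" "s = cj x s'" by blast
      have "s \<otimes> x = x \<otimes> s'" using s cj_eqD[OF x par_closed[OF s(2)]] by simp
      from reduced_commute_head[OF s(1,2) x this inner(1-3)]
      have s1: "s \<in> par (\<Theta> \<inter> lk t)" using s(1) par_Int by blast
      have "s = cj b (cj y s')" using s(3) inner b cj_cj par_closed[OF s(2)] by simp
      moreover have "s = cj b s" using cj_id[OF b par_closed[OF s(1)] bc[OF s1]] by simp
      ultimately have "s = cj y s'" using cj_eq_iff[OF b, of s "cj y s'"] par_closed s inner by simp
      then show "s \<in> par (\<Theta> \<inter> lk t) \<inter> cj y ` par \<Theta>'" using s1 s(2) by blast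
    next
      fix s assume "s \<in> par (\<Theta> \<inter> lk t) \<inter> cj y ` par \<Theta>'"
      then obtain s' where s: "s \<in> par (\<Theta> \<inter> lk t)" "s' \<in> par \<Theta>'" "s = cj y s'" by blast
      have "s = cj b s" using cj_id[OF b par_closed[OF s(1)] bc[OF s(1)]] by simp
      also have "\<dots> = cj x s'" using s(3) inner b cj_cj par_closed[OF s(2)] by simp
      finally show "s \<in> par \<Theta> \<inter> cj x ` par \<Theta>'" using s(1,2) par_Int by blast
    qed
    moreover obtain h \<Xi> where "h \<in> par (\<Theta> \<inter> lk t)" "\<Xi> \<subseteq> \<Theta> \<inter> lk t \<inter> \<Theta>'"
      "par (\<Theta> \<inter> lk t) \<inter> cj y ` par \<Theta>' = cj h ` par \<Xi>"
      using less.hyps[of y "\<Theta> \<inter> lk t"] inner by blast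
    ultimately show ?thesis using par_mono[of "\<Theta> \<inter> lk t" \<Theta>] by (intro bexI[of _ h] exI[of _ \<Xi>]) auto
  qed
qed

lemma K_par_mem:
  assumes "u \<in> V" "a \<in> K u" "a \<noteq> \<one>" "a \<in> par \<Theta>"
  shows "u \<in> \<Theta>"
  using cnt_push[of u a \<one> u] cnt_par[OF assms(4,1)] assms K_closed by (auto simp: head_iff stk_one)

text \<open>In the inner case \<open>reduced_commute_head\<close> applies to all of
  \<open>par \<Theta>\<close> at once, so every vertex of \<open>\<Theta>\<close> is adjacent to
  \<open>t\<close>; thus \<open>t \<in> perp \<Theta>\<close>, and \<open>b\<close> can be stripped
  off because it centralizes \<open>par \<Theta>\<close>. The inclusion of one conjugate suffices
  for this.\<close>

lemma par_normalizer:
  assumes "x \<in> carrier P" "\<Theta> \<subseteq> V" "\<And>s. s \<in> par \<Theta> \<Longrightarrow> cj (inv x) s \<in> par \<Theta>"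
  shows "x \<in> par (\<Theta> \<union> perp \<Theta>)"
  using assms(1,3)
proof (induction "len x" arbitrary: x rule: less_induct)
  case less
  note x = less.prems(1)
  have left: "x \<in> par (\<Theta> \<union> perp \<Theta>)"
    if t: "t \<in> \<Theta> \<union> perp \<Theta>" "t \<in> V" "b \<in> K t" "y \<in> carrier P" "x = b \<otimes> y" "len y < len x"
      and bs: "\<And>s. s \<in> par \<Theta> \<Longrightarrow> cj b s \<in> par \<Theta>" for t b y
  proof -
    have b: "b \<in> carrier P" using K_closed t by auto
    have "y \<in> par (\<Theta> \<union> perp \<Theta>)"
    proof (rule less.hyps[OF t(6,4)])
      fix s assume s: "s \<in> par \<Theta>"
      have "cj (inv y) s = cj (inv x) (cj b s)"
        using t b par_closed[OF s] by (simp add: cj_cj inv_mult_group m_assoc)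
      then show "cj (inv y) s \<in> par \<Theta>" using less.prems(2)[OF bs[OF s]] by simp
    qed
    then show ?thesis using par_mult K_par t by simp
  qed
  show ?case
  proof (cases rule: peel_cases[OF x, where \<Theta> = \<Theta> and \<Theta>' = \<Theta>, case_names head tail one inner])
    case (head t b y)
    show ?thesis by (rule left[of t b y]) (use head K_par cj_par in blast)+
  next
    case (tail t b y)
    have b: "b \<in> carrier P" "b \<in> par \<Theta>" using K_closed K_par tail by auto
    have "y \<in> par (\<Theta> \<union> perp \<Theta>)"
    proof (rule less.hyps[OF tail(6,4)])
      fix s assume s: "s \<in> par \<Theta>"
      have "cj (inv y) s = cj b (cj (inv x) s)"
        using tail b par_closed[OF s] by (simp add: cj_cj inv_mult_group m_assoc[symmetric])
      then show "cj (inv y) s \<in> par \<Theta>" using less.prems(2)[OF s] cj_par[OF b(2)] by auto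
    qed
    then show ?thesis using par_mult b(2) par_mono[of \<Theta> "\<Theta> \<union> perp \<Theta>"] tail by auto
  next
    case one
    then show ?thesis using par_one by simp
  next
    case (inner t b y)
    have lk: "s \<in> par (lk t)" if s: "s \<in> par \<Theta>" for s
    proof (rule reduced_commute_head[OF s less.prems(2)[OF s] x _ inner(1-3)])
      show "s \<otimes> x = x \<otimes> cj (inv x) s"
        using cj_eqD[OF x, of "cj (inv x) s"] x par_closed[OF s] by simp
    qed
    have "adj u t" if u: "u \<in> \<Theta>" for u
    proof -
      have uV: "u \<in> V" using u assms(2) by blast
      obtain a where a: "a \<in> K u" "a \<noteq> \<one>" using K_nontrivial[OF uV] by blast
      have "a \<in> par (lk t)" by (rule lk) (use K_par uV u a in blast)
      then have "u \<in> lk t" using K_par_mem[OF uV a] by blast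
      then show ?thesis using adj_sym by (simp add: lk_def)
    qed
    then have t: "t \<in> perp \<Theta>" using inner by (simp add: perp_def)
    have bs: "cj b s = s" if s: "s \<in> par \<Theta>" for s
    proof (rule cj_id)
      show "b \<otimes> s = s \<otimes> b"
        by (rule par_commute[of b "{t}" s "lk t"]) (use lk[OF s] par_singleton inner in \<open>auto simp: lk_def\<close>)
    qed (use inner K_closed par_closed s in auto)
    show ?thesis by (rule left[of t b y]) (use inner t bs in auto)
  qed
qed

text \<open>Killing the vertex-groups outside \<open>\<Theta>\<close> respects the commutation
  relations.\<close>

lemma retraction:
  obtains r where "r \<in> hom P P" "\<And>x. x \<in> par \<Theta> \<Longrightarrow> r x = x" "\<And>x. x \<in> carrier P \<Longrightarrow> r x \<in> par \<Theta>"
    "\<And>x \<Theta>'. x \<in> par \<Theta>' \<Longrightarrow> \<Theta> \<inter> \<Theta>' = {} \<Longrightarrow> r x = \<one>"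
proof -
  obtain r where r: "r \<in> hom P P" "\<And>u a. u \<in> V \<Longrightarrow> a \<in> K u \<Longrightarrow> r a = (if u \<in> \<Theta> then a else \<one>)"
  proof (rule universal[OF is_group, of "\<lambda>u a. if u \<in> \<Theta> then a else \<one>"])
    show "(\<lambda>a. if u \<in> \<Theta> then a else \<one>) \<in> hom (P\<lparr>carrier := K u\<rparr>) P" if "u \<in> V" for u
      using K_closed[OF that] by (auto simp: hom_def)
    show "(if u \<in> \<Theta> then a else \<one>) \<otimes> (if v \<in> \<Theta> then b else \<one>) =
        (if v \<in> \<Theta> then b else \<one>) \<otimes> (if u \<in> \<Theta> then a else \<one>)"
      if "adj u v" "a \<in> K u" "b \<in> K v" for u v a b
      using that K_commute[OF that] adjD[OF that(1)] K_closed by simp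
  qed blast
  note r1 = hom_one[OF r(1) is_group is_group] and rm = hom_mult[OF r(1)]
  show thesis
  proof (rule that[OF r(1)])
    show "r x = x" if "x \<in> par \<Theta>" for x
      using that
      by (induction x rule: par_induct) (simp_all add: r1 rm[OF K_closed par_closed] r(2))
    show "r x = \<one>" if "x \<in> par \<Theta>'" "\<Theta> \<inter> \<Theta>' = {}" for x \<Theta>'
      using that
    proof (induction x rule: par_induct)
      case (push u a g)
      then have "r a = \<one>" using r(2)[of u a] by auto
      then show ?case using push rm[OF K_closed[OF push.hyps(2,3)] par_closed[OF push.hyps(5)]] by simp
    qed (rule r1)
    show "r x \<in> par \<Theta>" if "x \<in> carrier P" for x
      using that
    proof (induction x rule: nf_elt_induct)
      case one
      then show ?case by (simp add: r1 par_one)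
    next
      case (push u a g)
      then have "r a \<in> par \<Theta>" using r(2) K_par par_one by simp
      then show ?case using rm[OF K_closed[OF push.hyps(1,2)] push.hyps(4)] push.IH par_mult by simp
    qed
  qed
qed

text \<open>Two elements \<open>h\<close> and \<open>h'\<close> are allowed because stripping
  syllables in \<open>par (st w)\<close> from \<open>x\<close> conjugates one of them. The invariant
  \<open>r h \<noteq> \<one>\<close> survives conjugation and rules out the inner case, where
  \<open>h\<close> would avoid \<open>w\<close>.\<close>

lemma centralizer_star_aux:
  assumes r: "r \<in> hom P P" "\<And>x. x \<in> par (- {w}) \<Longrightarrow> r x = \<one>"
    and "x \<in> carrier P" "h \<in> par (st w)" "h' \<in> par (st w)" "r h \<noteq> \<one>" "h \<otimes> x = x \<otimes> h'"
  shows "x \<in> par (st w)"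
  using assms(3-)
proof (induction "len x" arbitrary: x h h' rule: less_induct)
  case less
  note x = less.prems(1)
  have hc: "h \<in> carrier P" "h' \<in> carrier P" using less.prems par_closed by auto
  have r_hom: "group_hom P P r" by unfold_locales (rule r(1))
  show ?case
  proof (cases rule: peel_cases[OF x, where \<Theta> = "st w" and \<Theta>' = "st w", case_names head tail one inner])
    case (head t b y)
    have b: "b \<in> par (st w)" "b \<in> carrier P" using K_par K_closed head by auto
    have "y \<in> par (st w)"
    proof (rule less.hyps[OF head(6,4)])
      show "cj (inv b) h \<in> par (st w)" using cj_par[OF par_inv[OF b(1)]] less.prems(2) by blast
      show "h' \<in> par (st w)" by (rule less.prems(3))
      have "h = cj b (cj (inv b) h)" using b hc by simp
      show "r (cj (inv b) h) \<noteq> \<one>"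
      proof
        assume "r (cj (inv b) h) = \<one>"
        then have "r (cj b (cj (inv b) h)) = \<one>"
          using b hc hom_in_carrier[OF r(1)] group_hom.hom_inv[OF r_hom]
          by (subst cj_def) (simp add: hom_mult[OF r(1)])
        then show False using less.prems(4) b hc by simp
      qed
      have "cj (inv b) h \<otimes> y = inv b \<otimes> (h \<otimes> x)" using head b hc by (simp add: cj_def m_assoc)
      also have "\<dots> = y \<otimes> h'" using head b hc less.prems(5) by (simp add: m_assoc[symmetric])
      finally show "cj (inv b) h \<otimes> y = y \<otimes> h'" .
    qed
    then show ?thesis using par_mult b head by simp
  next
    case (tail t b y)
    have b: "b \<in> par (st w)" "b \<in> carrier P" using K_par K_closed tail by auto
    have "y \<in> par (st w)"
    proof (rule less.hyps[OF tail(6,4) less.prems(2) _ less.prems(4)])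
      show "cj b h' \<in> par (st w)" using cj_par[OF b(1)] less.prems(3) by blast
      have "h \<otimes> y = h \<otimes> x \<otimes> inv b" using tail b hc by (simp add: m_assoc)
      also have "\<dots> = x \<otimes> h' \<otimes> inv b" using less.prems(5) by simp
      finally show "h \<otimes> y = y \<otimes> cj b h'"
        using tail b hc by (simp add: cj_def m_assoc)
    qed
    then show ?thesis using par_mult b tail by simp
  next
    case one
    then show ?thesis using par_one by simp
  next
    case (inner t b y)
    have "h \<in> par (lk t)" by (rule reduced_commute_head[OF less.prems(2,3) x less.prems(5) inner(1-3)])
    moreover have "w \<notin> lk t" using inner(1,3) adj_sym by (auto simp: st_def lk_def)
    ultimately have "h \<in> par (- {w})" using par_mono[of "lk t" "- {w}"] by blast
    then show ?thesis using r(2) less.prems(4) by blast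
  qed
qed

text \<open>The factor \<open>e\<close> makes room for products of a syllable with an element of an
  adjacent vertex-group, such as the products of powers fixing an axis edge. The retraction onto
  \<open>K w\<close> removes \<open>e\<close> and keeps \<open>k\<close>.\<close>

lemma centralizer_star:
  assumes "w \<in> V" "k \<in> K w" "k \<noteq> \<one>" "e \<in> par (lk w)" "x \<in> carrier P" "k \<otimes> e \<otimes> x = x \<otimes> (k \<otimes> e)"
  shows "x \<in> par (st w)"
proof -
  obtain r where r: "r \<in> hom P P" "\<And>x. x \<in> par {w} \<Longrightarrow> r x = x"
    "\<And>x \<Theta>'. x \<in> par \<Theta>' \<Longrightarrow> {w} \<inter> \<Theta>' = {} \<Longrightarrow> r x = \<one>"
    using retraction[of "{w}"] by metis
  have ke: "k \<in> carrier P" "e \<in> carrier P" using assms K_closed par_closed by auto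
  have "r e = \<one>" using r(3)[OF assms(4)] by (simp add: lk_def)
  then have "r (k \<otimes> e) = k" using hom_mult[OF r(1) ke] r(2) par_singleton assms ke by simp
  moreover have "k \<otimes> e \<in> par (st w)"
    by (rule par_mult[OF K_par[OF assms(1) _ assms(2)]])
      (use assms(4) par_mono[of "lk w" "st w"] in \<open>auto simp: st_def\<close>)
  ultimately show ?thesis
    using centralizer_star_aux[OF r(1) _ assms(5), of w "k \<otimes> e" "k \<otimes> e"] r(3)[of _ "- {w}"] assms by auto
qed

lemma centralizer_K:
  assumes "w \<in> V" "k \<in> K w" "k \<noteq> \<one>" "x \<in> carrier P" "k \<otimes> x = x \<otimes> k"
  shows "x \<in> par (st w)"
  using centralizer_star[OF assms(1-3) par_one assms(4)] assms K_closed by simp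

text \<open>\<open>\<Theta>\<close> has least cardinality among the subsets of
  \<open>\<Lambda>\<close> whose parabolic subgroup contains a conjugate of \<open>S\<close>. If
  \<open>x\<close> centralizes \<open>S\<close>, this conjugate also lies in \<open>cj y\<close> of
  \<open>par \<Theta>\<close> for \<open>y = cj g' x\<close>; by \<open>par_Int_conj\<close> and
  minimality the intersection is all of \<open>par \<Theta>\<close>, and
  \<open>par_normalizer\<close> applies to \<open>y\<close>.\<close>

lemma minimal_parabolic_centralizer:
  assumes S: "S \<subseteq> carrier P" and g: "g \<in> carrier P" "cj g ` S \<subseteq> par \<Lambda>" and \<Lambda>: "\<Lambda> \<subseteq> V"
  obtains g' \<Theta> where "g' \<in> carrier P" "\<Theta> \<subseteq> \<Lambda>" "cj g' ` S \<subseteq> par \<Theta>"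
    "\<And>x. x \<in> carrier P \<Longrightarrow> (\<And>s. s \<in> S \<Longrightarrow> x \<otimes> s = s \<otimes> x) \<Longrightarrow> cj g' x \<in> par (\<Theta> \<union> perp \<Theta>)"
proof -
  define Q where "Q \<Theta> \<longleftrightarrow> \<Theta> \<subseteq> \<Lambda> \<and> (\<exists>g\<in>carrier P. cj g ` S \<subseteq> par \<Theta>)" for \<Theta>
  have "Q \<Lambda>" using g by (auto simp: Q_def)
  then obtain \<Theta> where \<Theta>: "Q \<Theta>" and min: "\<And>\<Xi>. Q \<Xi> \<Longrightarrow> card \<Theta> \<le> card \<Xi>"
    using ex_has_least_nat[of Q \<Lambda> card] by blast
  then obtain g' where g': "\<Theta> \<subseteq> \<Lambda>" "g' \<in> carrier P" "cj g' ` S \<subseteq> par \<Theta>" by (auto simp: Q_def)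
  have fin: "finite \<Theta>" using g'(1) \<Lambda> fin_verts by (meson finite_subset)
  have "cj g' x \<in> par (\<Theta> \<union> perp \<Theta>)" if x: "x \<in> carrier P" "\<And>s. s \<in> S \<Longrightarrow> x \<otimes> s = s \<otimes> x" for x
  proof (rule par_normalizer)
    let ?y = "cj g' x"
    show y: "?y \<in> carrier P" using g' x by simp
    show "\<Theta> \<subseteq> V" using g' \<Lambda> by blast
    obtain h \<Xi> where h: "h \<in> par \<Theta>" "\<Xi> \<subseteq> \<Theta> \<inter> \<Theta>" "par \<Theta> \<inter> cj ?y ` par \<Theta> = cj h ` par \<Xi>"
      using par_Int_conj[OF y, of \<Theta> \<Theta>] by blast
    have hc: "h \<in> carrier P" by (rule par_closed[OF h(1)])
    have "cj g' ` S \<subseteq> cj h ` par \<Xi>"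
    proof
      fix z assume "z \<in> cj g' ` S"
      then obtain s where s: "s \<in> S" "z = cj g' s" by blast
      have sc: "s \<in> carrier P" using s S by blast
      have "?y \<otimes> z = z \<otimes> ?y" unfolding s(2) using cj_commute_iff[OF g'(2) x(1) sc] x(2)[OF s(1)] by simp
      then have "z = cj ?y z" using cj_id[OF y, of z] s g' sc by simp
      moreover have "z \<in> par \<Theta>" using s g' by blast
      ultimately show "z \<in> cj h ` par \<Xi>" using h(3) by blast
    qed
    then have "cj (inv h \<otimes> g') ` S \<subseteq> par \<Xi>"
      using cj_subset_iff[of "inv h" "cj g' ` S" "par \<Xi>"] hc par_subset cj_image_closed[OF g'(2) S]
        cj_image_cj[OF _ g'(2) S, of "inv h"] by simp
    then have "Q \<Xi>" using h(2) g' hc by (auto simp: Q_def)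
    then have "\<Xi> = \<Theta>" using min h(2) fin by (metis card_seteq inf.idem)
    then have sub: "par \<Theta> \<subseteq> cj ?y ` par \<Theta>" using h(3) cj_par[OF h(1)] by blast
    fix s assume "s \<in> par \<Theta>"
    then obtain s' where "s' \<in> par \<Theta>" "s = cj ?y s'" using sub by blast
    then show "cj (inv ?y) s \<in> par \<Theta>" using y par_closed by simp
  qed
  then show thesis using that g' by blast
qed


lemma inv_cancel: "g \<in> carrier P \<Longrightarrow> x \<in> carrier P \<Longrightarrow> inv g \<otimes> (g \<otimes> x) = x"
  by (simp add: m_assoc[symmetric])

lemma stk_adj_mult:
  assumes "adj u t" "a \<in> K u" "x \<in> carrier P"
  shows "stk (a \<otimes> x) t = stk x t"
proof -
  have uV: "u \<in> V" by (rule adjD(1)[OF assms(1)])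
  have *: "stk (b \<otimes> y) t = stk y t" if "b \<in> K u" "y \<in> carrier P" "\<not> head u y" for b y
    using stk_push[OF uV that(1) _ that(2,3)] that(2) push_adj[OF assms(1)] by (cases "b = \<one>") auto
  show ?thesis
  proof (cases "head u x")
    case True
    obtain b y where b: "u \<in> V" "b \<in> K u" "b \<noteq> \<one>" "y \<in> carrier P" "\<not> head u y" "x = b \<otimes> y"
      "stk x = push u b (stk y)"
      using head_peel[OF assms(3) True] .
    have "a \<otimes> x = (a \<otimes> b) \<otimes> y" using b(2,4,6) assms(2) K_closed[OF uV] by (simp add: m_assoc)
    then show ?thesis using *[OF K_mult[OF uV assms(2) b(2)] b(4,5)] b(7) push_adj[OF assms(1)] by simp
  next
    case False
    then show ?thesis using * assms by blast
  qed
qed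

lemma stk_lk_mult: "e \<in> par (lk t) \<Longrightarrow> x \<in> carrier P \<Longrightarrow> stk (e \<otimes> x) t = stk x t"
proof (induction e rule: par_induct)
  case (push u a e)
  have "stk (a \<otimes> (e \<otimes> x)) t = stk (e \<otimes> x) t"
    by (rule stk_adj_mult) (use push par_closed adj_sym in \<open>auto simp: lk_def\<close>)
  then show ?case using push par_closed K_closed by (simp add: m_assoc)
qed simp

lemma par_Un_decomp:
  assumes "c \<in> par (A \<union> B)" "\<And>u v. u \<in> A \<Longrightarrow> v \<in> B \<Longrightarrow> adj u v"
  shows "\<exists>x\<in>par A. \<exists>y\<in>par B. c = x \<otimes> y"
  using assms(1)
proof (induction c rule: par_induct)
  case one
  show ?case by (rule bexI[OF bexI[OF _ par_one] par_one]) simp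
next
  case (push u a c)
  obtain x y where xy: "x \<in> par A" "y \<in> par B" "c = x \<otimes> y" using push.IH by blast
  note cl = par_closed[OF xy(1)] par_closed[OF xy(2)] K_closed[OF push.hyps(2,3)]
  show ?case
  proof (cases "u \<in> A")
    case True
    have "a \<otimes> x \<in> par A" by (rule par_mult[OF K_par[OF push.hyps(2) True push.hyps(3)] xy(1)])
    moreover have "a \<otimes> c = (a \<otimes> x) \<otimes> y" using cl xy(3) by (simp add: m_assoc)
    ultimately show ?thesis using xy(2) by (intro bexI[of _ "a \<otimes> x"] bexI[of _ y])
  next
    case False
    then have "u \<in> B" using push.hyps(1) by simp
    then have a: "a \<in> par B" using K_par[OF push.hyps(2) _ push.hyps(3)] by simp
    have xa: "x \<otimes> a = a \<otimes> x" by (rule par_commute[OF xy(1) a assms(2)])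
    have "a \<otimes> c = (a \<otimes> x) \<otimes> y" using cl xy(3) by (simp add: m_assoc)
    also have "\<dots> = x \<otimes> (a \<otimes> y)" unfolding xa[symmetric] using cl by (simp add: m_assoc)
    finally have "a \<otimes> c = x \<otimes> (a \<otimes> y)" .
    then show ?thesis by (intro bexI[of _ x] bexI[of _ "a \<otimes> y"] xy(1) par_mult[OF a xy(2)])
  qed
qed

lemma par_st_decomp:
  assumes "v \<in> V" "c \<in> par (st v)"
  obtains s e where "s \<in> K v" "e \<in> par (lk v)" "c = s \<otimes> e"
proof -
  have "\<exists>x\<in>par {v}. \<exists>y\<in>par (lk v). c = x \<otimes> y"
  proof (rule par_Un_decomp)
    show "c \<in> par ({v} \<union> lk v)" using assms(2) by (simp add: st_def)
    show "adj u t" if "u \<in> {v}" "t \<in> lk v" for u t using that by (simp add: lk_def)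
  qed
  then obtain x y where "x \<in> par {v}" "y \<in> par (lk v)" "c = x \<otimes> y" by (elim bexE)
  then show thesis using that[of x y] par_singleton[OF assms(1)] by simp
qed

lemma min_rep:
  "g \<in> carrier P \<Longrightarrow> \<exists>c\<in>par \<Theta>. \<exists>k\<in>carrier P. g = c \<otimes> k \<and> (\<forall>u\<in>\<Theta>. \<not> head u k)"
proof (induction "len g" arbitrary: g rule: less_induct)
  case less
  show ?case
  proof (cases "\<exists>u\<in>\<Theta>. head u g")
    case True
    then obtain u where u: "u \<in> \<Theta>" "head u g" by blast
    obtain b h where b: "u \<in> V" "b \<in> K u" "b \<noteq> \<one>" "h \<in> carrier P" "\<not> head u h" "g = b \<otimes> h"
      "stk g = push u b (stk h)"
      using head_peel[OF less.prems u(2)] .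
    have "len h < len g" using len_push[OF b(1-5)] b(6) by simp
    from less.hyps[OF this b(4)] obtain c k where
      c: "c \<in> par \<Theta>" "k \<in> carrier P" "h = c \<otimes> k" "\<forall>u\<in>\<Theta>. \<not> head u k" by blast
    have bp: "b \<in> par \<Theta>" by (rule K_par[OF b(1) u(1) b(2)])
    have "g = (b \<otimes> c) \<otimes> k" using b(6) c(1-3) bp par_closed by (simp add: m_assoc)
    then show ?thesis by (intro bexI[of _ "b \<otimes> c"] bexI[of _ k] conjI par_mult[OF bp c(1)] c(2,4))
  next
    case False
    have "g = \<one> \<otimes> g" using less.prems by simp
    then show ?thesis using False
      by (intro bexI[of _ \<one>] bexI[of _ g] conjI less.prems par_one) simp_all
  qed
qed

subsection \<open>The Bass--Serre tree at a vertex\<close>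

text \<open>\<open>P\<close> is the amalgam of \<open>par (st v)\<close> and
  \<open>par (- {v})\<close> over \<open>par (lk v)\<close>; the Boolean selects the factor. Right
  cosets are used below because normal forms are built by multiplying on the left.\<close>

definition side :: "'v \<Rightarrow> bool \<Rightarrow> 'g set" where
  "side v i = (if i then par (st v) else par (- {v}))"

definition cos :: "'v \<Rightarrow> bool \<Rightarrow> 'g \<Rightarrow> bool \<times> 'g set" where
  "cos v i g = (i, side v i #> g)"

definition TV :: "'v \<Rightarrow> (bool \<times> 'g set) set" where
  "TV v = {cos v i g | i g. g \<in> carrier P}"

definition TE :: "'v \<Rightarrow> ((bool \<times> 'g set) \<times> (bool \<times> 'g set)) set" where
  "TE v = {(cos v i g, cos v (\<not> i) g) | i g. g \<in> carrier P}"

text \<open>Distance from the base coset \<open>cos v False \<one>\<close>: each syllable of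
  \<open>K v\<close> costs two edges, and cosets of \<open>par (st v)\<close> lie halfway.\<close>

definition lev :: "'v \<Rightarrow> bool \<times> 'g set \<Rightarrow> nat" where
  "lev v x = 2 * (LEAST n. \<exists>k\<in>snd x. cnt v k = n) + (if fst x then 1 else 0)"

lemma side_subgroup: "subgroup (side v i) P"
  by (simp add: side_def par_subgroup)

lemma cos_eq_iff:
  assumes "g \<in> carrier P" "h \<in> carrier P"
  shows "cos v i g = cos v i h \<longleftrightarrow> (\<exists>c\<in>side v i. h = c \<otimes> g)"
proof
  assume "cos v i g = cos v i h"
  then have "h \<in> side v i #> g" using rcos_self[OF assms(2) side_subgroup, of v i] by (simp add: cos_def)
  then show "\<exists>c\<in>side v i. h = c \<otimes> g" by (auto simp: r_coset_def)
next
  assume "\<exists>c\<in>side v i. h = c \<otimes> g"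
  then have "h \<in> side v i #> g" by (auto simp: r_coset_def)
  from repr_independence[OF this assms(1) side_subgroup] show "cos v i g = cos v i h"
    by (simp add: cos_def)
qed

lemma st_Diff: "st v \<inter> - {v} = lk v"
  by (auto simp: st_def lk_def)

lemma side_Int: "side v True \<inter> side v False = par (lk v)"
  by (simp add: side_def par_Int st_Diff)

lemma lk_subset: "par (lk v) \<subseteq> side v i"
  using side_Int[of v] by (cases i) auto

text \<open>The number of syllables of \<open>K v\<close> is constant on cosets of
  \<open>par (- {v})\<close>.\<close>

lemma lev_False: "g \<in> carrier P \<Longrightarrow> lev v (cos v False g) = 2 * cnt v g"
proof -
  assume g: "g \<in> carrier P"
  have *: "cnt v k = cnt v g" if k: "k \<in> side v False #> g" for k
  proof -
    from k obtain c where "c \<in> par (- {v})" "k = c \<otimes> g" by (auto simp: side_def r_coset_def)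
    then show ?thesis using cnt_par_mult[OF _ g, of c "- {v}" v] by simp
  qed
  have "(LEAST n. \<exists>k\<in>side v False #> g. cnt v k = n) = cnt v g"
  proof (rule Least_equality)
    show "\<exists>k\<in>side v False #> g. cnt v k = cnt v g" using rcos_self[OF g side_subgroup] by (intro bexI[of _ g]) simp_all
    show "cnt v g \<le> n" if "\<exists>k\<in>side v False #> g. cnt v k = n" for n using that * by fastforce
  qed
  then show ?thesis by (simp add: lev_def cos_def)
qed

text \<open>Within the coset, the syllable count at \<open>v\<close> is least at representatives
  without head at \<open>v\<close>, because \<open>par (st v)\<close> is \<open>K v\<close> times
  \<open>par (lk v)\<close>.\<close>

lemma lev_True:
  assumes v: "v \<in> V" and g: "g \<in> carrier P" "\<not> head v g"
  shows "lev v (cos v True g) = Suc (2 * cnt v g)"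
proof -
  have *: "cnt v g \<le> cnt v k" if k: "k \<in> side v True #> g" for k
  proof -
    obtain c where c: "c \<in> par (st v)" "k = c \<otimes> g" using k by (auto simp: side_def r_coset_def)
    obtain s e where s: "s \<in> K v" "e \<in> par (lk v)" "c = s \<otimes> e" using par_st_decomp[OF v c(1)] .
    have eg: "e \<otimes> g \<in> carrier P" "stk (e \<otimes> g) v = stk g v"
      using stk_lk_mult[OF s(2) g(1)] par_closed[OF s(2)] g(1) by auto
    then have nh: "\<not> head v (e \<otimes> g)" "cnt v (e \<otimes> g) = cnt v g" using g(2) by (auto simp: head_iff cnt_def)
    have "k = s \<otimes> (e \<otimes> g)" using c s par_closed K_closed[OF v] g by (simp add: m_assoc)
    then show ?thesis using cnt_push[OF v s(1) _ eg(1) nh(1), of v] nh(2) eg(1) by (cases "s = \<one>") auto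
  qed
  have "(LEAST n. \<exists>k\<in>side v True #> g. cnt v k = n) = cnt v g"
  proof (rule Least_equality)
    show "\<exists>k\<in>side v True #> g. cnt v k = cnt v g" using rcos_self[OF g(1) side_subgroup] by (intro bexI[of _ g]) simp_all
    show "cnt v g \<le> n" if "\<exists>k\<in>side v True #> g. cnt v k = n" for n using that * by fastforce
  qed
  then show ?thesis by (simp add: lev_def cos_def)
qed

lemma cos_True_peel:
  assumes v: "v \<in> V" and g: "g \<in> carrier P" "head v g"
  obtains h where "h \<in> carrier P" "\<not> head v h" "cos v True g = cos v True h" "cnt v g = Suc (cnt v h)"
proof -
  obtain b h where b: "v \<in> V" "b \<in> K v" "b \<noteq> \<one>" "h \<in> carrier P" "\<not> head v h" "g = b \<otimes> h"
      "stk g = push v b (stk h)"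
    using head_peel[OF g] .
  have "b \<in> side v True" using K_par[OF v _ b(2)] by (simp add: side_def st_def)
  then have "cos v True h = cos v True g" using cos_eq_iff[OF b(4) g(1)] b(6) by blast
  then show thesis using that[OF b(4,5)] cnt_push[OF b(1-5), of v] b(6) by simp
qed

lemma lev_True_head: "v \<in> V \<Longrightarrow> g \<in> carrier P \<Longrightarrow> head v g \<Longrightarrow> Suc (lev v (cos v True g)) = 2 * cnt v g"
  by (rule cos_True_peel) (auto simp: lev_True)

text \<open>For a coset representative \<open>k0\<close> with no heads other than \<open>v\<close>,
  products \<open>x \<otimes> k0\<close> are reduced, so \<open>v\<close> is a head only if no
  syllable of \<open>x\<close> blocks it. With the next lemma this gives uniqueness of lower
  neighbours.\<close>

lemma head_uniq_False:
  assumes v: "v \<in> V" and k: "k \<in> carrier P" "head v k" and c: "c \<in> par (- {v})" "head v (c \<otimes> k)"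
  shows "c \<in> par (lk v)"
proof -
  obtain c0 k0 where c0: "c0 \<in> par (- {v})" "k0 \<in> carrier P" "k = c0 \<otimes> k0" "\<forall>u\<in>- {v}. \<not> head u k0"
    using min_rep[OF k(1)] by blast
  have *: "x \<in> par (lk v)" if x: "x \<in> par (- {v})" "head v (x \<otimes> k0)" for x
  proof -
    have xc: "x \<in> carrier P" by (rule par_closed[OF x(1)])
    have "stk (x \<otimes> k0) = (\<lambda>t. stk x t @ stk k0 t)"
      by (rule stk_concat[OF xc c0(2)]) (use tail_par[OF x(1)] c0(4) in blast)
    moreover have "\<not> head v x" by (rule not_head_par[OF x(1) v]) simp
    ultimately have "stk x v = []" using x(2) by (cases "stk x v") (auto simp: head_iff)
    then show ?thesis by (rule par_lk_stk[OF xc])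
  qed
  have 0: "c0 \<in> par (lk v)" using *[OF c0(1)] c0(3) k(2) by simp
  have cl: "c \<in> carrier P" "c0 \<in> carrier P" using par_closed c c0 by auto
  have "c \<otimes> k = (c \<otimes> c0) \<otimes> k0" using cl c0(2,3) by (simp add: m_assoc)
  then have 1: "c \<otimes> c0 \<in> par (lk v)" using *[OF par_mult[OF c(1) c0(1)]] c(2) by simp
  have "c = (c \<otimes> c0) \<otimes> inv c0" using cl by (simp add: m_assoc)
  then show ?thesis using par_mult[OF 1 par_inv[OF 0]] by simp
qed

text \<open>If the component \<open>s\<close> of \<open>c\<close> in \<open>K v\<close> were
  non-trivial, it would become a head at \<open>v\<close>.\<close>

lemma head_uniq_True:
  assumes v: "v \<in> V" and k: "k \<in> carrier P" "\<not> head v k" and c: "c \<in> par (st v)" "\<not> head v (c \<otimes> k)"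
  shows "c \<in> par (lk v)"
proof -
  obtain s e where s: "s \<in> K v" "e \<in> par (lk v)" "c = s \<otimes> e" using par_st_decomp[OF v c(1)] .
  have cl: "s \<in> carrier P" "e \<in> carrier P" using K_closed[OF v s(1)] par_closed[OF s(2)] by auto
  have nh: "\<not> head v (e \<otimes> k)" using stk_lk_mult[OF s(2) k(1)] k(2) by (simp add: head_iff)
  have ck: "c \<otimes> k = s \<otimes> (e \<otimes> k)" using s(3) cl k(1) by (simp add: m_assoc)
  have "s = \<one>"
  proof (rule ccontr)
    assume "s \<noteq> \<one>"
    then have "stk (c \<otimes> k) = push v s (stk (e \<otimes> k))" unfolding ck using stk_push[OF v s(1)] nh cl k(1) by simp
    then show False using c(2) by (simp add: head_iff push_at)
  qed
  then show ?thesis using s cl by simp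
qed

lemma rooted_tree_T:
  assumes v: "v \<in> V"
  shows "rooted_tree (TV v) (TE v) (lev v) (cos v False \<one>)"
proof
  show "TE v \<subseteq> TV v \<times> TV v" unfolding TE_def TV_def by blast
  show "(y, x) \<in> TE v" if "(x, y) \<in> TE v" for x y
  proof -
    from that obtain i g where "x = cos v i g" "y = cos v (\<not> i) g" "g \<in> carrier P" unfolding TE_def by blast
    then have "(y, x) = (cos v (\<not> i) g, cos v (\<not> \<not> i) g)" "g \<in> carrier P" by simp_all
    then show ?thesis unfolding TE_def by blast
  qed
  show "cos v False \<one> \<in> TV v" unfolding TV_def by blast
  show "lev v (cos v False \<one>) = 0" by (simp add: lev_False)
  show "x = cos v False \<one>" if "x \<in> TV v" "lev v x = 0" for x
  proof -
    from that(1) obtain i g where x: "x = cos v i g" "g \<in> carrier P" unfolding TV_def by blast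
    have i: "\<not> i" using that(2) x by (auto simp: lev_def cos_def split: if_splits)
    then have "cnt v g = 0" using that(2) x lev_False by simp
    then have "g \<in> side v False" using x(2) by (simp add: side_def par_def)
    then have "cos v False \<one> = cos v False g" using cos_eq_iff[OF one_closed x(2)] x(2) by force
    then show ?thesis using x(1) i by simp
  qed
  have lev_edge: "if head v g then Suc (lev v (cos v True g)) = lev v (cos v False g)
      else lev v (cos v True g) = Suc (lev v (cos v False g))" if "g \<in> carrier P" for g
    using lev_True_head[OF v that] lev_True[OF v that] lev_False[OF that] by simp
  \<comment> \<open>The inequality compares truth values: from the star side an edge descends if its
    element has no head at \<open>v\<close>, from the other side if it has one.\<close>
  have lev_less: "lev v (cos v (\<not> i) g) < lev v (cos v i g) \<longleftrightarrow> head v g \<noteq> i" if "g \<in> carrier P" for i g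
    using lev_edge[OF that] by (cases i; cases "head v g") auto
  show "lev v y = Suc (lev v x) \<or> lev v x = Suc (lev v y)" if "(x, y) \<in> TE v" for x y
  proof -
    from that obtain i g where xy: "x = cos v i g" "y = cos v (\<not> i) g" "g \<in> carrier P" unfolding TE_def by blast
    then show ?thesis using lev_edge[OF xy(3)] by (cases i; cases "head v g") auto
  qed
  show "\<exists>y. (x, y) \<in> TE v \<and> lev v y < lev v x" if "x \<in> TV v" "lev v x \<noteq> 0" for x
  proof -
    from that(1) obtain i g where x: "x = cos v i g" "g \<in> carrier P" unfolding TV_def by blast
    have "\<exists>h\<in>carrier P. x = cos v i h \<and> head v h \<noteq> i"
    proof (cases i)
      case True
      then show ?thesis using x cos_True_peel[OF v x(2)] by metis
    next
      case False
      obtain c k where c: "c \<in> par (- {v})" "k \<in> carrier P" "g = c \<otimes> k" "\<forall>u\<in>- {v}. \<not> head u k"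
        using min_rep[OF x(2)] by blast
      have "cnt v g \<noteq> 0" using that(2) x False lev_False by simp
      then have "cnt v k \<noteq> 0" using cnt_par_mult[OF c(1,2), of v] c(3) by simp
      then have "k \<noteq> \<one>" by auto
      then have "head v k" using head_ex[OF c(2)] c(4) by blast
      moreover have "cos v False k = cos v False g" using cos_eq_iff[OF c(2) x(2)] c(1,3) by (auto simp: side_def)
      ultimately show ?thesis using x(1) c(2) False by (intro bexI[of _ k]) simp_all
    qed
    then obtain h where "h \<in> carrier P" "x = cos v i h" "head v h \<noteq> i" by blast
    then show ?thesis using lev_less[of h i] unfolding TE_def by blast
  qed
  show "y = z" if "(x, y) \<in> TE v" "(x, z) \<in> TE v" "lev v y < lev v x" "lev v z < lev v x" for x y z
  proof -
    from that(1) obtain i g where xy: "x = cos v i g" "y = cos v (\<not> i) g" "g \<in> carrier P" unfolding TE_def by blast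
    from that(2) obtain j h where xz: "x = cos v j h" "z = cos v (\<not> j) h" "h \<in> carrier P" unfolding TE_def by blast
    have ij: "j = i" using xy(1) xz(1) by (simp add: cos_def)
    have hd: "head v g \<noteq> i" "head v h \<noteq> i" using lev_less[OF xy(3), of i] lev_less[OF xz(3), of j] that(3,4) xy(1,2) xz(1,2) ij by simp_all
    obtain c where c: "c \<in> side v i" "h = c \<otimes> g" using cos_eq_iff[OF xy(3) xz(3), of v i] xy(1) xz(1) ij by auto
    have "c \<in> par (lk v)"
    proof (cases i)
      case True
      then show ?thesis using head_uniq_True[OF v xy(3)] hd c by (simp add: side_def)
    next
      case False
      then show ?thesis using head_uniq_False[OF v xy(3)] hd c by (simp add: side_def)
    qed
    then have "c \<in> side v (\<not> i)" using lk_subset by blast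
    then have "cos v (\<not> i) g = cos v (\<not> i) h" using cos_eq_iff[OF xy(3) xz(3), of v "\<not> i"] c(2) by blast
    then show ?thesis using xy(2) xz(2) ij by simp
  qed
qed

text \<open>The inverse turns right multiplication on right cosets into a left action.\<close>

definition tact :: "'g \<Rightarrow> bool \<times> 'g set \<Rightarrow> bool \<times> 'g set" where
  "tact h x = (fst x, snd x #> inv h)"

lemma side_subset: "side v i \<subseteq> carrier P"
  using subgroup.subset[OF side_subgroup] .

lemma tact_cos: "g \<in> carrier P \<Longrightarrow> h \<in> carrier P \<Longrightarrow> tact h (cos v i g) = cos v i (g \<otimes> inv h)"
  by (simp add: tact_def cos_def coset_mult_assoc[OF side_subset])

lemma tact_fix_iff:
  assumes "g \<in> carrier P" "h \<in> carrier P"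
  shows "tact h (cos v i g) = cos v i g \<longleftrightarrow> cj g h \<in> side v i"
proof -
  have "tact h (cos v i g) = cos v i g \<longleftrightarrow> (\<exists>c\<in>side v i. g = c \<otimes> (g \<otimes> inv h))"
    using tact_cos[OF assms] cos_eq_iff[of "g \<otimes> inv h" g v i] assms by simp
  also have "\<dots> \<longleftrightarrow> cj g h \<in> side v i"
  proof
    assume "\<exists>c\<in>side v i. g = c \<otimes> (g \<otimes> inv h)"
    then obtain c where c: "c \<in> side v i" "g = c \<otimes> (g \<otimes> inv h)" by blast
    have cc: "c \<in> carrier P" using c side_subset by blast
    have "c = c \<otimes> (g \<otimes> inv h) \<otimes> (h \<otimes> inv g)" using cc assms by (simp add: m_assoc inv_cancel)
    then have "cj g h = c" using c(2) assms by (simp add: cj_def m_assoc)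
    then show "cj g h \<in> side v i" using c by simp
  next
    assume "cj g h \<in> side v i"
    moreover have "g = cj g h \<otimes> (g \<otimes> inv h)" using assms by (simp add: cj_def m_assoc inv_cancel)
    ultimately show "\<exists>c\<in>side v i. g = c \<otimes> (g \<otimes> inv h)" by blast
  qed
  finally show ?thesis .
qed

lemma tree_action_T:
  assumes v: "v \<in> V"
  shows "tree_action (TV v) (rooted_tree.D (TE v)) P tact"
proof -
  interpret T: rooted_tree "TV v" "TE v" "lev v" "cos v False \<one>" by (rule rooted_tree_T[OF v])
  have TVD: "\<exists>i g. x = cos v i g \<and> g \<in> carrier P" if "x \<in> TV v" for x using that unfolding TV_def by blast
  have cl: "tact h x \<in> TV v" if "h \<in> carrier P" "x \<in> TV v" for h x
  proof -
    from TVD[OF that(2)] obtain i g where x: "x = cos v i g" "g \<in> carrier P" by blast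
    then show ?thesis using tact_cos[OF x(2) that(1)] that(1) unfolding TV_def by fastforce
  qed
  have mult: "tact (g \<otimes> h) x = tact g (tact h x)" if gh: "g \<in> carrier P" "h \<in> carrier P" and "x \<in> TV v" for g h x
  proof -
    from TVD[OF that(3)] obtain i k where x: "x = cos v i k" "k \<in> carrier P" by blast
    then show ?thesis using gh by (simp add: tact_cos inv_mult_group m_assoc)
  qed
  have one: "tact \<one> x = x" if "x \<in> TV v" for x
    using TVD[OF that] by (auto simp: tact_cos)
  have TE: "(tact h x, tact h y) \<in> TE v" if "h \<in> carrier P" "(x, y) \<in> TE v" for h x y
  proof -
    from that(2) obtain i g where xy: "x = cos v i g" "y = cos v (\<not> i) g" "g \<in> carrier P" unfolding TE_def by blast
    have "(tact h x, tact h y) = (cos v i (g \<otimes> inv h), cos v (\<not> i) (g \<otimes> inv h))"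
      using xy that(1) by (simp add: tact_cos)
    moreover have "g \<otimes> inv h \<in> carrier P" using xy that(1) by simp
    ultimately show ?thesis unfolding TE_def by blast
  qed
  have pw: "(tact h x, tact h y) \<in> TE v ^^ n" if "h \<in> carrier P" "(x, y) \<in> TE v ^^ n" for h x y n
    using that(2)
  proof (induction n arbitrary: y)
    case (Suc n)
    then obtain z where z: "(x, z) \<in> TE v ^^ n" "(z, y) \<in> TE v" by auto
    show ?case by (rule relpow_Suc_I[OF Suc.IH[OF z(1)] TE[OF that(1) z(2)]])
  qed simp
  have le: "T.D (tact h x) (tact h y) \<le> T.D x y" if "h \<in> carrier P" "x \<in> TV v" "y \<in> TV v" for h x y
    by (rule T.D_le[OF pw[OF that(1) T.D_path[OF that(2,3)]]])
  have iso: "T.D (tact h x) (tact h y) = T.D x y" if h: "h \<in> carrier P" and xy: "x \<in> TV v" "y \<in> TV v" for h x y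
  proof (rule antisym)
    have "tact (inv h) (tact h z) = z" if "z \<in> TV v" for z
      using mult[of "inv h" h z] h that one by simp
    then show "T.D x y \<le> T.D (tact h x) (tact h y)"
      using le[of "inv h" "tact h x" "tact h y"] h cl xy by simp
  qed (rule le[OF h xy])
  \<comment> \<open>The action preserves the side of a coset and therefore the parity of its
    level.\<close>
  have ev: "even (T.D x (tact h x))" if "h \<in> carrier P" "x \<in> TV v" for h x
  proof -
    have par: "even (lev v z) \<longleftrightarrow> \<not> fst z" for z by (simp add: lev_def)
    have "even (T.D x (tact h x) + lev v x + lev v (tact h x))"
      by (rule T.lev_parity[OF T.D_path[OF that(2) cl[OF that]]])
    then show ?thesis using par[of x] par[of "tact h x"] by (cases "fst x") (simp_all add: tact_def)
  qed
  interpret tree "TV v" T.D by (rule T.tree)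
  show ?thesis
    by unfold_locales ((rule cl mult one iso ev; assumption)+)
qed

text \<open>Fixing a vertex of the tree, expressed by conjugation into one of the two factors (see
  \<open>Fix_ell\<close>), so that later arguments need not mention the tree.\<close>

definition ell :: "'v \<Rightarrow> 'g set \<Rightarrow> bool" where
  "ell v S \<longleftrightarrow> (\<exists>g\<in>carrier P. cj g ` S \<subseteq> par (st v) \<or> cj g ` S \<subseteq> par (- {v}))"

lemma ell_mono: "ell v S \<Longrightarrow> S' \<subseteq> S \<Longrightarrow> ell v S'"
  unfolding ell_def by (meson image_mono order_trans)

lemma Fix_ell:
  assumes v: "v \<in> V" and S: "S \<subseteq> carrier P"
  shows "tree_action.Fix (TV v) tact S \<noteq> {} \<longleftrightarrow> ell v S"
proof -
  interpret tree_action "TV v" "rooted_tree.D (TE v)" P tact by (rule tree_action_T[OF v])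
  have *: "cos v i g \<in> Fix S \<longleftrightarrow> cj g ` S \<subseteq> side v i" if g: "g \<in> carrier P" for i g
  proof -
    have "cos v i g \<in> TV v" using g unfolding TV_def by blast
    moreover have "tact s (cos v i g) = cos v i g \<longleftrightarrow> cj g s \<in> side v i" if "s \<in> S" for s
      using tact_fix_iff[OF g, of s] that S by blast
    ultimately show ?thesis unfolding Fix_def by auto
  qed
  show ?thesis
  proof
    assume "Fix S \<noteq> {}"
    then obtain x where x: "x \<in> Fix S" by blast
    then have "x \<in> TV v" by (simp add: Fix_def)
    then obtain i g where "x = cos v i g" "g \<in> carrier P" unfolding TV_def by blast
    then show "ell v S" using * x unfolding ell_def side_def by (cases i) auto
  next
    assume "ell v S"
    then obtain g where g: "g \<in> carrier P" "cj g ` S \<subseteq> side v True \<or> cj g ` S \<subseteq> side v False"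
      unfolding ell_def side_def by auto
    then show "Fix S \<noteq> {}" using *[OF g(1)] by blast
  qed
qed

text \<open>The conjugator comes from the edge alone and serves all elements fixing it.\<close>

lemma edge_fix:
  assumes v: "v \<in> V" and S: "S \<subseteq> carrier P"
    and xy: "x \<in> TV v" "y \<in> TV v" "rooted_tree.D (TE v) x y = 1"
  shows "\<exists>g\<in>carrier P. \<forall>s\<in>carrier P. {x, y} \<subseteq> tree_action.Fix (TV v) tact {s} \<longrightarrow> cj g s \<in> par (lk v)"
proof -
  interpret T: rooted_tree "TV v" "TE v" "lev v" "cos v False \<one>" by (rule rooted_tree_T[OF v])
  interpret tree_action "TV v" T.D P tact by (rule tree_action_T[OF v])
  have "(x, y) \<in> TE v" using T.D_1[OF xy(1,2)] xy(3) by blast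
  then obtain i g where g: "x = cos v i g" "y = cos v (\<not> i) g" "g \<in> carrier P" unfolding TE_def by blast
  have "cj g s \<in> par (lk v)" if s: "s \<in> carrier P" "{x, y} \<subseteq> Fix {s}" for s
  proof -
    have "cj g s \<in> side v i" "cj g s \<in> side v (\<not> i)"
      using s g tact_fix_iff[OF g(3) s(1)] by (auto simp: Fix_def)
    then show ?thesis using side_Int[of v] by (cases i) auto
  qed
  then show ?thesis using g(3) by blast
qed

text \<open>Elements commuting with \<open>a\<close> all preserve its axis, so one edge of the axis,
  and with it one conjugator \<open>g\<close>, serves every \<open>b\<close>.\<close>

lemma nonelliptic_centralizer:
  assumes v: "v \<in> V" and a: "a \<in> carrier P" "\<not> ell v {a}"
  obtains g where "g \<in> carrier P"
    "\<And>b. b \<in> carrier P \<Longrightarrow> b \<otimes> a = a \<otimes> b \<Longrightarrow> b \<noteq> \<one> \<Longrightarrow>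
      \<exists>(n::nat) (m::int). b [^] n \<noteq> \<one> \<and> cj g (b [^] n \<otimes> a [^] m) \<in> par (lk v)"
proof -
  interpret tree_action "TV v" "rooted_tree.D (TE v)" P tact by (rule tree_action_T[OF v])
  have "Fix {a} = {}" using Fix_ell[OF v, of "{a}"] a by simp
  then have nofix: "tact a x \<noteq> x" if "x \<in> TV v" for x using that unfolding Fix_def by blast
  have ne: "TV v \<noteq> {}" unfolding TV_def by blast
  have "\<exists>x y. x \<in> TV v \<and> y \<in> TV v \<and> rooted_tree.D (TE v) x y = 1 \<and>
      (\<forall>b\<in>carrier P. b \<otimes> a = a \<otimes> b \<longrightarrow> b \<noteq> \<one> \<longrightarrow>
        (\<exists>(n::nat) (m::int). b [^] n \<noteq> \<one> \<and> {x, y} \<subseteq> Fix {b [^] n \<otimes> a [^] m}))"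
  proof (rule commuting_fix_axis_edge[OF a(1) nofix ne])
    fix x y assume xy: "x \<in> TV v" "y \<in> TV v" "rooted_tree.D (TE v) x y = 1"
      and b: "\<And>b. b \<in> carrier P \<Longrightarrow> b \<otimes> a = a \<otimes> b \<Longrightarrow> b \<noteq> \<one> \<Longrightarrow>
        \<exists>(n::nat) (m::int). b [^] n \<noteq> \<one> \<and> {x, y} \<subseteq> Fix {b [^] n \<otimes> a [^] m}"
    then show ?thesis by (intro exI[of _ x] exI[of _ y] conjI ballI impI xy b)
  qed
  then obtain x y where xy: "x \<in> TV v" "y \<in> TV v" "rooted_tree.D (TE v) x y = 1"
    and b: "\<forall>b\<in>carrier P. b \<otimes> a = a \<otimes> b \<longrightarrow> b \<noteq> \<one> \<longrightarrow>
        (\<exists>(n::nat) (m::int). b [^] n \<noteq> \<one> \<and> {x, y} \<subseteq> Fix {b [^] n \<otimes> a [^] m})" by blast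
  from edge_fix[OF v empty_subsetI xy]
  obtain g where g: "g \<in> carrier P" "\<forall>s\<in>carrier P. {x, y} \<subseteq> Fix {s} \<longrightarrow> cj g s \<in> par (lk v)" by (elim bexE)
  show thesis
  proof (rule that[OF g(1)])
    fix c assume c: "c \<in> carrier P" "c \<otimes> a = a \<otimes> c" "c \<noteq> \<one>"
    obtain n :: nat and m :: int where nm: "c [^] n \<noteq> \<one>" "{x, y} \<subseteq> Fix {c [^] n \<otimes> a [^] m}" using b c by blast
    have "cj g (c [^] n \<otimes> a [^] m) \<in> par (lk v)" by (rule mp[OF bspec[OF g(2)] nm(2)]) (use c a in simp)
    then show "\<exists>(n::nat) (m::int). c [^] n \<noteq> \<one> \<and> cj g (c [^] n \<otimes> a [^] m) \<in> par (lk v)"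
      by (intro exI[of _ n] exI[of _ m] conjI[OF nm(1)])
  qed
qed

lemma elliptic_or_edge:
  assumes v: "v \<in> V" and S: "finite S" "S \<subseteq> carrier P" "\<And>s. s \<in> S \<Longrightarrow> ell v {s}" and A: "A \<subseteq> carrier P"
    and comm: "\<And>a s. a \<in> A \<Longrightarrow> s \<in> S \<Longrightarrow> a \<otimes> s = s \<otimes> a"
  shows "ell v A \<or> (\<exists>g\<in>carrier P. cj g ` S \<subseteq> par (lk v))"
proof -
  interpret tree_action "TV v" "rooted_tree.D (TE v)" P tact by (rule tree_action_T[OF v])
  have ne: "TV v \<noteq> {}" unfolding TV_def by blast
  have "Fix {s} \<noteq> {}" if "s \<in> S" for s using Fix_ell[OF v, of "{s}"] S(2) S(3)[OF that] that by auto
  from fix_or_common_fix[OF S(1,2) this A comm ne] consider "Fix A \<noteq> {}" | "Fix S \<noteq> {}" by blast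
  then show ?thesis
  proof cases
    case 1
    then show ?thesis using Fix_ell[OF v A] by blast
  next
    case 2
    consider "Fix A \<noteq> {}" | x y where "x \<in> Fix S" "y \<in> Fix S" "rooted_tree.D (TE v) x y = 1"
      using fix_or_edge[OF S(2) A comm 2] by blast
    then show ?thesis
    proof cases
      case 1
      then show ?thesis using Fix_ell[OF v A] by blast
    next
      case (2 x y)
      have X: "x \<in> TV v" "y \<in> TV v" using 2 by (auto simp: Fix_def)
      from edge_fix[OF v S(2) X 2(3)]
      obtain g where g: "g \<in> carrier P" "\<forall>s\<in>carrier P. {x, y} \<subseteq> Fix {s} \<longrightarrow> cj g s \<in> par (lk v)" by (elim bexE)
      have "cj g s \<in> par (lk v)" if s: "s \<in> S" for s
      proof (rule mp[OF bspec[OF g(2)]])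
        show "s \<in> carrier P" using s S(2) by blast
        show "{x, y} \<subseteq> Fix {s}" using 2(1,2) s unfolding Fix_def by simp
      qed
      then have "cj g ` S \<subseteq> par (lk v)" by (rule image_subsetI)
      then show ?thesis using g(1) by blast
    qed
  qed
qed

text \<open>\<open>B\<close> preserves the convex set \<open>Fix A\<close>, so the projection to it
  of a fixed point of \<open>B\<close> is fixed by both.\<close>

lemma ell_commuting:
  assumes v: "v \<in> V" and XY: "A \<subseteq> carrier P" "B \<subseteq> carrier P" "ell v A" "ell v B"
    and comm: "\<And>a b. a \<in> A \<Longrightarrow> b \<in> B \<Longrightarrow> b \<otimes> a = a \<otimes> b"
  shows "ell v (A \<union> B)"
proof -
  interpret tree_action "TV v" "rooted_tree.D (TE v)" P tact by (rule tree_action_T[OF v])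
  have A: "Fix A \<noteq> {}" "conv (Fix A)" using Fix_ell[OF v XY(1)] XY(3) conv_Fix[OF XY(1)] by auto
  obtain z where z: "z \<in> Fix B" using Fix_ell[OF v XY(2)] XY(4) by blast
  obtain c where c: "c \<in> Fix A" "\<And>b. b \<in> B \<Longrightarrow> tact b c = c"
  proof (rule fix_nearest[OF A(2,1) _ XY(2), of z])
    show "z \<in> TV v" using z by (simp add: Fix_def)
    show "tact b x \<in> Fix A" if "b \<in> B" "x \<in> Fix A" for b x
      by (rule Fix_commuting[OF XY(1) _ _ that(2)]) (use that comm XY(2) in auto)
    show "tact b z = z" if "b \<in> B" for b using z that by (simp add: Fix_def)
  qed blast
  then have "Fix (A \<union> B) \<noteq> {}" unfolding Fix_def by blast
  then show ?thesis using Fix_ell[OF v, of "A \<union> B"] XY(1,2) by simp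
qed


section \<open>Irreducible centralizers are elliptic\<close>

lemma K_iso: "u \<in> V \<Longrightarrow> G u \<cong> P\<lparr>carrier := K u\<rparr>"
proof -
  assume u: "u \<in> V"
  have "\<iota> u \<in> hom (G u) (P\<lparr>carrier := K u\<rparr>)"
    using \<iota>_hom[OF u] by (auto simp: hom_def K_def)
  moreover have "bij_betw (\<iota> u) (carrier (G u)) (K u)"
    using \<iota>_inj[OF u] by (simp add: bij_betw_def K_def)
  ultimately show ?thesis by (auto simp: is_iso_def iso_def)
qed

lemma perp_disjoint: "\<Theta> \<inter> perp \<Theta> = {}"
  using adj_irrefl by (auto simp: perp_def)

text \<open>
  A subgroup between \<open>par (perp \<Theta>)\<close> and \<open>par (\<Theta> \<union> perp \<Theta>)\<close> is the direct product of
  \<open>par (perp \<Theta>)\<close> with its intersection with \<open>par \<Theta>\<close>, so it is a graph product over the cone over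
  \<open>perp \<Theta>\<close>, or over \<open>perp \<Theta>\<close> itself if that intersection is trivial.
\<close>

lemma irreducible_perp:
  fixes L :: "'k monoid"
  assumes L: "group L" "graphically_irreducible L" and A: "subgroup A P" "L \<cong> P\<lparr>carrier := A\<rparr>"
    and sub: "par (perp \<Theta>) \<subseteq> A" "A \<subseteq> par (\<Theta> \<union> perp \<Theta>)"
    and ut: "u \<in> perp \<Theta>" "t \<in> perp \<Theta>" "u \<noteq> t"
  shows "adj u t"
proof -
  define Q where "Q = A \<inter> par \<Theta>"
  define T where "T \<longleftrightarrow> Q = {\<one>}"
  have Q_sub: "subgroup Q P" unfolding Q_def by (rule subgroups_Inter_pair[OF A(1) par_subgroup])
  define \<Delta> :: "'v option sgraph" where
    "\<Delta> = \<lparr>verts = Some ` perp \<Theta> \<union> (if T then {} else {None}),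
      edges = {{Some u, Some t} | u t. u \<in> perp \<Theta> \<and> t \<in> perp \<Theta> \<and> adj u t} \<union>
        (if T then {} else {{None, Some u} | u. u \<in> perp \<Theta>})\<rparr>"
  define G' where "G' x = P\<lparr>carrier := (case x of None \<Rightarrow> Q | Some u \<Rightarrow> K u)\<rparr>" for x
  have perpV: "u \<in> V" if "u \<in> perp \<Theta>" for u using that by (simp add: perp_def)
  have G'c: "carrier (G' (Some u)) = K u" "carrier (G' None) = Q" for u by (simp_all add: G'_def)
  have \<Delta>: "simplicial_graph \<Delta>"
    unfolding simplicial_graph_def \<Delta>_def using adjD(3) by (auto simp: card_insert_if)
  have grpG': "group (G' x)" if "x \<in> verts \<Delta>" for x
    using that subgroup.subgroup_is_group[OF Q_sub is_group]
      subgroup.subgroup_is_group[OF K_subgroup[OF perpV] is_group]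
    by (auto simp: \<Delta>_def G'_def split: if_splits)
  have "carrier (G' x) \<noteq> {\<one>\<^bsub>G' x\<^esub>}" if x: "x \<in> verts \<Delta>" for x
  proof (cases x)
    case None
    then have "\<not> T" using x by (auto simp: \<Delta>_def split: if_splits)
    then show ?thesis using None by (simp add: G'_def T_def)
  next
    case (Some w)
    then have "w \<in> V" using x perpV by (auto simp: \<Delta>_def split: if_splits)
    then show ?thesis using K_nontrivial[of w] Some by (auto simp: G'_def)
  qed
  then have vg: "vertex_groups \<Delta> G'" using grpG' by (simp add: vertex_groups_def)
  have grp': "\<forall>x\<in>verts \<Delta>. group (G' x)" using grpG' by blast
  let ?R = "graph_product \<Delta> G'"
  interpret R: group ?R by (rule group_graph_product[OF \<Delta> grp'])
  let ?i = "vertex_incl \<Delta> G'"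
  have i_hom: "?i x \<in> hom (G' x) ?R" if "x \<in> verts \<Delta>" for x by (rule vertex_incl_hom[OF \<Delta> grp' that])
  have SomeV: "Some u \<in> verts \<Delta>" if "u \<in> perp \<Theta>" for u using that by (simp add: \<Delta>_def)
  have NoneV: "None \<in> verts \<Delta>" if "\<not> T" using that by (simp add: \<Delta>_def)
  have edge_S: "{Some u, Some t} \<in> edges \<Delta> \<longleftrightarrow> u \<in> perp \<Theta> \<and> t \<in> perp \<Theta> \<and> adj u t" for u t
    using adj_sym[of u t] by (auto simp: \<Delta>_def doubleton_eq_iff)
  have edge_N: "{None, Some u} \<in> edges \<Delta>" if "u \<in> perp \<Theta>" "\<not> T" for u
    using that by (auto simp: \<Delta>_def)
  have iS_closed: "?i (Some u) a \<in> carrier ?R" if "u \<in> perp \<Theta>" "a \<in> K u" for u a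
    using hom_in_carrier[OF i_hom[OF SomeV[OF that(1)]], of a] that(2) by (simp add: G'_def)
  have iN_closed: "?i None q \<in> carrier ?R" if "\<not> T" "q \<in> Q" for q
    using hom_in_carrier[OF i_hom[OF NoneV[OF that(1)]], of q] that(2) by (simp add: G'_def)
  interpret PA: group "P\<lparr>carrier := A\<rparr>" by (rule subgroup.subgroup_is_group[OF A(1) is_group])
  have QP: "q \<in> carrier P" "q \<in> A" "q \<in> par \<Theta>" if "q \<in> Q" for q
    using that subgroup.mem_carrier[OF Q_sub that] by (auto simp: Q_def)
  have KA: "a \<in> A" "a \<in> par (perp \<Theta>)" if "u \<in> perp \<Theta>" "a \<in> K u" for u a
    using K_par[OF perpV[OF that(1)] that(1,2)] sub(1) by auto
  have comm: "q \<otimes> t = t \<otimes> q" if "q \<in> par \<Theta>" "t \<in> par (perp \<Theta>)" for q t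
    by (rule par_commute[OF that]) (simp add: perp_def)

  obtain j where j: "j \<in> hom ?R (P\<lparr>carrier := A\<rparr>)"
    "\<And>x k. x \<in> verts \<Delta> \<Longrightarrow> k \<in> carrier (G' x) \<Longrightarrow> j (?i x k) = k"
  proof (rule graph_product_universal[OF \<Delta> grp' PA.is_group, of "\<lambda>x k. k"])
    show "(\<lambda>k. k) \<in> hom (G' x) (P\<lparr>carrier := A\<rparr>)" if "x \<in> verts \<Delta>" for x
      using that QP KA by (auto simp: hom_def G'_def \<Delta>_def split: if_splits)
    fix x y k l assume e: "{x, y} \<in> edges \<Delta>" and k: "k \<in> carrier (G' x)" and l: "l \<in> carrier (G' y)"
    note xy = simplicial_edgeD[OF \<Delta> e]
    show "k \<otimes>\<^bsub>P\<lparr>carrier := A\<rparr>\<^esub> l = l \<otimes>\<^bsub>P\<lparr>carrier := A\<rparr>\<^esub> k"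
    proof (cases x)
      case None
      then obtain w where w: "y = Some w" using xy(3) by (cases y) auto
      then have "w \<in> perp \<Theta>" using xy(2) by (auto simp: \<Delta>_def split: if_splits)
      then have "l \<in> par (perp \<Theta>)" using KA l w by (simp add: G'_def)
      moreover have "k \<in> par \<Theta>" using k None QP by (simp add: G'_def)
      ultimately show ?thesis using comm by simp
    next
      case (Some w)
      then have w: "w \<in> perp \<Theta>" using xy(1) by (auto simp: \<Delta>_def split: if_splits)
      show ?thesis
      proof (cases y)
        case None
        then have "l \<in> par \<Theta>" using l QP by (simp add: G'_def)
        moreover have "k \<in> par (perp \<Theta>)" using KA w k Some by (simp add: G'_def)
        ultimately show ?thesis using comm by simp
      next
        case (Some z)
        then have "adj w z" using e \<open>x = Some w\<close> edge_S by simp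
        then show ?thesis using K_commute[of w z k l] k l \<open>x = Some w\<close> Some by (simp add: G'_def)
      qed
    qed
  qed blast

  \<comment> \<open>All vertex-groups outside \<open>perp \<Theta>\<close> are killed. The map is
    defined on \<open>P\<close>, where \<open>universal\<close> is available; on \<open>A\<close>
    only the part in \<open>par \<Theta>\<close> is lost.\<close>
  obtain h1 where h1: "h1 \<in> hom P ?R"
    "\<And>u a. u \<in> V \<Longrightarrow> a \<in> K u \<Longrightarrow> h1 a = (if u \<in> perp \<Theta> then ?i (Some u) a else \<one>\<^bsub>?R\<^esub>)"
  proof (rule universal[OF R.is_group, of "\<lambda>u a. if u \<in> perp \<Theta> then ?i (Some u) a else \<one>\<^bsub>?R\<^esub>"])
    show "(\<lambda>a. if u \<in> perp \<Theta> then ?i (Some u) a else \<one>\<^bsub>?R\<^esub>) \<in> hom (P\<lparr>carrier := K u\<rparr>) ?R" if "u \<in> V" for u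
    proof (cases "u \<in> perp \<Theta>")
      case True
      then show ?thesis using i_hom[OF SomeV[OF True]] by (simp add: G'_def)
    next
      case False
      then show ?thesis by (simp add: hom_def)
    qed
    show "(if u \<in> perp \<Theta> then ?i (Some u) a else \<one>\<^bsub>?R\<^esub>) \<otimes>\<^bsub>?R\<^esub> (if t \<in> perp \<Theta> then ?i (Some t) b else \<one>\<^bsub>?R\<^esub>) =
        (if t \<in> perp \<Theta> then ?i (Some t) b else \<one>\<^bsub>?R\<^esub>) \<otimes>\<^bsub>?R\<^esub> (if u \<in> perp \<Theta> then ?i (Some u) a else \<one>\<^bsub>?R\<^esub>)"
      if "adj u t" "a \<in> K u" "b \<in> K t" for u t a b
    proof (cases "u \<in> perp \<Theta> \<and> t \<in> perp \<Theta>")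
      case True
      then have "{Some u, Some t} \<in> edges \<Delta>" using edge_S that(1) by simp
      from vertex_incl_commute[OF \<Delta> grp' this, of a b] show ?thesis using True that(2,3) by (simp add: G'c)
    next
      case False
      then show ?thesis using iS_closed that(2,3) by auto
    qed
  qed blast
  have h1c: "h1 x \<in> carrier ?R" if "x \<in> carrier P" for x using hom_in_carrier[OF h1(1) that] .
  have h1m: "h1 (x \<otimes> y) = h1 x \<otimes>\<^bsub>?R\<^esub> h1 y" if "x \<in> carrier P" "y \<in> carrier P" for x y
    by (rule hom_mult[OF h1(1) that])
  have h1_one: "h1 \<one> = \<one>\<^bsub>?R\<^esub>" by (rule hom_one[OF h1(1) is_group R.is_group])
  have h1_Q: "h1 q = \<one>\<^bsub>?R\<^esub>" if "q \<in> par \<Theta>" for q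
    using that
  proof (induction q rule: par_induct)
    case one
    show ?case by (rule h1_one)
  next
    case (push u a g)
    have "u \<notin> perp \<Theta>" using push.hyps(1) perp_disjoint by blast
    then show ?case
      using h1m[OF K_closed[OF push.hyps(2,3)] par_closed[OF push.hyps(5)]] h1(2)[OF push.hyps(2,3)] push.IH by simp
  qed
  obtain r where r: "r \<in> hom P P" "\<And>x. x \<in> par \<Theta> \<Longrightarrow> r x = x"
    "\<And>x. x \<in> carrier P \<Longrightarrow> r x \<in> par \<Theta>" "\<And>x \<Theta>'. x \<in> par \<Theta>' \<Longrightarrow> \<Theta> \<inter> \<Theta>' = {} \<Longrightarrow> r x = \<one>"
    by (rule retraction[of \<Theta>]) blast
  \<comment> \<open>Both factors stay in \<open>A\<close> since
    \<open>par (perp \<Theta>) \<subseteq> A\<close>, and the retraction \<open>r\<close> computes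
    the first one.\<close>
  have dec: "\<exists>q\<in>Q. \<exists>y\<in>par (perp \<Theta>). x = q \<otimes> y \<and> r x = q" if x: "x \<in> A" for x
  proof -
    have "x \<in> par (\<Theta> \<union> perp \<Theta>)" using x sub(2) by blast
    then have "\<exists>q\<in>par \<Theta>. \<exists>y\<in>par (perp \<Theta>). x = q \<otimes> y" by (rule par_Un_decomp) (simp add: perp_def)
    then obtain q y where qy: "q \<in> par \<Theta>" "y \<in> par (perp \<Theta>)" "x = q \<otimes> y" by (elim bexE)
    note cl = par_closed[OF qy(1)] par_closed[OF qy(2)]
    have yA: "y \<in> A" using qy(2) sub(1) by blast
    have "q = x \<otimes> inv y" using qy(3) cl by (simp add: m_assoc)
    then have "q \<in> A" using subgroup.m_closed[OF A(1) x subgroup.m_inv_closed[OF A(1) yA]] by simp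
    then have "q \<in> Q" using qy(1) by (simp add: Q_def)
    moreover have "r x = q"
      using hom_mult[OF r(1) cl] r(2)[OF qy(1)] r(4)[OF qy(2) perp_disjoint] cl by (simp add: qy(3))
    ultimately show ?thesis by (intro bexI[of _ q] bexI[of _ y] conjI qy(2,3))
  qed
  have rQ: "r x \<in> Q" if "x \<in> A" for x using dec[OF that] by auto
  have AP: "x \<in> carrier P" if "x \<in> A" for x by (rule subgroup.mem_carrier[OF A(1) that])
  define h2 where "h2 x = (if T then \<one>\<^bsub>?R\<^esub> else ?i None (r x))" for x
  have h2c: "h2 x \<in> carrier ?R" if "x \<in> A" for x
    using iN_closed rQ[OF that] by (simp add: h2_def)
  have h2m: "h2 (x \<otimes> y) = h2 x \<otimes>\<^bsub>?R\<^esub> h2 y" if "x \<in> A" "y \<in> A" for x y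
  proof (cases T)
    case True
    then show ?thesis by (simp add: h2_def)
  next
    case False
    have "r (x \<otimes> y) = r x \<otimes> r y" by (rule hom_mult[OF r(1) AP[OF that(1)] AP[OF that(2)]])
    then show ?thesis
      using hom_mult[OF i_hom[OF NoneV[OF False]], of "r x" "r y"] rQ that False by (simp add: h2_def G'_def)
  qed
  have h2h1: "h2 x \<otimes>\<^bsub>?R\<^esub> h1 y = h1 y \<otimes>\<^bsub>?R\<^esub> h2 x" if x: "x \<in> A" and y: "y \<in> carrier P" for x y
    using y
  proof (rule gen_induct)
    show "h2 x \<otimes>\<^bsub>?R\<^esub> h1 \<one> = h1 \<one> \<otimes>\<^bsub>?R\<^esub> h2 x" using h2c[OF x] h1_one by simp
    fix u a y assume u: "u \<in> V" "a \<in> K u" and y: "y \<in> carrier P" and IH: "h2 x \<otimes>\<^bsub>?R\<^esub> h1 y = h1 y \<otimes>\<^bsub>?R\<^esub> h2 x"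
    have ac: "a \<in> carrier P" by (rule K_closed[OF u])
    have c: "h2 x \<otimes>\<^bsub>?R\<^esub> h1 a = h1 a \<otimes>\<^bsub>?R\<^esub> h2 x"
    proof (cases "u \<in> perp \<Theta> \<and> \<not> T")
      case True
      then have "{None, Some u} \<in> edges \<Delta>" using edge_N by simp
      from vertex_incl_commute[OF \<Delta> grp' this, of "r x" a] show ?thesis
        using True u rQ[OF x] h1(2)[OF u] by (simp add: G'c h2_def)
    next
      case False
      then show ?thesis using h2c[OF x] h1(2)[OF u] h1c[OF ac] by (auto simp: h2_def)
    qed
    note cl = h2c[OF x] h1c[OF ac] h1c[OF y]
    have "h2 x \<otimes>\<^bsub>?R\<^esub> (h1 a \<otimes>\<^bsub>?R\<^esub> h1 y) = (h1 a \<otimes>\<^bsub>?R\<^esub> h2 x) \<otimes>\<^bsub>?R\<^esub> h1 y"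
      unfolding c[symmetric] using cl by (simp add: R.m_assoc)
    also have "\<dots> = h1 a \<otimes>\<^bsub>?R\<^esub> (h1 y \<otimes>\<^bsub>?R\<^esub> h2 x)" unfolding IH[symmetric] using cl by (simp add: R.m_assoc)
    finally show "h2 x \<otimes>\<^bsub>?R\<^esub> h1 (a \<otimes> y) = h1 (a \<otimes> y) \<otimes>\<^bsub>?R\<^esub> h2 x"
      unfolding h1m[OF ac y] using cl by (simp add: R.m_assoc)
  qed
  \<comment> \<open>The inverse of \<open>j\<close> in coordinates: \<open>h2\<close> records the
    part in \<open>Q\<close> at the apex \<open>None\<close>, and \<open>h1\<close> the part in
    \<open>par (perp \<Theta>)\<close>.\<close>
  define h where "h x = h2 x \<otimes>\<^bsub>?R\<^esub> h1 x" for x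
  have h_hom: "h \<in> hom (P\<lparr>carrier := A\<rparr>) ?R"
  proof (rule homI)
    fix x y assume "x \<in> carrier (P\<lparr>carrier := A\<rparr>)" "y \<in> carrier (P\<lparr>carrier := A\<rparr>)"
    then have xy: "x \<in> A" "y \<in> A" by auto
    note cl = h2c[OF xy(1)] h2c[OF xy(2)] h1c[OF AP[OF xy(1)]] h1c[OF AP[OF xy(2)]]
    show "h x \<in> carrier ?R" using cl by (simp add: h_def)
    have "h (x \<otimes> y) = h2 x \<otimes>\<^bsub>?R\<^esub> (h2 y \<otimes>\<^bsub>?R\<^esub> h1 x) \<otimes>\<^bsub>?R\<^esub> h1 y"
      unfolding h_def h2m[OF xy] h1m[OF AP[OF xy(1)] AP[OF xy(2)]] using cl by (simp add: R.m_assoc)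
    also have "\<dots> = h x \<otimes>\<^bsub>?R\<^esub> h y"
      unfolding h2h1[OF xy(2) AP[OF xy(1)]] h_def using cl by (simp add: R.m_assoc)
    finally show "h (x \<otimes>\<^bsub>P\<lparr>carrier := A\<rparr>\<^esub> y) = h x \<otimes>\<^bsub>?R\<^esub> h y" by simp
  qed
  have j_one: "j \<one>\<^bsub>?R\<^esub> = \<one>" using hom_one[OF j(1) R.is_group PA.is_group] by simp
  have jm: "j (x \<otimes>\<^bsub>?R\<^esub> y) = j x \<otimes> j y" if "x \<in> carrier ?R" "y \<in> carrier ?R" for x y
    using hom_mult[OF j(1) that] by simp
  have jh1: "j (h1 y) = y" if "y \<in> par (perp \<Theta>)" for y
    using that
  proof (induction y rule: par_induct)
    case one
    show ?case using h1_one j_one by simp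
  next
    case (push u a g)
    have "j (h1 a) = a"
      using h1(2)[OF push.hyps(2,3)] push.hyps(1,3) j(2)[OF SomeV[OF push.hyps(1)], of a] by (simp add: G'_def)
    then show ?case
      using h1m[OF K_closed[OF push.hyps(2,3)] par_closed[OF push.hyps(5)]] push.IH
        jm[OF h1c[OF K_closed[OF push.hyps(2,3)]] h1c[OF par_closed[OF push.hyps(5)]]] by simp
  qed
  have jh: "j (h x) = x" if x: "x \<in> A" for x
  proof -
    obtain q y where qy: "q \<in> Q" "y \<in> par (perp \<Theta>)" "x = q \<otimes> y" "r x = q" using dec[OF x] by blast
    have "j (h2 x) = q"
    proof (cases T)
      case True
      then show ?thesis using qy(1) j_one by (simp add: h2_def T_def)
    next
      case False
      then show ?thesis using j(2)[OF NoneV[OF False], of q] qy(1,4) by (simp add: h2_def G'_def)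
    qed
    moreover have "h1 x = h1 y"
      unfolding qy(3) using h1m[OF QP(1)[OF qy(1)] par_closed[OF qy(2)]] h1_Q[OF QP(3)[OF qy(1)]]
        h1c[OF par_closed[OF qy(2)]] by simp
    ultimately show ?thesis
      unfolding h_def using jm[OF h2c[OF x] h1c[OF AP[OF x]]] jh1[OF qy(2)] qy(3) by simp
  qed
  have hj: "h (j y) = y" if y: "y \<in> carrier ?R" for y
  proof -
    have "(h \<circ> j) y = (\<lambda>y. y) y"
    proof (rule graph_product_hom_eq[OF \<Delta> grp' R.is_group Group.hom_compose[OF j(1) h_hom] _ _ y])
      show "(\<lambda>y. y) \<in> hom ?R ?R" by (auto simp: hom_def)
      fix x k assume x: "x \<in> verts \<Delta>" and k: "k \<in> carrier (G' x)"
      have "h k = ?i x k"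
      proof (cases x)
        case None
        then have nT: "\<not> T" using x by (auto simp: \<Delta>_def split: if_splits)
        have kQ: "k \<in> Q" using k None by (simp add: G'_def)
        then show ?thesis
          using h1_Q[OF QP(3)[OF kQ]] r(2)[OF QP(3)[OF kQ]] nT iN_closed[OF nT kQ] None by (simp add: h_def h2_def)
      next
        case (Some w)
        then have w: "w \<in> perp \<Theta>" "k \<in> K w" using x k by (auto simp: \<Delta>_def G'_def split: if_splits)
        have "r k = \<one>" by (rule r(4)[OF KA(2)[OF w] perp_disjoint])
        moreover have "?i None \<one> = \<one>\<^bsub>?R\<^esub>" if "\<not> T"
          using hom_one[OF i_hom[OF NoneV[OF that]] grpG'[OF NoneV[OF that]] R.is_group] by (simp add: G'_def)
        ultimately show ?thesis
          using h1(2)[OF perpV[OF w(1)] w(2)] w iS_closed[OF w] Some by (simp add: h_def h2_def)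
      qed
      then show "(h \<circ> j) (?i x k) = ?i x k" using j(2)[OF x k] by simp
    qed
    then show ?thesis by simp
  qed
  have "bij_betw h A (carrier ?R)"
    by (rule bij_betw_byWitness[where f' = j])
      (use jh hj hom_in_carrier[OF j(1)] hom_in_carrier[OF h_hom] in auto)
  then have "P\<lparr>carrier := A\<rparr> \<cong> ?R" using h_hom by (auto simp: is_iso_def iso_def)
  then have "L \<cong> ?R" by (rule iso_trans[OF A(2)])
  then have "complete_graph \<Delta>"
    by (rule graphically_irreducible_complete[OF L \<Delta> vg])
  then have "{Some u, Some t} \<in> edges \<Delta>"
    unfolding complete_graph_def using SomeV[OF ut(1)] SomeV[OF ut(2)] ut(3) by blast
  then show ?thesis using edge_S by blast
qed

lemma cj_iso:
  assumes "subgroup A P" "g \<in> carrier P"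
  shows "subgroup (cj g ` A) P" "P\<lparr>carrier := A\<rparr> \<cong> P\<lparr>carrier := cj g ` A\<rparr>"
proof -
  have AP: "x \<in> carrier P" if "x \<in> A" for x by (rule subgroup.mem_carrier[OF assms(1) that])
  show "subgroup (cj g ` A) P"
  proof (rule subgroupI)
    show "cj g ` A \<subseteq> carrier P" using AP assms(2) by auto
    show "cj g ` A \<noteq> {}" using subgroup.one_closed[OF assms(1)] by blast
    show "inv x \<in> cj g ` A" if "x \<in> cj g ` A" for x
    proof -
      from that obtain y where y: "y \<in> A" "x = cj g y" by blast
      then have "inv x = cj g (inv y)" using cj_of_inv[OF assms(2) AP[OF y(1)]] by simp
      then show ?thesis using subgroup.m_inv_closed[OF assms(1) y(1)] by simp
    qed
    show "x \<otimes> y \<in> cj g ` A" if "x \<in> cj g ` A" "y \<in> cj g ` A" for x y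
    proof -
      from that obtain x' y' where xy: "x' \<in> A" "x = cj g x'" "y' \<in> A" "y = cj g y'" by blast
      then have "x \<otimes> y = cj g (x' \<otimes> y')" using cj_mult[OF assms(2) AP AP] by simp
      then show ?thesis using subgroup.m_closed[OF assms(1) xy(1,3)] by simp
    qed
  qed
  have "cj g \<in> hom (P\<lparr>carrier := A\<rparr>) (P\<lparr>carrier := cj g ` A\<rparr>)"
    using cj_mult[OF assms(2) AP AP] by (auto simp: hom_def)
  moreover have "bij_betw (cj g) A (cj g ` A)"
    using AP cj_eq_iff[OF assms(2)] by (auto simp: bij_betw_def inj_on_def)
  ultimately show "P\<lparr>carrier := A\<rparr> \<cong> P\<lparr>carrier := cj g ` A\<rparr>" by (auto simp: is_iso_def iso_def)
qed

lemma centralizer_conj: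
  assumes "g \<in> carrier P" "x \<in> carrier P" "s \<in> carrier P" "x \<otimes> cj g s = cj g s \<otimes> x"
  shows "cj (inv g) x \<otimes> s = s \<otimes> cj (inv g) x"
  using cj_commute_iff[of "inv g" x "cj g s"] assms by simp

lemma lk_verts: "lk v \<subseteq> V"
  using adjD(2) by (auto simp: lk_def)

text \<open>\<open>\<Theta>\<close> can be found inside \<open>lk v\<close>, so \<open>v\<close>
  itself belongs to \<open>perp \<Theta>\<close>. By \<open>irreducible_perp\<close> the other
  vertices of \<open>perp \<Theta>\<close> are adjacent to \<open>v\<close>; hence
  \<open>\<Theta> \<union> perp \<Theta> \<subseteq> st v\<close>, and a conjugate of
  \<open>A\<close> lies in \<open>par (st v)\<close>.\<close>

lemma irreducible_centralizer_elliptic: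
  fixes L :: "'k monoid"
  assumes v: "v \<in> V" and L: "group L" "graphically_irreducible L" "L \<cong> P\<lparr>carrier := A\<rparr>"
    and A: "subgroup A P" and S: "S \<subseteq> carrier P"
    and cent: "\<And>x. x \<in> carrier P \<Longrightarrow> x \<in> A \<longleftrightarrow> (\<forall>s\<in>S. x \<otimes> s = s \<otimes> x)"
    and g: "g \<in> carrier P" "cj g ` S \<subseteq> par (lk v)"
  shows "ell v A"
proof -
  obtain g' \<Theta> where g': "g' \<in> carrier P" "\<Theta> \<subseteq> lk v" "cj g' ` S \<subseteq> par \<Theta>"
    and C: "\<And>x. x \<in> carrier P \<Longrightarrow> (\<And>s. s \<in> S \<Longrightarrow> x \<otimes> s = s \<otimes> x) \<Longrightarrow> cj g' x \<in> par (\<Theta> \<union> perp \<Theta>)"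
    by (rule minimal_parabolic_centralizer[OF S g lk_verts]) blast
  have AP: "x \<in> carrier P" if "x \<in> A" for x by (rule subgroup.mem_carrier[OF A that])
  have up: "cj g' ` A \<subseteq> par (\<Theta> \<union> perp \<Theta>)"
  proof (rule image_subsetI)
    fix x assume x: "x \<in> A"
    show "cj g' x \<in> par (\<Theta> \<union> perp \<Theta>)" by (rule C[OF AP[OF x]]) (use cent[OF AP[OF x]] x in blast)
  qed
  have low: "par (perp \<Theta>) \<subseteq> cj g' ` A"
  proof
    fix y assume y: "y \<in> par (perp \<Theta>)"
    have yc: "y \<in> carrier P" by (rule par_closed[OF y])
    have "cj (inv g') y \<otimes> s = s \<otimes> cj (inv g') y" if s: "s \<in> S" for s
    proof (rule centralizer_conj[OF g'(1) yc])
      show "s \<in> carrier P" using s S by blast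
      have "cj g' s \<in> par \<Theta>" using g'(3) s by blast
      then show "y \<otimes> cj g' s = cj g' s \<otimes> y"
        by (rule par_commute[OF y]) (use adj_sym in \<open>simp add: perp_def\<close>)
    qed
    then have "cj (inv g') y \<in> A" using cent[of "cj (inv g') y"] g'(1) yc by simp
    moreover have "y = cj g' (cj (inv g') y)" using g'(1) yc by simp
    ultimately show "y \<in> cj g' ` A" by blast
  qed
  have iso: "L \<cong> P\<lparr>carrier := cj g' ` A\<rparr>" by (rule iso_trans[OF L(3) cj_iso(2)[OF A g'(1)]])
  have vp: "v \<in> perp \<Theta>" using v g'(2) adj_sym by (auto simp: perp_def lk_def)
  have "\<Theta> \<union> perp \<Theta> \<subseteq> st v"
  proof
    fix t assume t: "t \<in> \<Theta> \<union> perp \<Theta>"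
    show "t \<in> st v"
    proof (cases "t \<in> \<Theta> \<or> t = v")
      case True
      then show ?thesis using g'(2) by (auto simp: st_def)
    next
      case False
      then have "adj v t"
        using irreducible_perp[OF L(1,2) cj_iso(1)[OF A g'(1)] iso low up vp] t by blast
      then show ?thesis by (simp add: st_def lk_def)
    qed
  qed
  then have "cj g' ` A \<subseteq> par (st v)" using up par_mono by blast
  then show ?thesis unfolding ell_def using g'(1) by blast
qed

end

section \<open>Two graph product decompositions of a group\<close>

context graph_decomp
begin

section \<open>Cliques and conjugates of parabolic subgroups\<close>

definition clique :: "'v set \<Rightarrow> bool" where
  "clique Q \<longleftrightarrow> Q \<subseteq> V \<and> (\<forall>u\<in>Q. \<forall>t\<in>Q. u \<noteq> t \<longrightarrow> adj u t)"

definition max_clique :: "'v set \<Rightarrow> bool" where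
  "max_clique Q \<longleftrightarrow> clique Q \<and> perp Q = {}"

lemma clique_verts: "clique Q \<Longrightarrow> Q \<subseteq> V"
  by (simp add: clique_def)

lemma clique_adj: "clique Q \<Longrightarrow> u \<in> Q \<Longrightarrow> t \<in> Q \<Longrightarrow> u \<noteq> t \<Longrightarrow> adj u t"
  by (simp add: clique_def)

lemma clique_subset: "clique Q \<Longrightarrow> Q' \<subseteq> Q \<Longrightarrow> clique Q'"
  unfolding clique_def by blast

lemma max_clique_eq:
  assumes "max_clique Q" "clique Q'" "Q \<subseteq> Q'"
  shows "Q = Q'"
proof (rule ccontr)
  assume "Q \<noteq> Q'"
  then obtain t where t: "t \<in> Q'" "t \<notin> Q" using assms(3) by blast
  have "adj u t" if "u \<in> Q" for u
    by (rule clique_adj[OF assms(2)]) (use that t assms(3) in auto)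
  then have "t \<in> perp Q" using t(1) clique_verts[OF assms(2)] by (auto simp: perp_def)
  then show False using assms(1) by (simp add: max_clique_def)
qed

lemma max_clique_ex:
  assumes "clique C"
  obtains Q where "max_clique Q" "C \<subseteq> Q"
proof -
  define R where "R Q \<longleftrightarrow> clique Q \<and> C \<subseteq> Q" for Q
  have RC: "R C" using assms by (simp add: R_def)
  have bnd: "\<forall>Q. R Q \<longrightarrow> card Q < Suc (card V)"
    using card_mono[OF fin_verts clique_verts] by (simp add: R_def less_Suc_eq_le)
  from ex_has_greatest_nat[of R C card, OF RC bnd]
  obtain Q where Q: "R Q" "\<forall>Q'. R Q' \<longrightarrow> card Q' \<le> card Q" by blast
  have cl: "clique Q" "C \<subseteq> Q" using Q(1) by (auto simp: R_def)
  have fin: "finite Q" using clique_verts[OF cl(1)] fin_verts finite_subset by blast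
  have "t \<notin> perp Q" for t
  proof
    assume t: "t \<in> perp Q"
    then have tQ: "t \<notin> Q" using perp_disjoint by blast
    have "clique (insert t Q)"
      using cl(1) t adj_sym unfolding clique_def perp_def by auto
    then have "R (insert t Q)" using cl(2) by (auto simp: R_def)
    then have "card (insert t Q) \<le> card Q" using Q(2) by blast
    then show False using tQ fin by simp
  qed
  then have "max_clique Q" using cl(1) by (auto simp: max_clique_def)
  then show thesis using that cl(2) by blast
qed

text \<open>The retraction onto \<open>K u\<close> maps a conjugate of a non-trivial element of
  \<open>K u\<close> to a non-trivial element, but it kills \<open>par \<Theta>'\<close> if
  \<open>u \<notin> \<Theta>'\<close>.\<close>

lemma conj_par_subset:
  assumes x: "x \<in> carrier P" and \<Theta>: "\<Theta> \<subseteq> V" and sub: "cj x ` par \<Theta> \<subseteq> par \<Theta>'"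
  shows "\<Theta> \<subseteq> \<Theta>'"
proof
  fix u assume u: "u \<in> \<Theta>"
  have uV: "u \<in> V" using u \<Theta> by blast
  obtain a where a: "a \<in> K u" "a \<noteq> \<one>" using K_nontrivial[OF uV] by blast
  have ac: "a \<in> carrier P" by (rule K_closed[OF uV a(1)])
  obtain r where r: "r \<in> hom P P" "\<And>x. x \<in> par {u} \<Longrightarrow> r x = x"
    "\<And>x. x \<in> carrier P \<Longrightarrow> r x \<in> par {u}" "\<And>x \<Theta>'. x \<in> par \<Theta>' \<Longrightarrow> {u} \<inter> \<Theta>' = {} \<Longrightarrow> r x = \<one>"
    by (rule retraction[of "{u}"]) blast
  have "cj x a \<in> par \<Theta>'" using sub K_par[OF uV u a(1)] by blast
  interpret r: group_hom P P r by unfold_locales (rule r(1))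
  have "r (cj x a) = cj (r x) (r a)" using x ac by (simp add: cj_def)
  moreover have "r a = a" using r(2) a(1) par_singleton[OF uV] by simp
  ultimately have "r (cj x a) \<noteq> \<one>" using cj_eq_one[OF r.hom_closed[OF x] ac] a(2) by simp
  then show "u \<in> \<Theta>'" using r(4)[OF \<open>cj x a \<in> par \<Theta>'\<close>] by blast
qed

text \<open>Applying the retraction \<open>r\<close> onto \<open>par \<Theta>\<close> shows that
  \<open>x\<close> and \<open>r x\<close> conjugate \<open>par \<Theta>\<close> in the same way, and
  \<open>r x\<close> belongs to \<open>par \<Theta>\<close>.\<close>

lemma conj_par_eq:
  assumes x: "x \<in> carrier P" and sub: "cj x ` par \<Theta> \<subseteq> par \<Theta>"
  shows "cj x ` par \<Theta> = par \<Theta>"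
proof
  show "par \<Theta> \<subseteq> cj x ` par \<Theta>"
  proof
    fix s assume s: "s \<in> par \<Theta>"
    obtain r where r: "r \<in> hom P P" "\<And>x. x \<in> par \<Theta> \<Longrightarrow> r x = x"
      "\<And>x. x \<in> carrier P \<Longrightarrow> r x \<in> par \<Theta>" "\<And>x \<Theta>'. x \<in> par \<Theta>' \<Longrightarrow> \<Theta> \<inter> \<Theta>' = {} \<Longrightarrow> r x = \<one>"
      by (rule retraction[of \<Theta>]) blast
    interpret r: group_hom P P r by unfold_locales (rule r(1))
    have "s \<in> cj (r x) ` par \<Theta>" using cj_par[OF r(3)[OF x]] s by simp
    then obtain s0 where s0: "s0 \<in> par \<Theta>" "s = cj (r x) s0" by blast
    have c0: "s0 \<in> carrier P" by (rule par_closed[OF s0(1)])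
    have "cj x s0 \<in> par \<Theta>" using sub s0(1) by blast
    then have "cj x s0 = r (cj x s0)" using r(2) by simp
    also have "\<dots> = cj (r x) (r s0)" using x c0 by (simp add: cj_def)
    also have "\<dots> = s" using s0 r(2) by simp
    finally show "s \<in> cj x ` par \<Theta>" using s0(1) by blast
  qed
qed (rule sub)

lemma par_Int_conj2:
  assumes g: "g \<in> carrier P" and k: "k \<in> carrier P"
  obtains h \<Xi> where "h \<in> carrier P" "\<Xi> \<subseteq> \<Theta> \<inter> \<Theta>'" "cj g ` par \<Theta> \<inter> cj k ` par \<Theta>' = cj h ` par \<Xi>"
proof -
  have x: "inv g \<otimes> k \<in> carrier P" using g k by simp
  obtain h \<Xi> where h: "h \<in> par \<Theta>" "\<Xi> \<subseteq> \<Theta> \<inter> \<Theta>'" "par \<Theta> \<inter> cj (inv g \<otimes> k) ` par \<Theta>' = cj h ` par \<Xi>"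
    using par_Int_conj[OF x, of \<Theta> \<Theta>'] by blast
  have hc: "h \<in> carrier P" by (rule par_closed[OF h(1)])
  have "cj k ` par \<Theta>' = cj g ` cj (inv g \<otimes> k) ` par \<Theta>'"
    unfolding cj_image_cj[OF g x par_subset] using g k by (simp add: m_assoc[symmetric])
  then have "cj g ` par \<Theta> \<inter> cj k ` par \<Theta>' = cj g ` cj h ` par \<Xi>"
    using cj_image_Int[OF g par_subset cj_image_closed[OF x par_subset], of \<Theta> \<Theta>'] h(3) by simp
  also have "\<dots> = cj (g \<otimes> h) ` par \<Xi>" by (rule cj_image_cj[OF g hc par_subset])
  finally show thesis using that[of "g \<otimes> h" \<Xi>] g hc h(2) by simp
qed

text \<open>Let \<open>\<Lambda>\<close> be smallest with \<open>S\<close> in a conjugate of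
  \<open>par \<Lambda>\<close>. As intersections of conjugates are again of this form,
  \<open>\<Lambda>\<close> lies in every \<open>\<Theta>\<close> with the same property. For
  \<open>v \<in> \<Lambda>\<close> this excludes \<open>- {v}\<close>, so ellipticity at
  \<open>v\<close> gives \<open>\<Lambda> \<subseteq> st v\<close>.\<close>

lemma elliptic_clique:
  assumes S: "S \<subseteq> carrier P" and ell: "\<And>v. v \<in> V \<Longrightarrow> ell v S"
  obtains g \<Lambda> where "g \<in> carrier P" "clique \<Lambda>" "S \<subseteq> cj g ` par \<Lambda>"
proof -
  define R where "R \<Lambda> \<longleftrightarrow> \<Lambda> \<subseteq> V \<and> (\<exists>g\<in>carrier P. S \<subseteq> cj g ` par \<Lambda>)" for \<Lambda>
  have "S \<subseteq> cj \<one> ` par V"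
  proof
    fix s assume "s \<in> S"
    then have "s \<in> par V" "s = cj \<one> s" using S par_verts by auto
    then show "s \<in> cj \<one> ` par V" by blast
  qed
  then have "R V" by (auto simp: R_def)
  from ex_has_least_nat[of R V card, OF this]
  obtain \<Lambda> where \<Lambda>: "R \<Lambda>" and min: "\<forall>\<Xi>. R \<Xi> \<longrightarrow> card \<Lambda> \<le> card \<Xi>" by blast
  obtain g where g: "g \<in> carrier P" "S \<subseteq> cj g ` par \<Lambda>" "\<Lambda> \<subseteq> V" using \<Lambda> by (auto simp: R_def)
  have fin: "finite \<Lambda>" using g(3) fin_verts finite_subset by blast
  have inside: "\<Lambda> \<subseteq> \<Theta>" if k: "k \<in> carrier P" "cj k ` S \<subseteq> par \<Theta>" for k \<Theta>
  proof -
    have "S \<subseteq> cj (inv k) ` par \<Theta>" using cj_subset_iff[OF k(1) S par_subset] k(2) by simp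
    moreover obtain h \<Xi> where h: "h \<in> carrier P" "\<Xi> \<subseteq> \<Lambda> \<inter> \<Theta>"
      "cj g ` par \<Lambda> \<inter> cj (inv k) ` par \<Theta> = cj h ` par \<Xi>"
      by (rule par_Int_conj2[OF g(1) inv_closed[OF k(1)]])
    ultimately have "S \<subseteq> cj h ` par \<Xi>" using g(2) by (metis Int_greatest)
    then have "R \<Xi>" using g(3) h(1,2) unfolding R_def by blast
    then have "card \<Lambda> \<le> card \<Xi>" using min by blast
    moreover have "\<Xi> \<subseteq> \<Lambda>" using h(2) by blast
    ultimately have "\<Xi> = \<Lambda>" using card_seteq[OF fin] by blast
    then show ?thesis using h(2) by blast
  qed
  have "\<Lambda> \<subseteq> st v" if v: "v \<in> \<Lambda>" for v
  proof -
    have "ell v S" using ell v g(3) by blast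
    then obtain k where k: "k \<in> carrier P" "cj k ` S \<subseteq> par (st v) \<or> cj k ` S \<subseteq> par (- {v})"
      by (auto simp: ell_def)
    then show ?thesis using inside[OF k(1), of "st v"] inside[OF k(1), of "- {v}"] v by blast
  qed
  then have "clique \<Lambda>" using g(3) unfolding clique_def st_def lk_def by blast
  then show thesis using that g(1,2) by blast
qed

end

locale rigid_decomp = graph_decomp +
  assumes irr: "u \<in> V \<Longrightarrow> graphically_irreducible (G u)"
    and no_prec: "u \<in> V \<Longrightarrow> v \<in> V \<Longrightarrow> u \<noteq> v \<Longrightarrow> \<not> prec_related \<Gamma> u v"
begin

text \<open>Link and star are induced subgraphs, so inclusion of their vertices would entail that of
  their edges and hence \<open>prec \<Gamma> u v\<close>. The hypothesis on
  \<open>prec_related\<close> enters only in this form.\<close>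

lemma separating_neighbour:
  assumes "u \<in> V" "v \<in> V" "u \<noteq> v"
  obtains w where "adj u w" "w \<notin> st v"
proof -
  have "prec \<Gamma> u v" if all: "\<forall>w. adj u w \<longrightarrow> w \<in> st v"
  proof -
    have *: "{w. {u, w} \<in> edges \<Gamma>} \<subseteq> insert v (V \<inter> {w. {v, w} \<in> edges \<Gamma>})"
    proof
      fix w assume "w \<in> {w. {u, w} \<in> edges \<Gamma>}"
      then have w: "adj u w" by (simp add: adj_def)
      then have "w \<in> st v" using all by blast
      then show "w \<in> insert v (V \<inter> {w. {v, w} \<in> edges \<Gamma>})" using adjD(2)[OF w] by (auto simp: st_def lk_def adj_def)
    qed
    show ?thesis
      unfolding prec_def subgraph_def link_def star_def induced_subgraph_def using * by auto
  qed
  then show thesis using no_prec[OF assms] that unfolding prec_related_def by blast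
qed

text \<open>Each \<open>t \<noteq> u\<close> is missing from the star of some neighbour
  \<open>w\<close> of \<open>u\<close>, by \<open>separating_neighbour\<close> and symmetry of
  adjacency, so \<open>x\<close> has no syllable at \<open>t\<close>.\<close>

lemma star_intersection:
  assumes u: "u \<in> V" and x: "x \<in> carrier P" "\<And>w. w \<in> lk u \<Longrightarrow> x \<in> par (st w)"
  shows "x \<in> K u"
proof -
  have "cnt t x = 0" if t: "t \<in> V - {u}" for t
  proof -
    have "t \<in> V" "u \<noteq> t" using t by auto
    then obtain w where w: "adj u w" "w \<notin> st t" using separating_neighbour[OF u] by metis
    have "t \<notin> st w" using w(2) adj_sym by (auto simp: st_def lk_def)
    moreover have "x \<in> par (st w)" by (rule x(2)) (use w(1) in \<open>simp add: lk_def\<close>)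
    ultimately show ?thesis using cnt_par t by blast
  qed
  then have "x \<in> par {u}" using x(1) by (simp add: par_def)
  then show ?thesis using par_singleton[OF u] by simp
qed

text \<open>A vertex \<open>t \<noteq> u\<close> is excluded by a maximal clique through
  \<open>u\<close> and a neighbour \<open>w\<close> of \<open>u\<close> with
  \<open>w \<notin> st t\<close>.\<close>

lemma vertex_group_Int:
  assumes u: "u \<in> V"
  shows "K u = \<Inter> (par ` {Q. max_clique Q \<and> u \<in> Q})"
proof
  show "K u \<subseteq> \<Inter> (par ` {Q. max_clique Q \<and> u \<in> Q})"
    using K_par[OF u] by blast
  show "\<Inter> (par ` {Q. max_clique Q \<and> u \<in> Q}) \<subseteq> K u"
  proof
    fix x assume x: "x \<in> \<Inter> (par ` {Q. max_clique Q \<and> u \<in> Q})"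
    have mem: "x \<in> par Q" if "max_clique Q" "u \<in> Q" for Q using x that by blast
    obtain Q0 where Q0: "max_clique Q0" "{u} \<subseteq> Q0"
      by (rule max_clique_ex[of "{u}"]) (use u in \<open>auto simp: clique_def\<close>)
    have xc: "x \<in> carrier P" using mem[OF Q0(1)] Q0(2) par_closed by blast
    have "cnt t x = 0" if t: "t \<in> V - {u}" for t
    proof -
      have tu: "t \<in> V" "u \<noteq> t" using t by auto
      then obtain w where w: "adj u w" "w \<notin> st t" using separating_neighbour[OF u] by metis
      have "clique {u, w}" using w(1) adjD(2)[OF w(1)] u adj_sym by (auto simp: clique_def)
      then obtain Q where Q: "max_clique Q" "{u, w} \<subseteq> Q" by (rule max_clique_ex)
      have "t \<notin> Q"
      proof
        assume "t \<in> Q"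
        moreover have "w \<noteq> t" using w(2) by (auto simp: st_def)
        ultimately have "adj t w" using clique_adj[of Q t w] Q by (auto simp: max_clique_def)
        then show False using w(2) by (simp add: st_def lk_def)
      qed
      moreover have "x \<in> par Q" using mem[OF Q(1)] Q(2) by blast
      ultimately show ?thesis using cnt_par tu(1) by blast
    qed
    then have "x \<in> par {u}" using xc by (simp add: par_def)
    then show "x \<in> K u" using par_singleton[OF u] by simp
  qed
qed

lemma K_commute_lk: "u \<in> V \<Longrightarrow> x \<in> K u \<Longrightarrow> w \<in> lk u \<Longrightarrow> k \<in> K w \<Longrightarrow> x \<otimes> k = k \<otimes> x"
  using K_commute[of u w x k] by (simp add: lk_def)

text \<open>One non-trivial commuting element per neighbour is enough, since its centralizer already
  lies in \<open>par (st w)\<close>. This permits finite sets of test elements.\<close>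

lemma centralizer_lk:
  assumes u: "u \<in> V" and x: "x \<in> carrier P"
    and c: "\<And>w. w \<in> lk u \<Longrightarrow> \<exists>k\<in>K w. k \<noteq> \<one> \<and> x \<otimes> k = k \<otimes> x"
  shows "x \<in> K u"
proof (rule star_intersection[OF u x])
  fix w assume w: "w \<in> lk u"
  obtain k where k: "k \<in> K w" "k \<noteq> \<one>" "x \<otimes> k = k \<otimes> x" using c[OF w] by blast
  have "w \<in> V" using w lk_verts by blast
  then show "x \<in> par (st w)" by (rule centralizer_K[OF _ k(1,2) x k(3)[symmetric]])
qed

end

text \<open>Both decompositions carry the same assumptions, so every result is also available with
  the roles exchanged (\<open>swap\<close>).\<close>

locale two_decomps = group P + A: rigid_decomp P \<Phi> G \<phi>1 + B: rigid_decomp P \<Psi> H \<phi>2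
  for P :: "'g monoid" (structure) and \<Phi> :: "'v sgraph" and G :: "'v \<Rightarrow> 'a monoid" and \<phi>1
    and \<Psi> :: "'w sgraph" and H :: "'w \<Rightarrow> 'b monoid" and \<phi>2
begin

lemma vertex_group_elliptic_of_centralizer:
  assumes u: "u \<in> A.V" and v: "v \<in> B.V" and S: "S \<subseteq> carrier P"
    and cent: "\<And>x. x \<in> carrier P \<Longrightarrow> x \<in> A.K u \<longleftrightarrow> (\<forall>s\<in>S. x \<otimes> s = s \<otimes> x)"
    and g: "g \<in> carrier P" "cj g ` S \<subseteq> B.par (B.lk v)"
  shows "B.ell v (A.K u)"
proof (rule B.irreducible_centralizer_elliptic[OF v _ A.irr[OF u] A.K_iso[OF u] A.K_subgroup[OF u] S cent g])
  show "group (G u)" using A.grp u by blast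
qed

text \<open>
  If \<open>a\<close> is hyperbolic, the products \<open>b\<^sup>n a\<^sup>m\<close> fixing an edge of its axis still have their common
  centralizer inside \<open>K u\<close>. As it contains \<open>a\<close>, it contains conjugates of \<open>K v\<close> and \<open>K v'\<close> with
  \<open>v\<close>, \<open>v'\<close> not adjacent. These commute with the subgroup of the link of \<open>u\<close>, which is
  therefore conjugate into \<open>par (lk v)\<close>; but its centralizer is \<open>K u\<close>.
\<close>

lemma element_elliptic:
  assumes u: "u \<in> A.V" and v: "v \<in> B.V" and a: "a \<in> A.K u"
  shows "B.ell v {a}"
proof (rule ccontr)
  assume nell: "\<not> B.ell v {a}"
  have ac: "a \<in> carrier P" by (rule A.K_closed[OF u a])
  have "\<exists>g\<in>carrier P. \<forall>b\<in>carrier P. b \<otimes> a = a \<otimes> b \<longrightarrow> b \<noteq> \<one> \<longrightarrow>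
      (\<exists>(n::nat) (m::int). b [^] n \<noteq> \<one> \<and> cj g (b [^] n \<otimes> a [^] m) \<in> B.par (B.lk v))"
  proof (rule B.nonelliptic_centralizer[OF v ac nell])
    fix g assume g: "g \<in> carrier P" and *: "\<And>b. b \<in> carrier P \<Longrightarrow> b \<otimes> a = a \<otimes> b \<Longrightarrow> b \<noteq> \<one> \<Longrightarrow>
      \<exists>(n::nat) (m::int). b [^] n \<noteq> \<one> \<and> cj g (b [^] n \<otimes> a [^] m) \<in> B.par (B.lk v)"
    show ?thesis by (intro bexI[of _ g] ballI impI * g)
  qed
  then obtain g where g: "g \<in> carrier P" and *: "\<forall>b\<in>carrier P. b \<otimes> a = a \<otimes> b \<longrightarrow> b \<noteq> \<one> \<longrightarrow>
      (\<exists>(n::nat) (m::int). b [^] n \<noteq> \<one> \<and> cj g (b [^] n \<otimes> a [^] m) \<in> B.par (B.lk v))"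
    by (elim bexE)
  \<comment> \<open>\<open>k\<close> and \<open>e\<close> stand for the powers of \<open>b\<close>
    and \<open>a\<close>; of the latter only membership in \<open>K u\<close> and commutation with
    \<open>a\<close> are retained.\<close>
  define good where "good w k e \<longleftrightarrow> k \<in> A.K w \<and> k \<noteq> \<one> \<and> e \<in> A.K u \<and> a \<otimes> e = e \<otimes> a \<and>
    cj g (k \<otimes> e) \<in> B.par (B.lk v)" for w k e
  have good_ex: "\<exists>k e. good w k e" if w: "w \<in> A.lk u" for w
  proof -
    have wV: "w \<in> A.V" using w A.lk_verts by blast
    obtain b where b: "b \<in> A.K w" "b \<noteq> \<one>" using A.K_nontrivial[OF wV] by blast
    have bc: "b \<in> carrier P" by (rule A.K_closed[OF wV b(1)])
    have "b \<otimes> a = a \<otimes> b" using A.K_commute_lk[OF u a w b(1)] by simp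
    from mp[OF mp[OF bspec[OF * bc] this] b(2)]
    obtain n :: nat and m :: int where nm: "b [^] n \<noteq> \<one>" "cj g (b [^] n \<otimes> a [^] m) \<in> B.par (B.lk v)" by blast
    have pw: "x [^] (n::nat) \<in> A.K t" if "t \<in> A.V" "x \<in> A.K t" for x t and n :: nat
      by (induction n) (simp_all add: A.K_one[OF that(1)] A.K_mult[OF that(1)] that(2))
    have "a [^] m \<in> A.K u" by (rule subgroup_int_pow_closed[OF A.K_subgroup[OF u] a])
    moreover have "a \<otimes> a [^] m = a [^] m \<otimes> a"
      using int_pow_mult[OF ac, of 1 m] int_pow_mult[OF ac, of m 1] ac by (simp add: add.commute int_pow_1)
    ultimately have "good w (b [^] n) (a [^] m)" using pw[OF wV b(1)] nm unfolding good_def by simp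
    then show ?thesis by (intro exI)
  qed
  define S where "S = {k \<otimes> e | w k e. w \<in> A.lk u \<and> good w k e}"
  have good_cl: "k \<in> carrier P" "e \<in> carrier P" if "w \<in> A.lk u" "good w k e" for w k e
    using that A.K_closed[of w k] A.K_closed[OF u, of e] A.lk_verts by (auto simp: good_def)
  have S: "S \<subseteq> carrier P" using good_cl by (auto simp: S_def)
  have gS: "cj g ` S \<subseteq> B.par (B.lk v)" by (auto simp: S_def good_def)
  have cS: "x \<in> A.K u" if x: "x \<in> carrier P" "\<And>s. s \<in> S \<Longrightarrow> x \<otimes> s = s \<otimes> x" for x
  proof (rule A.star_intersection[OF u x(1)])
    fix w assume w: "w \<in> A.lk u"
    then obtain k e where ke: "good w k e" using good_ex by blast
    have wV: "w \<in> A.V" using w A.lk_verts by blast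
    have s: "k \<otimes> e \<in> S" using ke w unfolding S_def by blast
    have "u \<in> A.lk w" using w A.adj_sym by (simp add: A.lk_def)
    then have e: "e \<in> A.par (A.lk w)" using A.K_par[OF u] ke by (simp add: good_def)
    show "x \<in> A.par (A.st w)"
      by (rule A.centralizer_star[OF wV _ _ e x(1) x(2)[OF s, symmetric]]) (use ke in \<open>simp_all add: good_def\<close>)
  qed
  have aS: "a \<otimes> s = s \<otimes> a" if "s \<in> S" for s
  proof -
    from that obtain w k e where s: "s = k \<otimes> e" "w \<in> A.lk u" "good w k e" by (auto simp: S_def)
    note cl = good_cl[OF s(2,3)]
    have ak: "a \<otimes> k = k \<otimes> a" by (rule A.K_commute_lk[OF u a s(2)]) (use s(3) in \<open>simp add: good_def\<close>)
    have ae: "a \<otimes> e = e \<otimes> a" using s(3) by (simp add: good_def)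
    have "a \<otimes> s = (a \<otimes> k) \<otimes> e" using s(1) cl ac by (simp add: m_assoc)
    also have "\<dots> = k \<otimes> (a \<otimes> e)" unfolding ak using cl ac by (simp add: m_assoc)
    also have "\<dots> = s \<otimes> a" unfolding ae using s(1) cl ac by (simp add: m_assoc)
    finally show ?thesis .
  qed
  obtain g' \<Theta> where g': "g' \<in> carrier P" "\<Theta> \<subseteq> B.lk v" "cj g' ` S \<subseteq> B.par \<Theta>"
    and C: "\<And>x. x \<in> carrier P \<Longrightarrow> (\<And>s. s \<in> S \<Longrightarrow> x \<otimes> s = s \<otimes> x) \<Longrightarrow>
      cj g' x \<in> B.par (\<Theta> \<union> B.perp \<Theta>)"
    by (rule B.minimal_parabolic_centralizer[OF S g gS B.lk_verts]) blast
  \<comment> \<open>Since \<open>a\<close> centralizes \<open>S\<close>, its conjugate lies in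
    \<open>par (\<Theta> \<union> perp \<Theta>)\<close>; if that were contained in
    \<open>par (st v)\<close>, then \<open>a\<close> would be elliptic.\<close>
  have "\<not> B.perp \<Theta> \<subseteq> B.st v"
  proof
    assume "B.perp \<Theta> \<subseteq> B.st v"
    then have "\<Theta> \<union> B.perp \<Theta> \<subseteq> B.st v" using g'(2) by (auto simp: B.st_def)
    then have "cj g' a \<in> B.par (B.st v)" using C[OF ac aS] B.par_mono by blast
    then have "B.ell v {a}" unfolding B.ell_def using g'(1) by blast
    then show False using nell by simp
  qed
  then obtain v' where v': "v' \<in> B.perp \<Theta>" "v' \<notin> B.st v" by blast
  have v'V: "v' \<in> B.V" using v'(1) by (simp add: B.perp_def)
  have vp: "v \<in> B.perp \<Theta>" using v g'(2) B.adj_sym by (auto simp: B.perp_def B.lk_def)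
  have in_A: "cj (inv g') y \<in> A.K u" if y: "y \<in> B.par (B.perp \<Theta>)" for y
  proof (rule cS)
    have yc: "y \<in> carrier P" by (rule B.par_closed[OF y])
    show "cj (inv g') y \<in> carrier P" using g'(1) yc by simp
    fix s assume s: "s \<in> S"
    show "cj (inv g') y \<otimes> s = s \<otimes> cj (inv g') y"
    proof (rule A.centralizer_conj[OF g'(1) yc])
      show "s \<in> carrier P" using s S by blast
      have "cj g' s \<in> B.par \<Theta>" using g'(3) s by blast
      then show "y \<otimes> cj g' s = cj g' s \<otimes> y"
        by (rule B.par_commute[OF y]) (use B.adj_sym in \<open>simp add: B.perp_def\<close>)
    qed
  qed
  let ?B0 = "A.par (A.lk u)"
  have comm: "x \<otimes> b = b \<otimes> x" if "x \<in> A.K u" "b \<in> ?B0" for x b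
    by (rule A.par_commute[of x "{u}" b "A.lk u"]) (use that A.par_singleton[OF u] in \<open>auto simp: A.lk_def\<close>)
  have B0_st: "cj g' b \<in> B.par (B.st z)" if b: "b \<in> ?B0" and z: "z \<in> B.perp \<Theta>" "z \<in> B.V" for b z
  proof -
    have bc: "b \<in> carrier P" by (rule A.par_closed[OF b])
    obtain y where y: "y \<in> B.K z" "y \<noteq> \<one>" using B.K_nontrivial[OF z(2)] by blast
    have yc: "y \<in> carrier P" by (rule B.K_closed[OF z(2) y(1)])
    have "cj (inv g') y \<otimes> b = b \<otimes> cj (inv g') y"
      by (rule comm[OF in_A b]) (rule B.K_par[OF z(2,1) y(1)])
    then have "y \<otimes> cj g' b = cj g' b \<otimes> y"
      using cj_commute_iff[OF g'(1), of "cj (inv g') y" b] g'(1) yc bc by simp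
    then show ?thesis by (rule B.centralizer_K[OF z(2) y cj_closed[OF g'(1) bc]])
  qed
  \<comment> \<open>Neither of \<open>v\<close>, \<open>v'\<close> lies in the star of the other, so
    their stars meet inside \<open>lk v\<close>.\<close>
  have "cj g' ` ?B0 \<subseteq> B.par (B.lk v)"
  proof (rule image_subsetI)
    fix b assume b: "b \<in> ?B0"
    have "cj g' b \<in> B.par (B.st v \<inter> B.st v')"
      using B0_st[OF b vp v] B0_st[OF b v'(1) v'V] B.par_Int by blast
    moreover have "B.st v \<inter> B.st v' \<subseteq> B.lk v" using v'(2) B.adj_sym by (auto simp: B.st_def B.lk_def)
    ultimately show "cj g' b \<in> B.par (B.lk v)" using B.par_mono by blast
  qed
  moreover have "x \<in> A.K u \<longleftrightarrow> (\<forall>s\<in>?B0. x \<otimes> s = s \<otimes> x)" if x: "x \<in> carrier P" for x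
  proof
    show "x \<in> A.K u \<Longrightarrow> \<forall>s\<in>?B0. x \<otimes> s = s \<otimes> x" using comm by blast
    assume c: "\<forall>s\<in>?B0. x \<otimes> s = s \<otimes> x"
    show "x \<in> A.K u"
    proof (rule A.centralizer_lk[OF u x])
      fix w assume w: "w \<in> A.lk u"
      have wV: "w \<in> A.V" using w A.lk_verts by blast
      obtain k where k: "k \<in> A.K w" "k \<noteq> \<one>" using A.K_nontrivial[OF wV] by blast
      have "k \<in> ?B0" by (rule A.K_par[OF wV w k(1)])
      then show "\<exists>k\<in>A.K w. k \<noteq> \<one> \<and> x \<otimes> k = k \<otimes> x" using c k by blast
    qed
  qed
  ultimately have "B.ell v (A.K u)"
    by (rule vertex_group_elliptic_of_centralizer[OF u v A.par_subset _ g'(1), rotated])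
  then show False using nell B.ell_mono a by blast
qed

text \<open>The test elements \<open>k w\<close>, elliptic by \<open>element_elliptic\<close>, form
  a finite set with centralizer \<open>K u\<close>. If they do not lead directly to a fixed point of
  \<open>K u\<close>, they fix a common edge, and the irreducibility argument applies.\<close>

lemma vertex_group_elliptic:
  assumes u: "u \<in> A.V" and v: "v \<in> B.V"
  shows "B.ell v (A.K u)"
proof -
  have "\<exists>k. k \<in> A.K w \<and> k \<noteq> \<one>" if "w \<in> A.lk u" for w
  proof -
    have "w \<in> A.V" using that A.lk_verts by blast
    then show ?thesis using A.K_nontrivial by blast
  qed
  then obtain k where k: "\<And>w. w \<in> A.lk u \<Longrightarrow> k w \<in> A.K w" "\<And>w. w \<in> A.lk u \<Longrightarrow> k w \<noteq> \<one>" by metis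
  have lkV: "w \<in> A.V" if "w \<in> A.lk u" for w using that A.lk_verts by blast
  let ?S = "k ` A.lk u"
  have S: "?S \<subseteq> carrier P"
  proof (rule image_subsetI)
    fix w assume w: "w \<in> A.lk u"
    show "k w \<in> carrier P" by (rule A.K_closed[OF lkV[OF w] k(1)[OF w]])
  qed
  have comm: "x \<otimes> s = s \<otimes> x" if x: "x \<in> A.K u" and "s \<in> ?S" for x s
  proof -
    from that(2) obtain w where w: "w \<in> A.lk u" "s = k w" by blast
    then show ?thesis using A.K_commute_lk[OF u x w(1) k(1)[OF w(1)]] by simp
  qed
  have cent: "x \<in> A.K u \<longleftrightarrow> (\<forall>s\<in>?S. x \<otimes> s = s \<otimes> x)" if x: "x \<in> carrier P" for x
  proof
    show "x \<in> A.K u \<Longrightarrow> \<forall>s\<in>?S. x \<otimes> s = s \<otimes> x" using comm by blast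
    assume c: "\<forall>s\<in>?S. x \<otimes> s = s \<otimes> x"
    show "x \<in> A.K u"
      by (rule A.centralizer_lk[OF u x]) (use c k in blast)
  qed
  have fin: "finite ?S" using finite_subset[OF A.lk_verts A.fin_verts] by simp
  have "B.ell v {s}" if "s \<in> ?S" for s
  proof -
    from that obtain w where w: "w \<in> A.lk u" "s = k w" by blast
    then show ?thesis using element_elliptic[OF lkV[OF w(1)] v k(1)[OF w(1)]] by simp
  qed
  from B.elliptic_or_edge[OF v fin S this subgroup.subset[OF A.K_subgroup[OF u]] comm]
  consider "B.ell v (A.K u)" | g where "g \<in> carrier P" "cj g ` ?S \<subseteq> B.par (B.lk v)" by blast
  then show ?thesis
  proof cases
    case (2 g)
    show ?thesis by (rule vertex_group_elliptic_of_centralizer[OF u v S cent 2])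
  qed
qed

text \<open>The group of an added vertex commutes with the rest of the clique, so
  \<open>ell_commuting\<close> provides a common fixed point of both.\<close>

lemma clique_elliptic:
  assumes Q: "A.clique Q" and v: "v \<in> B.V"
  shows "B.ell v (A.par Q)"
proof -
  have "finite Q" using finite_subset[OF A.clique_verts[OF Q] A.fin_verts] .
  then show ?thesis
    using Q
  proof (induction Q rule: finite_induct)
    case empty
    have triv: "x = \<one>" if "x \<in> A.par {}" for x
      using that by (induction x rule: A.par_induct) auto
    have "cj \<one> x \<in> B.par (B.st v)" if "x \<in> A.par {}" for x
      unfolding triv[OF that] using B.par_one by simp
    then have "cj \<one> ` A.par {} \<subseteq> B.par (B.st v)" by (rule image_subsetI)
    then show ?case unfolding B.ell_def by (intro bexI[of _ \<one>] disjI1) simp_all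
  next
    case (insert u Q)
    have u: "u \<in> A.V" using insert.prems by (simp add: A.clique_def)
    have adj: "A.adj u t" if "t \<in> Q" for t
      by (rule A.clique_adj[OF insert.prems]) (use that insert.hyps in auto)
    have "B.ell v (A.par Q)" using insert.IH A.clique_subset[OF insert.prems] by blast
    then have "B.ell v (A.K u \<union> A.par Q)"
    proof (rule B.ell_commuting[OF v subgroup.subset[OF A.K_subgroup[OF u]] A.par_subset vertex_group_elliptic[OF u v]])
      show "b \<otimes> a = a \<otimes> b" if "a \<in> A.K u" "b \<in> A.par Q" for a b
        by (rule A.par_commute[of b Q a "{u}"]) (use that A.par_singleton[OF u] adj A.adj_sym in auto)
    qed
    then obtain g where g: "g \<in> carrier P" and
      "cj g ` (A.K u \<union> A.par Q) \<subseteq> B.par (B.st v) \<or> cj g ` (A.K u \<union> A.par Q) \<subseteq> B.par (- {v})"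
      by (auto simp: B.ell_def)
    then obtain \<Theta> where \<Theta>: "\<Theta> = B.st v \<or> \<Theta> = - {v}" "cj g ` (A.K u \<union> A.par Q) \<subseteq> B.par \<Theta>" by blast
    have "cj g ` A.par (insert u Q) \<subseteq> B.par \<Theta>"
    proof (rule image_subsetI)
      fix x assume "x \<in> A.par (insert u Q)"
      then have "\<exists>y\<in>A.par {u}. \<exists>z\<in>A.par Q. x = y \<otimes> z"
        by (intro A.par_Un_decomp) (use adj in auto)
      then obtain y z where yz: "y \<in> A.par {u}" "z \<in> A.par Q" "x = y \<otimes> z" by (elim bexE)
      have "cj g y \<in> B.par \<Theta>" "cj g z \<in> B.par \<Theta>"
        using \<Theta>(2) yz(1,2) A.par_singleton[OF u] by auto
      then show "cj g x \<in> B.par \<Theta>"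
        unfolding yz(3) cj_mult[OF g A.par_closed[OF yz(1)] A.par_closed[OF yz(2)]] by (rule B.par_mult)
    qed
    then show ?case unfolding B.ell_def using g \<Theta>(1) by blast
  qed
qed

section \<open>Matching maximal cliques, then vertex-groups\<close>

lemma clique_conj:
  assumes "A.clique Q"
  obtains g \<Lambda> where "g \<in> carrier P" "B.clique \<Lambda>" "A.par Q \<subseteq> cj g ` B.par \<Lambda>"
  by (rule B.elliptic_clique[OF A.par_subset clique_elliptic[OF assms]])


lemma swap: "two_decomps P \<Psi> H \<phi>2 \<Phi> G \<phi>1"
  by unfold_locales

lemma subset_cj_iff:
  assumes "g \<in> carrier P" "S \<subseteq> carrier P" "T \<subseteq> carrier P"
  shows "S \<subseteq> cj g ` T \<longleftrightarrow> cj (inv g) ` S \<subseteq> T"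
  using cj_subset_iff[of "inv g" S T] assms by simp

lemma cj_image_inv:
  assumes "g \<in> carrier P" "T \<subseteq> carrier P" "S = cj g ` T"
  shows "T = cj (inv g) ` S"
proof -
  have "cj (inv g \<otimes> g) ` T = T" using assms(1,2) by (force simp: image_def)
  then show ?thesis using cj_image_cj[OF inv_closed[OF assms(1)] assms(1,2)] assms(3) by simp
qed

text \<open>Passing to the other decomposition and back encloses a conjugate of
  \<open>B.par \<Lambda>\<close> between \<open>A.par Q\<close> and a conjugate of
  \<open>A.par Q'\<close>. Maximality gives \<open>Q = Q'\<close>, and \<open>conj_par_eq\<close>
  turns the inclusions into equalities.\<close>

lemma max_clique_par:
  assumes Q: "A.max_clique Q"
  shows "\<exists>g\<in>carrier P. \<exists>\<Lambda>. A.par Q = cj g ` B.par \<Lambda>"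
proof -
  interpret S: two_decomps P \<Psi> H \<phi>2 \<Phi> G \<phi>1 by (rule swap)
  have clQ: "A.clique Q" using Q by (simp add: A.max_clique_def)
  obtain g \<Lambda> where g: "g \<in> carrier P" "B.clique \<Lambda>" "A.par Q \<subseteq> cj g ` B.par \<Lambda>"
    by (rule clique_conj[OF clQ])
  obtain h Q' where h: "h \<in> carrier P" "A.clique Q'" "B.par \<Lambda> \<subseteq> cj h ` A.par Q'"
    by (rule S.clique_conj[OF g(2)])
  have gh: "inv (g \<otimes> h) \<in> carrier P" using g(1) h(1) by simp
  have "cj g ` B.par \<Lambda> \<subseteq> cj g ` cj h ` A.par Q'" by (rule image_mono[OF h(3)])
  then have up: "cj g ` B.par \<Lambda> \<subseteq> cj (g \<otimes> h) ` A.par Q'"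
    using cj_image_cj[OF g(1) h(1) A.par_subset] by simp
  then have "A.par Q \<subseteq> cj (g \<otimes> h) ` A.par Q'" using g(3) by simp
  then have sub: "cj (inv (g \<otimes> h)) ` A.par Q \<subseteq> A.par Q'"
    using subset_cj_iff[OF m_closed[OF g(1) h(1)] A.par_subset A.par_subset] by simp
  have "Q \<subseteq> Q'" by (rule A.conj_par_subset[OF gh A.clique_verts[OF clQ] sub])
  then have "Q = Q'" by (rule A.max_clique_eq[OF Q h(2)])
  then have "cj (inv (g \<otimes> h)) ` A.par Q = A.par Q" using A.conj_par_eq[OF gh] sub by simp
  then have "A.par Q = cj (g \<otimes> h) ` A.par Q"
    using cj_image_inv[OF gh A.par_subset, of "A.par Q" Q] g(1) h(1) by simp
  then have "A.par Q = cj g ` B.par \<Lambda>" using up g(3) \<open>Q = Q'\<close> by blast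
  then show ?thesis using g(1) by blast
qed

text \<open>\<open>K u\<close> is a finite intersection of the subgroups of maximal cliques, and
  conjugates of parabolic subgroups are closed under such intersections by
  \<open>par_Int_conj2\<close>.\<close>

lemma vertex_group_par:
  assumes u: "u \<in> A.V"
  shows "\<exists>g\<in>carrier P. \<exists>\<Xi>. A.K u = cj g ` B.par \<Xi>"
proof -
  let ?M = "{Q. A.max_clique Q \<and> u \<in> Q}"
  have "?M \<subseteq> Pow A.V" using A.clique_verts by (auto simp: A.max_clique_def)
  then have fin: "finite ?M" by (rule finite_subset) (simp add: A.fin_verts)
  have ne: "?M \<noteq> {}"
  proof -
    obtain Q where "A.max_clique Q" "{u} \<subseteq> Q"
      by (rule A.max_clique_ex[of "{u}"]) (use u in \<open>auto simp: A.clique_def\<close>)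
    then show ?thesis by blast
  qed
  have "\<exists>g\<in>carrier P. \<exists>\<Xi>. \<Inter> (A.par ` M) = cj g ` B.par \<Xi>"
    if "finite M" "M \<noteq> {}" "M \<subseteq> ?M" for M
    using that
  proof (induction M rule: finite_ne_induct)
    case (singleton Q)
    then have "A.max_clique Q" by blast
    then show ?case using max_clique_par[of Q] by simp
  next
    case (insert Q M)
    have "A.max_clique Q" using insert.prems by blast
    then obtain g \<Lambda> where g: "g \<in> carrier P" "A.par Q = cj g ` B.par \<Lambda>" using max_clique_par by blast
    have "\<exists>g\<in>carrier P. \<exists>\<Xi>. \<Inter> (A.par ` M) = cj g ` B.par \<Xi>" using insert.IH insert.prems by blast
    then obtain k \<Xi> where k: "k \<in> carrier P" "\<Inter> (A.par ` M) = cj k ` B.par \<Xi>" by blast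
    obtain h \<Xi>' where h: "h \<in> carrier P" "\<Xi>' \<subseteq> \<Lambda> \<inter> \<Xi>" "cj g ` B.par \<Lambda> \<inter> cj k ` B.par \<Xi> = cj h ` B.par \<Xi>'"
      by (rule B.par_Int_conj2[OF g(1) k(1)])
    have "\<Inter> (A.par ` insert Q M) = cj h ` B.par \<Xi>'" using g(2) k(2) h(3) by simp
    then show ?case using h(1) by blast
  qed
  from this[OF fin ne subset_refl] show ?thesis using A.vertex_group_Int[OF u] by simp
qed

text \<open>Any \<open>v \<in> \<Xi>\<close> serves: \<open>B.K v\<close> is in turn conjugate to a
  parabolic subgroup of the first decomposition, which is then conjugate into \<open>A.K u\<close>.
  So its only vertex is \<open>u\<close>, and \<open>conj_par_eq\<close> shows that
  \<open>cj g\<close> maps \<open>B.K v\<close> onto \<open>A.K u\<close>.\<close>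

lemma vertex_group_conj:
  assumes u: "u \<in> A.V"
  shows "\<exists>v\<in>B.V. \<exists>g\<in>carrier P. A.K u = cj g ` B.K v"
proof -
  interpret S: two_decomps P \<Psi> H \<phi>2 \<Phi> G \<phi>1 by (rule swap)
  obtain g \<Xi> where g: "g \<in> carrier P" "A.K u = cj g ` B.par \<Xi>" using vertex_group_par[OF u] by blast
  have nonempty: "\<Xi> \<inter> B.V \<noteq> {}"
  proof
    assume "\<Xi> \<inter> B.V = {}"
    then have "B.par \<Xi> = B.par {}" using B.par_Int_verts[of \<Xi>] by simp
    moreover have "x = \<one>" if "x \<in> B.par {}" for x
      using that by (induction x rule: B.par_induct) auto
    ultimately have "y = \<one>" if "y \<in> A.K u" for y using that g cj_eq_one[OF g(1) one_closed] by auto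
    then show False using A.K_nontrivial[OF u] by blast
  qed
  then obtain v where v: "v \<in> \<Xi>" "v \<in> B.V" by blast
  obtain h \<Theta> where h: "h \<in> carrier P" "B.K v = cj h ` A.par \<Theta>" using S.vertex_group_par[OF v(2)] by blast
  let ?\<Theta> = "\<Theta> \<inter> A.V"
  \<comment> \<open>Points of \<open>\<Theta>\<close> that are not vertices are discarded, as
    \<open>conj_par_subset\<close> needs \<open>\<Theta> \<subseteq> V\<close>.\<close>
  have h': "B.K v = cj h ` A.par ?\<Theta>" using h(2) A.par_Int_verts by simp
  have gh: "g \<otimes> h \<in> carrier P" using g(1) h(1) by simp
  have "B.K v \<subseteq> B.par \<Xi>" using B.K_par[OF v(2,1)] by blast
  then have sub0: "cj g ` B.K v \<subseteq> A.K u" using g(2) by blast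
  then have sub: "cj (g \<otimes> h) ` A.par ?\<Theta> \<subseteq> A.par {u}"
    using h' cj_image_cj[OF g(1) h(1) A.par_subset] A.par_singleton[OF u] by simp
  then have "?\<Theta> \<subseteq> {u}" by (rule A.conj_par_subset[OF gh, rotated]) simp
  moreover have "?\<Theta> \<noteq> {}"
  proof
    assume e: "?\<Theta> = {}"
    have "x = \<one>" if "x \<in> A.par {}" for x
      using that by (induction x rule: A.par_induct) auto
    then have "y = \<one>" if "y \<in> B.K v" for y using that h' cj_eq_one[OF h(1) one_closed] unfolding e by auto
    then show False using B.K_nontrivial[OF v(2)] by blast
  qed
  ultimately have \<Theta>: "?\<Theta> = {u}" by blast
  have "cj (g \<otimes> h) ` A.par {u} = A.par {u}" by (rule A.conj_par_eq[OF gh]) (use sub \<Theta> in simp)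
  then have "A.K u = cj g ` B.K v"
    using h' \<Theta> cj_image_cj[OF g(1) h(1) A.par_subset[of "{u}"]] A.par_singleton[OF u] by simp
  then show ?thesis using v(2) g(1) by blast
qed

text \<open>A conjugate of \<open>B.K v'\<close> centralizes a non-trivial element of
  \<open>B.K v\<close>, hence lies in \<open>par (st v)\<close>; \<open>conj_par_subset\<close> then
  places \<open>v'\<close> in \<open>st v\<close>.\<close>

lemma adjacent_conj:
  assumes v: "v \<in> B.V" "v' \<in> B.V" "v \<noteq> v'" and u: "A.adj u u'"
    and g: "g \<in> carrier P" "A.K u = cj g ` B.K v" and h: "h \<in> carrier P" "A.K u' = cj h ` B.K v'"
  shows "B.adj v v'"
proof -
  obtain k where k: "k \<in> B.K v" "k \<noteq> \<one>" using B.K_nontrivial[OF v(1)] by blast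
  have kc: "k \<in> carrier P" by (rule B.K_closed[OF v(1) k(1)])
  have x: "inv g \<otimes> h \<in> carrier P" using g(1) h(1) by simp
  have "cj (inv g \<otimes> h) ` B.K v' \<subseteq> B.par (B.st v)"
  proof (rule image_subsetI)
    fix y assume y: "y \<in> B.K v'"
    have yc: "y \<in> carrier P" by (rule B.K_closed[OF v(2) y])
    have "cj g k \<in> A.K u" "cj h y \<in> A.K u'" using g(2) h(2) k(1) y by auto
    then have "cj g k \<otimes> cj h y = cj h y \<otimes> cj g k" by (rule A.K_commute[OF u])
    moreover have "cj h y = cj g (cj (inv g \<otimes> h) y)"
      using g(1) h(1) yc by (simp add: cj_cj m_assoc[symmetric])
    ultimately have "k \<otimes> cj (inv g \<otimes> h) y = cj (inv g \<otimes> h) y \<otimes> k"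
      using cj_commute_iff[OF g(1) kc, of "cj (inv g \<otimes> h) y"] x yc by simp
    then show "cj (inv g \<otimes> h) y \<in> B.par (B.st v)"
      by (rule B.centralizer_K[OF v(1) k cj_closed[OF x yc]])
  qed
  then have "{v'} \<subseteq> B.st v"
    using B.conj_par_subset[OF x, of "{v'}" "B.st v"] v(2) B.par_singleton[OF v(2)] by simp
  then show ?thesis using v(3) by (simp add: B.st_def B.lk_def)
qed

lemma conj_vertex_groups_eq:
  assumes "u \<in> A.V" "u' \<in> A.V" "x \<in> carrier P" "A.K u = cj x ` A.K u'"
  shows "u' = u"
  using A.conj_par_subset[OF assms(3), of "{u'}" "{u}"] assms A.par_singleton by simp

text \<open>Injectivity holds because groups of distinct vertices are never conjugate; surjectivity
  and the converse for edges come from the exchanged decompositions.\<close>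

lemma vertex_bijection:
  obtains s \<gamma> where "bij_betw s A.V B.V"
    "\<And>u. u \<in> A.V \<Longrightarrow> \<gamma> u \<in> carrier P" "\<And>u. u \<in> A.V \<Longrightarrow> A.K u = cj (\<gamma> u) ` B.K (s u)"
    "\<And>u u'. u \<in> A.V \<Longrightarrow> u' \<in> A.V \<Longrightarrow> A.adj u u' \<longleftrightarrow> B.adj (s u) (s u')"
proof -
  interpret S: two_decomps P \<Psi> H \<phi>2 \<Phi> G \<phi>1 by (rule swap)
  have "\<forall>u\<in>A.V. \<exists>v g. v \<in> B.V \<and> g \<in> carrier P \<and> A.K u = cj g ` B.K v" using vertex_group_conj by blast
  then obtain s \<gamma> where *: "\<forall>u\<in>A.V. s u \<in> B.V \<and> \<gamma> u \<in> carrier P \<and> A.K u = cj (\<gamma> u) ` B.K (s u)" by metis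
  have s: "s u \<in> B.V" "\<gamma> u \<in> carrier P" "A.K u = cj (\<gamma> u) ` B.K (s u)" if "u \<in> A.V" for u using * that by auto
  have KB: "B.K v \<subseteq> carrier P" if "v \<in> B.V" for v by (rule subgroup.subset[OF B.K_subgroup[OF that]])
  have KA: "A.K v \<subseteq> carrier P" if "v \<in> A.V" for v by (rule subgroup.subset[OF A.K_subgroup[OF that]])
  have s': "B.K (s u) = cj (inv (\<gamma> u)) ` A.K u" if "u \<in> A.V" for u
    by (rule cj_image_inv[OF s(2)[OF that] KB[OF s(1)[OF that]] s(3)[OF that]])
  have inj: "u = u'" if "u \<in> A.V" "u' \<in> A.V" "s u = s u'" for u u'
  proof -
    have "A.K u' = cj (\<gamma> u') ` cj (inv (\<gamma> u)) ` A.K u" using s(3)[OF that(2)] s'[OF that(1)] that(3) by simp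
    then have "A.K u' = cj (\<gamma> u' \<otimes> inv (\<gamma> u)) ` A.K u"
      using cj_image_cj[OF s(2)[OF that(2)] inv_closed[OF s(2)[OF that(1)]] KA[OF that(1)]] by simp
    then show ?thesis
      by (rule conj_vertex_groups_eq[OF that(2,1), rotated]) (use s(2) that in simp)
  qed
  have surj: "v \<in> s ` A.V" if v: "v \<in> B.V" for v
  proof -
    obtain u h where u: "u \<in> A.V" "h \<in> carrier P" "B.K v = cj h ` A.K u" using S.vertex_group_conj[OF v] by blast
    have "B.K v = cj h ` cj (\<gamma> u) ` B.K (s u)" using u(3) s(3)[OF u(1)] by simp
    then have "B.K v = cj (h \<otimes> \<gamma> u) ` B.K (s u)"
      using cj_image_cj[OF u(2) s(2)[OF u(1)] KB[OF s(1)[OF u(1)]]] by simp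
    then have "s u = v"
      by (rule S.conj_vertex_groups_eq[OF v s(1)[OF u(1)], rotated]) (use s(2) u in simp)
    then show ?thesis using u(1) by blast
  qed
  have "bij_betw s A.V B.V" unfolding bij_betw_def inj_on_def using inj surj s(1) by blast
  moreover have "A.adj u u' \<longleftrightarrow> B.adj (s u) (s u')" if u: "u \<in> A.V" "u' \<in> A.V" for u u'
  proof
    assume a: "A.adj u u'"
    then have "s u \<noteq> s u'" using inj[OF u] A.adjD(3) by blast
    then show "B.adj (s u) (s u')"
      by (rule adjacent_conj[OF s(1)[OF u(1)] s(1)[OF u(2)] _ a s(2,3)[OF u(1)] s(2,3)[OF u(2)]])
  next
    assume a: "B.adj (s u) (s u')"
    then have "u \<noteq> u'" using B.adjD(3) by blast
    then show "A.adj u u'"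
      by (rule S.adjacent_conj[OF u _ a inv_closed[OF s(2)[OF u(1)]] s'[OF u(1)] inv_closed[OF s(2)[OF u(2)]] s'[OF u(2)]])
  qed
  ultimately show thesis using that s(2,3) by blast
qed

text \<open>The conjugators vary with \<open>u\<close>, yet conjugating each \<open>K u\<close> by
  its own inverse conjugator extends to \<open>P\<close>, since adjacent vertex-groups are sent to
  the vertex-groups of adjacent, hence commuting, vertices. The universal property of the other
  decomposition supplies the inverse map.\<close>

lemma vertex_isomorphism:
  obtains s \<theta> where "bij_betw s A.V B.V"
    "\<And>u u'. u \<in> A.V \<Longrightarrow> u' \<in> A.V \<Longrightarrow> A.adj u u' \<longleftrightarrow> B.adj (s u) (s u')"
    "\<theta> \<in> iso P P" "\<And>u. u \<in> A.V \<Longrightarrow> \<theta> ` A.K u = B.K (s u)"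
    "\<And>u. u \<in> A.V \<Longrightarrow> \<exists>g\<in>carrier P. \<theta> ` A.K u = cj g ` A.K u"
proof -
  obtain s \<gamma> where s: "bij_betw s A.V B.V"
    and \<gamma>: "\<And>u. u \<in> A.V \<Longrightarrow> \<gamma> u \<in> carrier P" "\<And>u. u \<in> A.V \<Longrightarrow> A.K u = cj (\<gamma> u) ` B.K (s u)"
    and adj: "\<And>u u'. u \<in> A.V \<Longrightarrow> u' \<in> A.V \<Longrightarrow> A.adj u u' \<longleftrightarrow> B.adj (s u) (s u')"
    by (rule vertex_bijection) blast
  have sV: "s u \<in> B.V" if "u \<in> A.V" for u using s that by (auto simp: bij_betw_def)
  define t where "t = inv_into A.V s"
  have ts: "t (s u) = u" if "u \<in> A.V" for u using s that by (simp add: t_def bij_betw_inv_into_left)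
  have st: "s (t v) = v" "t v \<in> A.V" if "v \<in> B.V" for v
    using bij_betw_inv_into_right[OF s that] bij_betw_inv_into[OF s] that by (auto simp: t_def bij_betw_def)
  have \<gamma>': "B.K (s u) = cj (inv (\<gamma> u)) ` A.K u" if "u \<in> A.V" for u
    by (rule cj_image_inv[OF \<gamma>(1)[OF that] subgroup.subset[OF B.K_subgroup[OF sV[OF that]]] \<gamma>(2)[OF that]])
  have cjA: "cj (inv (\<gamma> u)) a \<in> B.K (s u)" if "u \<in> A.V" "a \<in> A.K u" for u a
    using \<gamma>'[OF that(1)] that(2) by blast
  have cjB: "cj (\<gamma> (t v)) b \<in> A.K (t v)" if "v \<in> B.V" "b \<in> B.K v" for v b
    using \<gamma>(2)[OF st(2)[OF that(1)]] st(1)[OF that(1)] that(2) by simp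
  obtain \<theta> where \<theta>: "\<theta> \<in> hom P P" "\<And>u a. u \<in> A.V \<Longrightarrow> a \<in> A.K u \<Longrightarrow> \<theta> a = cj (inv (\<gamma> u)) a"
  proof (rule A.universal[OF is_group, of "\<lambda>u a. cj (inv (\<gamma> u)) a"])
    show "(\<lambda>a. cj (inv (\<gamma> u)) a) \<in> hom (P\<lparr>carrier := A.K u\<rparr>) P" if u: "u \<in> A.V" for u
      using A.K_closed[OF u] \<gamma>(1)[OF u] cj_mult by (simp add: hom_def)
    show "cj (inv (\<gamma> u)) a \<otimes> cj (inv (\<gamma> u')) b = cj (inv (\<gamma> u')) b \<otimes> cj (inv (\<gamma> u)) a"
      if "A.adj u u'" "a \<in> A.K u" "b \<in> A.K u'" for u u' a b
    proof -
      note V = A.adjD(1,2)[OF that(1)]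
      show ?thesis
        by (rule B.K_commute[of "s u" "s u'"]) (use adj[OF V] that(1) cjA[OF V(1) that(2)] cjA[OF V(2) that(3)] in simp_all)
    qed
  qed blast
  obtain \<eta> where \<eta>: "\<eta> \<in> hom P P" "\<And>v b. v \<in> B.V \<Longrightarrow> b \<in> B.K v \<Longrightarrow> \<eta> b = cj (\<gamma> (t v)) b"
  proof (rule B.universal[OF is_group, of "\<lambda>v b. cj (\<gamma> (t v)) b"])
    show "(\<lambda>b. cj (\<gamma> (t v)) b) \<in> hom (P\<lparr>carrier := B.K v\<rparr>) P" if v: "v \<in> B.V" for v
      using B.K_closed[OF v] \<gamma>(1)[OF st(2)[OF v]] cj_mult by (simp add: hom_def)
    show "cj (\<gamma> (t v)) a \<otimes> cj (\<gamma> (t v')) b = cj (\<gamma> (t v')) b \<otimes> cj (\<gamma> (t v)) a"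
      if "B.adj v v'" "a \<in> B.K v" "b \<in> B.K v'" for v v' a b
    proof -
      note V = B.adjD(1,2)[OF that(1)]
      have "A.adj (t v) (t v')" using adj[OF st(2)[OF V(1)] st(2)[OF V(2)]] st(1)[OF V(1)] st(1)[OF V(2)] that(1) by simp
      then show ?thesis by (rule A.K_commute[OF _ cjB[OF V(1) that(2)] cjB[OF V(2) that(3)]])
    qed
  qed blast
  have \<eta>\<theta>: "\<eta> (\<theta> x) = x" if x: "x \<in> carrier P" for x
  proof -
    have "(\<eta> \<circ> \<theta>) x = (\<lambda>x. x) x"
    proof (rule A.hom_eqI[OF is_group Group.hom_compose[OF \<theta>(1) \<eta>(1)] _ _ x])
      show "(\<lambda>x. x) \<in> hom P P" by (simp add: hom_def)
      fix u a assume u: "u \<in> A.V" "a \<in> A.K u"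
      have "\<eta> (cj (inv (\<gamma> u)) a) = cj (\<gamma> u) (cj (inv (\<gamma> u)) a)"
        using \<eta>(2)[OF sV[OF u(1)] cjA[OF u]] ts[OF u(1)] by simp
      then show "(\<eta> \<circ> \<theta>) a = a" using \<theta>(2)[OF u] \<gamma>(1)[OF u(1)] A.K_closed[OF u] by simp
    qed
    then show ?thesis by simp
  qed
  have \<theta>\<eta>: "\<theta> (\<eta> x) = x" if x: "x \<in> carrier P" for x
  proof -
    have "(\<theta> \<circ> \<eta>) x = (\<lambda>x. x) x"
    proof (rule B.hom_eqI[OF is_group Group.hom_compose[OF \<eta>(1) \<theta>(1)] _ _ x])
      show "(\<lambda>x. x) \<in> hom P P" by (simp add: hom_def)
      fix v b assume v: "v \<in> B.V" "b \<in> B.K v"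
      have "\<theta> (cj (\<gamma> (t v)) b) = cj (inv (\<gamma> (t v))) (cj (\<gamma> (t v)) b)"
        by (rule \<theta>(2)[OF st(2)[OF v(1)] cjB[OF v]])
      then show "(\<theta> \<circ> \<eta>) b = b" using \<eta>(2)[OF v] \<gamma>(1)[OF st(2)[OF v(1)]] B.K_closed[OF v] by simp
    qed
    then show ?thesis by simp
  qed
  have "bij_betw \<theta> (carrier P) (carrier P)"
    by (rule bij_betw_byWitness[where f' = \<eta>])
      (use \<eta>\<theta> \<theta>\<eta> hom_in_carrier[OF \<theta>(1)] hom_in_carrier[OF \<eta>(1)] in auto)
  then have iso: "\<theta> \<in> iso P P" using \<theta>(1) by (simp add: iso_def)
  have im: "\<theta> ` A.K u = cj (inv (\<gamma> u)) ` A.K u" if "u \<in> A.V" for u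
    by (rule image_cong) (use \<theta>(2)[OF that] in simp_all)
  show thesis
  proof (rule that[OF s adj iso])
    show "\<theta> ` A.K u = B.K (s u)" if "u \<in> A.V" for u using im[OF that] \<gamma>'[OF that] by simp
    show "\<exists>g\<in>carrier P. \<theta> ` A.K u = cj g ` A.K u" if "u \<in> A.V" for u
      using im[OF that] \<gamma>(1)[OF that] by (intro bexI[of _ "inv (\<gamma> u)"]) simp_all
  qed
qed

end

theorem theorem8p1:
  fixes \<Phi> :: "'v sgraph" and \<Psi> :: "'w sgraph"
    and G :: "'v \<Rightarrow> 'a monoid" and H :: "'w \<Rightarrow> 'b monoid"
    and \<phi> :: "('v \<times> 'a) list set set \<Rightarrow> ('w \<times> 'b) list set set"
  assumes "simplicial_graph \<Phi>" and "finite (verts \<Phi>)"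
    and "simplicial_graph \<Psi>" and "finite (verts \<Psi>)"
    and "vertex_groups \<Phi> G" and "\<And>u. u \<in> verts \<Phi> \<Longrightarrow> graphically_irreducible (G u)"
    and "vertex_groups \<Psi> H" and "\<And>v. v \<in> verts \<Psi> \<Longrightarrow> graphically_irreducible (H v)"
    and "\<And>u v. u \<in> verts \<Phi> \<Longrightarrow> v \<in> verts \<Phi> \<Longrightarrow> u \<noteq> v \<Longrightarrow> \<not> prec_related \<Phi> u v"
    and "\<And>u v. u \<in> verts \<Psi> \<Longrightarrow> v \<in> verts \<Psi> \<Longrightarrow> u \<noteq> v \<Longrightarrow> \<not> prec_related \<Psi> u v"
    and "\<phi> \<in> iso (graph_product \<Phi> G) (graph_product \<Psi> H)"
  shows "\<exists>\<alpha>\<in>auto (graph_product \<Phi> G). \<exists>s.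
    conjugating \<Phi> G \<alpha> \<and> graph_isometry \<Phi> \<Psi> s \<and>
    (\<forall>u\<in>verts \<Phi>. \<phi> \<circ> \<alpha> \<in>
       iso ((graph_product \<Phi> G)\<lparr>carrier := vertex_subgroup \<Phi> G u\<rparr>)
           ((graph_product \<Psi> H)\<lparr>carrier := vertex_subgroup \<Psi> H (s u)\<rparr>))"
proof -
  let ?N = "graph_product \<Phi> G" and ?P = "graph_product \<Psi> H"
  have grpG: "\<forall>u\<in>verts \<Phi>. group (G u)" and grpH: "\<forall>v\<in>verts \<Psi>. group (H v)"
    using assms(5,7) by (auto simp: vertex_groups_def)
  interpret N: group ?N by (rule group_graph_product[OF assms(1) grpG])
  interpret P: group ?P by (rule group_graph_product[OF assms(3) grpH])
  have id: "(\<lambda>x. x) \<in> iso ?P ?P" by (simp add: iso_def hom_def bij_betw_def)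
  \<comment> \<open>Both decompositions live in the target graph product: the first through
    \<open>\<phi>\<close>, the second through the identity.\<close>
  interpret T: two_decomps ?P \<Phi> G \<phi> \<Psi> H "\<lambda>x. x"
    by unfold_locales (use assms id in auto)
  have KA: "T.A.K u = \<phi> ` vertex_subgroup \<Phi> G u" for u
    by (auto simp: T.A.K_def T.A.\<iota>_def vertex_subgroup_def)
  have KB: "T.B.K v = vertex_subgroup \<Psi> H v" for v
    by (auto simp: T.B.K_def T.B.\<iota>_def vertex_subgroup_def)
  obtain s \<theta> where s: "bij_betw s (verts \<Phi>) (verts \<Psi>)"
    and adj: "\<And>u u'. u \<in> verts \<Phi> \<Longrightarrow> u' \<in> verts \<Phi> \<Longrightarrow> T.A.adj u u' \<longleftrightarrow> T.B.adj (s u) (s u')"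
    and \<theta>: "\<theta> \<in> iso ?P ?P" and \<theta>K: "\<And>u. u \<in> verts \<Phi> \<Longrightarrow> \<theta> ` T.A.K u = T.B.K (s u)"
    and \<theta>c: "\<And>u. u \<in> verts \<Phi> \<Longrightarrow> \<exists>g\<in>carrier ?P. \<theta> ` T.A.K u = P.cj g ` T.A.K u"
    by (rule T.vertex_isomorphism) blast
  define \<psi> where "\<psi> = inv_into (carrier ?N) \<phi>"
  have \<psi>: "\<psi> \<in> iso ?P ?N" unfolding \<psi>_def by (rule N.iso_set_sym[OF assms(11)])
  have \<phi>b: "bij_betw \<phi> (carrier ?N) (carrier ?P)" using assms(11) by (simp add: iso_def)
  have \<psi>\<phi>: "\<psi> (\<phi> x) = x" if "x \<in> carrier ?N" for x
    unfolding \<psi>_def using \<phi>b that by (rule bij_betw_inv_into_left)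
  have \<phi>\<psi>: "\<phi> (\<psi> y) = y" if "y \<in> carrier ?P" for y
    unfolding \<psi>_def using \<phi>b that by (rule bij_betw_inv_into_right)
  have hom\<phi>: "\<phi> \<in> hom ?N ?P" and hom\<psi>: "\<psi> \<in> hom ?P ?N" and hom\<theta>: "\<theta> \<in> hom ?P ?P"
    using assms(11) \<psi> \<theta> by (auto simp: iso_def)
  have VN: "vertex_subgroup \<Phi> G u \<subseteq> carrier ?N" if "u \<in> verts \<Phi>" for u
    using hom_in_carrier[OF vertex_incl_hom[OF assms(1) grpG that]] by (auto simp: vertex_subgroup_def)
  have KP: "T.A.K u \<subseteq> carrier ?P" if "u \<in> verts \<Phi>" for u
    using VN[OF that] hom_in_carrier[OF hom\<phi>] by (auto simp: KA)
  \<comment> \<open>\<open>\<theta>\<close> transported to the first graph product, so that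
    composing with \<open>\<phi>\<close> yields \<open>\<theta> \<circ> \<phi>\<close> on the
    carrier.\<close>
  define \<beta> where "\<beta> = \<psi> \<circ> \<theta> \<circ> \<phi>"
  have \<beta>: "\<beta> \<in> iso ?N ?N"
    unfolding \<beta>_def using iso_set_trans[OF assms(11) iso_set_trans[OF \<theta> \<psi>]] by (simp add: comp_assoc)
  then have hom\<beta>: "\<beta> \<in> hom ?N ?N" and \<beta>b: "bij_betw \<beta> (carrier ?N) (carrier ?N)"
    by (auto simp: iso_def)
  \<comment> \<open>Members of \<open>auto\<close> are extensional on the carrier, hence the
    restriction.\<close>
  define \<alpha> where "\<alpha> = restrict \<beta> (carrier ?N)"
  have \<alpha>: "\<alpha> x = \<psi> (\<theta> (\<phi> x))" if "x \<in> carrier ?N" for x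
    using that by (simp add: \<alpha>_def \<beta>_def)
  have \<phi>\<alpha>: "\<phi> (\<alpha> x) = \<theta> (\<phi> x)" if "x \<in> carrier ?N" for x
    using \<alpha>[OF that] \<phi>\<psi>[OF hom_in_carrier[OF hom\<theta> hom_in_carrier[OF hom\<phi> that]]] by simp
  have "bij_betw \<alpha> (carrier ?N) (carrier ?N)"
    using \<beta>b unfolding \<alpha>_def by (simp add: bij_betw_def inj_on_restrict_eq)
  moreover have hom\<alpha>: "\<alpha> \<in> hom ?N ?N"
    using hom\<beta> by (auto simp: \<alpha>_def hom_def)
  ultimately have auto_\<alpha>: "\<alpha> \<in> auto ?N" by (simp add: auto_def Bij_def \<alpha>_def)
  have "conjugating \<Phi> G \<alpha>"
    unfolding conjugating_def
  proof
    fix u assume u: "u \<in> verts \<Phi>"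
    \<comment> \<open>\<open>\<theta>\<close> carries each \<open>K u\<close> to a conjugate of
      itself, so \<open>v = u\<close> is the witness.\<close>
    obtain g where g: "g \<in> carrier ?P" "\<theta> ` T.A.K u = P.cj g ` T.A.K u" using \<theta>c[OF u] by blast
    have cj\<psi>: "\<psi> (P.cj g (\<phi> x)) = \<psi> g \<otimes>\<^bsub>?N\<^esub> x \<otimes>\<^bsub>?N\<^esub> inv\<^bsub>?N\<^esub> (\<psi> g)" if x: "x \<in> carrier ?N" for x
    proof -
      interpret h: group_hom ?P ?N \<psi> by unfold_locales (rule hom\<psi>)
      have "\<phi> x \<in> carrier ?P" by (rule hom_in_carrier[OF hom\<phi> x])
      then show ?thesis using g(1) \<psi>\<phi>[OF x] by (simp add: P.cj_def)
    qed
    have "\<alpha> ` vertex_subgroup \<Phi> G u = \<psi> ` \<theta> ` \<phi> ` vertex_subgroup \<Phi> G u"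
      unfolding image_image by (rule image_cong) (use \<alpha> VN[OF u] in auto)
    also have "\<dots> = \<psi> ` P.cj g ` \<phi> ` vertex_subgroup \<Phi> G u" using g(2) unfolding KA by simp
    also have "\<dots> = conjugate_subgroup ?N (\<psi> g) (vertex_subgroup \<Phi> G u)"
      unfolding image_image conjugate_subgroup_def by (rule image_cong) (use cj\<psi> VN[OF u] in auto)
    finally show "\<exists>v\<in>verts \<Phi>. \<exists>g\<in>carrier ?N. \<alpha> ` vertex_subgroup \<Phi> G u =
        conjugate_subgroup ?N g (vertex_subgroup \<Phi> G v)"
      using u hom_in_carrier[OF hom\<psi> g(1)] by (intro bexI[of _ u] bexI[of _ "\<psi> g"])
  qed
  moreover have "graph_isometry \<Phi> \<Psi> s"
    unfolding graph_isometry_def using s adj by (auto simp: T.A.adj_def T.B.adj_def)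
  moreover have "\<phi> \<circ> \<alpha> \<in> iso (?N\<lparr>carrier := vertex_subgroup \<Phi> G u\<rparr>) (?P\<lparr>carrier := vertex_subgroup \<Psi> H (s u)\<rparr>)"
    if u: "u \<in> verts \<Phi>" for u
  proof -
    have im: "(\<phi> \<circ> \<alpha>) ` vertex_subgroup \<Phi> G u = vertex_subgroup \<Psi> H (s u)"
    proof -
      have "(\<phi> \<circ> \<alpha>) ` vertex_subgroup \<Phi> G u = \<theta> ` \<phi> ` vertex_subgroup \<Phi> G u"
        unfolding image_image by (rule image_cong) (use \<phi>\<alpha> VN[OF u] in auto)
      then show ?thesis using \<theta>K[OF u] by (simp add: KA KB)
    qed
    have "inj_on (\<theta> \<circ> \<phi>) (carrier ?N)"
      using bij_betw_trans[OF \<phi>b, of \<theta> "carrier ?P"] \<theta> by (simp add: iso_def bij_betw_def)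
    then have "inj_on (\<phi> \<circ> \<alpha>) (vertex_subgroup \<Phi> G u)"
      using VN[OF u] \<phi>\<alpha> by (auto simp: inj_on_def subset_iff)
    then have "bij_betw (\<phi> \<circ> \<alpha>) (vertex_subgroup \<Phi> G u) (vertex_subgroup \<Psi> H (s u))"
      using im by (simp add: bij_betw_def)
    moreover have "\<phi> \<circ> \<alpha> \<in> hom (?N\<lparr>carrier := vertex_subgroup \<Phi> G u\<rparr>) (?P\<lparr>carrier := vertex_subgroup \<Psi> H (s u)\<rparr>)"
    proof (rule homI)
      fix x assume "x \<in> carrier (?N\<lparr>carrier := vertex_subgroup \<Phi> G u\<rparr>)"
      then show "(\<phi> \<circ> \<alpha>) x \<in> carrier (?P\<lparr>carrier := vertex_subgroup \<Psi> H (s u)\<rparr>)" using im by auto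
    next
      fix x y assume "x \<in> carrier (?N\<lparr>carrier := vertex_subgroup \<Phi> G u\<rparr>)" "y \<in> carrier (?N\<lparr>carrier := vertex_subgroup \<Phi> G u\<rparr>)"
      then have "x \<in> carrier ?N" "y \<in> carrier ?N" using VN[OF u] by auto
      then show "(\<phi> \<circ> \<alpha>) (x \<otimes>\<^bsub>?N\<lparr>carrier := vertex_subgroup \<Phi> G u\<rparr>\<^esub> y) =
          (\<phi> \<circ> \<alpha>) x \<otimes>\<^bsub>?P\<lparr>carrier := vertex_subgroup \<Psi> H (s u)\<rparr>\<^esub> (\<phi> \<circ> \<alpha>) y"
        using hom_mult[OF Group.hom_compose[OF hom\<alpha> hom\<phi>]] by simp
    qed
    ultimately show ?thesis by (simp add: iso_def)
  qed
  ultimately show ?thesis using auto_\<alpha> by blast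
qed

end
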